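(* Let $N,m,k\ge 1$ be integers, let $p,q>0$, and let $K$ be a potential satisfying the assumptions listed in the context. Consider the problem $$(P)\qquad \begin{cases}\dfrac{\partial^k u}{\partial t^k}+(-\Delta)^m u\ \ge\ (K\ast |u|^p)|u|^q & \text{in } \mathbb R^{N+1}_+=\mathbb R^N\times(0,\infty),\\[2mm] \dfrac{\partial^i u}{\partial t^i}(x,0)=u_i(x) & \text{in }\mathbb R^N,\ 0\le i\le k-1.\end{cases}$$ (i) If $k$ is an even integer and $q\ge 1$, then $(P)$ admits (for suitable initial data $u_0,\dots,u_{k-1}$) positive solutions $u\in C^\infty(\mathbb R^{N+1}_+)$ which satisfy $$u_{k-1}=\frac{\partial^{k-1}u}{\partial t^{k-1}}(\cdot,0)<0\quad\text{in }\mathbb R^N .$$ (ii) If $p+q>2$ and $$\limsup_{R\to\infty}K(R)\,R^{\frac{2N+2m/k}{p+q}-N+2m(1-1/k)}>0,$$ then $(P)$ has no nontrivial weak solutions $u$ (that is, every weak solution is $u\equiv0$ a.e.) whose initial data $u_0,\dots,u_{k-1}\in L^1_{\rm loc}(\mathbb R^N)$ are such that $$\text{either}\quad u_{k-1}\ge 0,\qquad\text{or}\qquad u_{k-1}\in L^1(\mathbb R^N)\ \text{ and }\ \int_{\mathbb R^N}u_{k-1}(x)\,dx>0 .$$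
   Context: Write $\mathbb R_+=(0,\infty)$ and $\mathbb R^{N+1}_+=\mathbb R^N\times\mathbb R_+$. Assumptions on $K$: $K\in C(\mathbb R_+;\mathbb R_+)$ (continuous and positive), $x\mapsto K(|x|)$ belongs to $L^1_{\rm loc}(\mathbb R^N)$, and there exists $R_0>1$ such that $\inf_{r\in(0,R)}K(r)=K(R)$ for all $R>R_0$. Convolution: $(K\ast|u|^p)(x,t)=\int_{\mathbb R^N}K(|x-y|)\,|u(y,t)|^p\,dy$, which is required to be finite for almost all $(x,t)\in\mathbb R^{N+1}_+$. Weak solution: given initial data $u_0,\dots,u_{k-1}\in L^1_{\rm loc}(\mathbb R^N)$, a weak solution of $(P)$ is a function $u\in L^p_{\rm loc}$ such that $(K\ast|u|^p)|u|^q\in L^1_{\rm loc}$ (local integrability being understood on $\mathbb R^N\times[0,\infty)$) and, for every nonnegative $\varphi\in C_c^\infty(\mathbb R^N\times\mathbb R)$, $$\sum_{i=1}^k(-1)^i\int_{\mathbb R^N}u_{k-i}(x)\frac{\partial^{i-1}\varphi}{\partial t^{i-1}}(x,0)\,dx+\int_{\mathbb R^{N+1}_+}u\Big[(-1)^k\frac{\partial^k\varphi}{\partial t^k}+(-\Delta)^m\varphi\Big]dx\,dt\ \ge\ \int_{\mathbb R^{N+1}_+}(K\ast|u|^p)|u|^q\varphi\,dx\,dt ,$$ with the integrals in this inequality well defined. Any classical solution is a weak solution. *)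

theory Defs
  imports "HOL-Analysis.Analysis"
begin

section \<open>Smooth functions and differential operators\<close>

text \<open>
  Only meaningful for open \<open>S\<close>: the derivatives are two-sided. For such \<open>S\<close>, this is
  \<open>f \<in> C\<^sup>n(S)\<close> (all derivatives up to order \<open>n - 1\<close> are differentiable, those of order \<open>n\<close>
  are continuous).
\<close>

primrec Ck_on :: "nat \<Rightarrow> 'a::euclidean_space set \<Rightarrow> ('a \<Rightarrow> real) \<Rightarrow> bool" where
  "Ck_on 0 S f \<longleftrightarrow> continuous_on S f"
| "Ck_on (Suc n) S f \<longleftrightarrow>
     (\<forall>x\<in>S. f differentiable (at x)) \<and>
     (\<forall>v. Ck_on n S (\<lambda>x. frechet_derivative f (at x) v))"

definition smooth_on :: "'a::euclidean_space set \<Rightarrow> ('a \<Rightarrow> real) \<Rightarrow> bool" where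
  "smooth_on S f \<longleftrightarrow> (\<forall>n. Ck_on n S f)"

definition dir_deriv :: "'a::euclidean_space \<Rightarrow> ('a \<Rightarrow> real) \<Rightarrow> 'a \<Rightarrow> real" where
  "dir_deriv v f x = deriv (\<lambda>s. f (x + s *\<^sub>R v)) 0"

definition laplacian :: "('a::euclidean_space \<Rightarrow> real) \<Rightarrow> 'a \<Rightarrow> real" where
  "laplacian f x = (\<Sum>b\<in>Basis. dir_deriv b (dir_deriv b f) x)"

definition neg_laplacian_pow :: "nat \<Rightarrow> ('a::euclidean_space \<Rightarrow> real) \<Rightarrow> 'a \<Rightarrow> real" where
  "neg_laplacian_pow m = (\<lambda>f x. - laplacian f x) ^^ m"

text \<open>Space-time points are pairs \<open>(x, t)\<close>; the operators act on one of the two variables.\<close>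

definition time_deriv :: "nat \<Rightarrow> ('a \<times> real \<Rightarrow> real) \<Rightarrow> 'a \<times> real \<Rightarrow> real" where
  "time_deriv i u z = (deriv ^^ i) (\<lambda>s. u (fst z, s)) (snd z)"

definition space_polyharmonic ::
    "nat \<Rightarrow> ('a::euclidean_space \<times> real \<Rightarrow> real) \<Rightarrow> 'a \<times> real \<Rightarrow> real" where
  "space_polyharmonic m u z = neg_laplacian_pow m (\<lambda>y. u (y, snd z)) (fst z)"

definition half_space :: "('a \<times> real) set" where
  "half_space = UNIV \<times> {0<..}"

definition closed_half_space :: "('a \<times> real) set" where
  "closed_half_space = UNIV \<times> {0..}"

section \<open>Local integrability\<close>

definition L1_loc :: "'a::euclidean_space set \<Rightarrow> ('a \<Rightarrow> real) \<Rightarrow> bool" where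
  "L1_loc S f \<longleftrightarrow> (\<forall>C. compact C \<and> C \<subseteq> S \<longrightarrow> set_integrable lebesgue C f)"

text \<open>
  Integrability of \<open>\<bar>f\<bar>\<^sup>p\<close> does not imply measurability of \<open>f\<close>, which is therefore
  required separately.
\<close>

definition Lp_loc :: "real \<Rightarrow> 'a::euclidean_space set \<Rightarrow> ('a \<Rightarrow> real) \<Rightarrow> bool" where
  "Lp_loc p S f \<longleftrightarrow> (\<forall>C. compact C \<and> C \<subseteq> S \<longrightarrow>
     set_borel_measurable lebesgue C f \<and> set_integrable lebesgue C (\<lambda>x. \<bar>f x\<bar> powr p))"

section \<open>The convolution term\<close>

text \<open>
  \<open>conv_integrand K p u z\<close> is nonnegative off the null set \<open>{fst z}\<close>, so finiteness of the
  convolution at \<open>z\<close> is its integrability; where that fails, \<open>conv K p u z\<close> is a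
  meaningless \<open>0\<close>.
\<close>

definition conv_integrand ::
    "(real \<Rightarrow> real) \<Rightarrow> real \<Rightarrow> ('a::euclidean_space \<times> real \<Rightarrow> real) \<Rightarrow> 'a \<times> real \<Rightarrow> 'a \<Rightarrow> real" where
  "conv_integrand K p u z = (\<lambda>y. K (norm (fst z - y)) * \<bar>u (y, snd z)\<bar> powr p)"

definition conv ::
    "(real \<Rightarrow> real) \<Rightarrow> real \<Rightarrow> ('a::euclidean_space \<times> real \<Rightarrow> real) \<Rightarrow> 'a \<times> real \<Rightarrow> real" where
  "conv K p u z = integral\<^sup>L lebesgue (conv_integrand K p u z)"

definition rhs_term ::
    "(real \<Rightarrow> real) \<Rightarrow> real \<Rightarrow> real \<Rightarrow> ('a::euclidean_space \<times> real \<Rightarrow> real) \<Rightarrow> 'a \<times> real \<Rightarrow> real" where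
  "rhs_term K p q u z = conv K p u z * \<bar>u z\<bar> powr q"

section \<open>Solutions\<close>

definition test_function :: "('a::euclidean_space \<times> real \<Rightarrow> real) \<Rightarrow> bool" where
  "test_function \<phi> \<longleftrightarrow>
     smooth_on UNIV \<phi> \<and> compact (closure {z. \<phi> z \<noteq> 0}) \<and> (\<forall>z. \<phi> z \<ge> 0)"

text \<open>
  The initial data are \<open>U 0, \<dots>, U (k - 1)\<close>; other values of \<open>U\<close> are irrelevant. Among the
  integrals in the inequality, only the integrability of \<open>u L\<phi>\<close> has to be demanded: it is
  not clear from \<open>u \<in> L\<^sup>p\<^sub>l\<^sub>o\<^sub>c\<close> when \<open>p < 1\<close>, while the other integrands are products of locally
  integrable functions and bounded functions with compact support.
\<close>

definition weak_solution ::
    "nat \<Rightarrow> nat \<Rightarrow> (real \<Rightarrow> real) \<Rightarrow> real \<Rightarrow> real \<Rightarrow>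
     (nat \<Rightarrow> 'a::euclidean_space \<Rightarrow> real) \<Rightarrow> ('a \<times> real \<Rightarrow> real) \<Rightarrow> bool" where
  "weak_solution k m K p q U u \<longleftrightarrow>
     (\<forall>i<k. L1_loc UNIV (U i)) \<and>
     Lp_loc p closed_half_space u \<and>
     (AE z in lebesgue. z \<in> half_space \<longrightarrow> integrable lebesgue (conv_integrand K p u z)) \<and>
     L1_loc closed_half_space (rhs_term K p q u) \<and>
     (\<forall>\<phi>. test_function \<phi> \<longrightarrow>
        (let L\<phi> = (\<lambda>z. (-1)^k * time_deriv k \<phi> z + space_polyharmonic m \<phi> z) in
          set_integrable lebesgue half_space (\<lambda>z. u z * L\<phi> z) \<and>
          (\<Sum>i=1..k. (-1)^i * (LINT x|lebesgue. U (k - i) x * time_deriv (i - 1) \<phi> (x, 0)))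
            + (LINT z:half_space|lebesgue. u z * L\<phi> z)
          \<ge> (LINT z:half_space|lebesgue. rhs_term K p q u z * \<phi> z)))"

text \<open>
  A function that is \<open>C\<^sup>\<infinity>\<close> on the open half-space need not be defined in a useful way at
  \<open>t = 0\<close>. The initial conditions are read as: \<open>\<partial>\<^sub>t\<^sup>i u\<close> extends continuously to the closed
  half-space, with boundary values \<open>U i\<close>.
\<close>

definition smooth_solution ::
    "nat \<Rightarrow> nat \<Rightarrow> (real \<Rightarrow> real) \<Rightarrow> real \<Rightarrow> real \<Rightarrow>
     (nat \<Rightarrow> 'a::euclidean_space \<Rightarrow> real) \<Rightarrow> ('a \<times> real \<Rightarrow> real) \<Rightarrow> bool" where
  "smooth_solution k m K p q U u \<longleftrightarrow>
     smooth_on half_space u \<and>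
     (\<forall>z\<in>half_space. integrable lebesgue (conv_integrand K p u z) \<and>
        time_deriv k u z + space_polyharmonic m u z \<ge> rhs_term K p q u z) \<and>
     (\<forall>i<k. \<forall>x. (time_deriv i u \<longlongrightarrow> U i x) (at (x, 0) within half_space))"

end

(*
(ii) Test the inequality with phi_R(x,t) = Phi(x/R, t/T), T = R^(2m/k), where Phi = w^M is a high power of a
smooth cutoff that does not depend on t near t = 0, so that only u_(k-1) survives among the boundary terms
and |L phi_R| <= C R^(-2m) phi_R^(1/s) with s = (p+q)/2 > 1, L phi_R = 0 where phi_R is constant. Since
K(|x-y|) >= K(R) on the support, Cauchy-Schwarz bounds the nonlinear term below by K(R) J_R, with
J_R = int (int |u|^s phi_R dx)^2 dt. Splitting |u| phi_R^(1/s) <= mu + mu^(1-s) |u|^s phi_R, and then the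
x-integral g(t) <= nu + g(t)^2/nu, gives along radii with K(R) R^alpha >= delta
  J_R <= C' (l + l^(1-2s) J'_R)   for all l > 0,
where J'_R is the part of J_R over the support of L phi_R. Large l bounds J_R, hence J'_R -> 0 as R grows,
and then small l gives J_R -> 0.

(i) Take u(x,t) = exp(-M t) v(x), v(x) = prod_i (1 + x_i^2)^(-n) with n p >= 1. Every derivative of v is v times
a bounded function, and K * v^p is bounded, so M^k u absorbs both (-Delta)^m u and the right-hand side for
large M, while u_(k-1) = (-M)^(k-1) v < 0. The weak form follows from Green's formula on the half-space.
*)
theory Submission
  imports Defs
begin

section \<open>Smooth functions\<close>

text \<open>Convolution with \<open>K\<close> acts at a fixed time, so Cauchy-Schwarz is available
  in \<open>x\<close> but not in \<open>t\<close>. This is why the controlled quantity is the square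
  of an L^2-in-time, L^1-in-space norm and not a plain space-time integral. The exponent in the
  growth condition is forced by the truncation level mu = l R^(-beta): equal powers of R in the two
  error terms require 2 s beta = 2N + 2m/k, and the common power is then exactly R^(-alpha). The
  free factor l survives this scaling; it is what gives u = 0 although K(R) R^alpha is only known to
  stay away from 0. Absorbing J_R into the left-hand side requires J_R to be finite beforehand,
  which comes from local integrability of the right-hand side up to t = 0. Since growth is known
  only along some radii, the estimates are compared with fixed boxes before any limit is taken. In
  (i), parity of k enters twice, through (-M)^k > 0 and (-M)^(k-1) < 0, and q >= 1 serves to bound
  u^q by u, because u <= 1.\<close>

lemma smooth_on_differentiable: "smooth_on S f \<Longrightarrow> x \<in> S \<Longrightarrow> f differentiable (at x)"
  unfolding smooth_on_def by (metis Ck_on.simps(2))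

lemma smooth_on_frechet_derivative:
  "smooth_on S f \<Longrightarrow> smooth_on S (\<lambda>x. frechet_derivative f (at x) v)"
  unfolding smooth_on_def by (metis Ck_on.simps(2))

lemma smooth_on_subset:
  assumes "smooth_on S f" "T \<subseteq> S" shows "smooth_on T f"
proof -
  have "Ck_on n S f \<Longrightarrow> Ck_on n T f" for n
    using assms(2) by (induction n arbitrary: f) (auto intro: continuous_on_subset)
  with assms(1) show ?thesis by (auto simp: smooth_on_def)
qed

text \<open>\<open>Ck_on\<close> recurses through the derivatives of \<open>f\<close>, so an
  induction on a single function does not close. It closes for a class \<open>C\<close> that is
  stable under differentiation; the basic smoothness proofs below exhibit such a class.\<close>

lemma smooth_on_coinduct:
  assumes "f \<in> C"
    and step: "\<And>f. f \<in> C \<Longrightarrow> \<exists>f'. (\<forall>x. (f has_derivative f' x) (at x)) \<and> (\<forall>v. (\<lambda>x. f' x v) \<in> C)"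
  shows "smooth_on UNIV f"
proof -
  have "Ck_on n UNIV f" for n
    using assms(1)
  proof (induction n arbitrary: f)
    case 0
    then obtain f' where "\<forall>x. (f has_derivative f' x) (at x)" using step by blast
    then show ?case
      by (auto simp: continuous_on_eq_continuous_at intro: has_derivative_continuous)
  next
    case (Suc n)
    then obtain f' where f': "\<forall>x. (f has_derivative f' x) (at x)" "\<forall>v. (\<lambda>x. f' x v) \<in> C"
      using step by blast
    have "frechet_derivative f (at x) = f' x" for x
      using f'(1) frechet_derivative_at by metis
    with f' Suc.IH show ?case by (auto simp: differentiable_def)
  qed
  then show ?thesis by (simp add: smooth_on_def)
qed

lemma smooth_has_derivative:
  "smooth_on UNIV f \<Longrightarrow> (f has_derivative frechet_derivative f (at x)) (at x)"
  by (metis UNIV_I frechet_derivative_works smooth_on_differentiable)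

text \<open>Derivatives of products and composites mix sums, products and composites. The three
  closure properties are therefore obtained together, from one hull that is stable under
  differentiation.\<close>

inductive_set smooth_hull :: "('a::euclidean_space \<Rightarrow> real) set" where
  base: "smooth_on UNIV f \<Longrightarrow> f \<in> smooth_hull"
| add: "f \<in> smooth_hull \<Longrightarrow> g \<in> smooth_hull \<Longrightarrow> (\<lambda>x. f x + g x) \<in> smooth_hull"
| mult: "f \<in> smooth_hull \<Longrightarrow> g \<in> smooth_hull \<Longrightarrow> (\<lambda>x. f x * g x) \<in> smooth_hull"
| comp: "smooth_on UNIV (h::real \<Rightarrow> real) \<Longrightarrow> f \<in> smooth_hull \<Longrightarrow> (\<lambda>x. h (f x)) \<in> smooth_hull"

lemma smooth_hull_smooth: "f \<in> smooth_hull \<Longrightarrow> smooth_on UNIV f"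
proof (erule smooth_on_coinduct)
  fix f :: "'a \<Rightarrow> real" assume "f \<in> smooth_hull"
  then show "\<exists>f'. (\<forall>x. (f has_derivative f' x) (at x)) \<and> (\<forall>v. (\<lambda>x. f' x v) \<in> smooth_hull)"
  proof induction
    case (base f)
    then show ?case
      by (intro exI[of _ "\<lambda>x. frechet_derivative f (at x)"])
         (auto intro: smooth_has_derivative smooth_hull.base smooth_on_frechet_derivative)
  next
    case (add f g)
    then obtain f' g' where
      "\<forall>x. (f has_derivative f' x) (at x)" "\<forall>v. (\<lambda>x. f' x v) \<in> smooth_hull"
      "\<forall>x. (g has_derivative g' x) (at x)" "\<forall>v. (\<lambda>x. g' x v) \<in> smooth_hull" by blast
    then show ?case
      by (intro exI[of _ "\<lambda>x v. f' x v + g' x v"])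
         (auto intro: smooth_hull.add has_derivative_add)
  next
    case (mult f g)
    then obtain f' g' where
      "\<forall>x. (f has_derivative f' x) (at x)" "\<forall>v. (\<lambda>x. f' x v) \<in> smooth_hull"
      "\<forall>x. (g has_derivative g' x) (at x)" "\<forall>v. (\<lambda>x. g' x v) \<in> smooth_hull" by blast
    moreover from this mult.hyps have "(\<lambda>x. f x * g' x v + f' x v * g x) \<in> smooth_hull" for v
      using smooth_hull.add[OF smooth_hull.mult[of f "\<lambda>x. g' x v"] smooth_hull.mult[of "\<lambda>x. f' x v" g]] by blast
    ultimately show ?case
      by (intro exI[of _ "\<lambda>x v. f x * g' x v + f' x v * g x"])
         (blast intro: has_derivative_mult)
  next
    case (comp h f)
    then obtain f' where
      f': "\<forall>x. (f has_derivative f' x) (at x)" "\<forall>v. (\<lambda>x. f' x v) \<in> smooth_hull" by blast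
    let ?h' = "\<lambda>y. frechet_derivative h (at y) 1"
    have "((\<lambda>x. h (f x)) has_derivative (\<lambda>v. ?h' (f x) * f' x v)) (at x)" for x
    proof -
      have "((\<lambda>x. h (f x)) has_derivative (\<lambda>v. frechet_derivative h (at (f x)) (f' x v))) (at x)"
        using has_derivative_compose[OF f'(1)[rule_format] smooth_has_derivative[OF comp.hyps(1)]] .
      \<comment> \<open>A linear map on the reals is multiplication by its value at 1; this turns
        the chain rule into a product of two members of the hull.\<close>
      also have "frechet_derivative h (at y) = (\<lambda>r. ?h' y * r)" for y
      proof
        fix r show "frechet_derivative h (at y) r = ?h' y * r"
          using linear_scale[OF has_derivative_linear[OF smooth_has_derivative[OF comp.hyps(1)]], of y r 1]
          by (simp add: mult.commute)
      qed
      finally show ?thesis .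
    qed
    moreover have "(\<lambda>x. ?h' (f x) * f' x v) \<in> smooth_hull" for v
      using smooth_hull.mult[OF smooth_hull.comp[OF smooth_on_frechet_derivative[OF comp.hyps(1)] comp.hyps(2)] f'(2)[rule_format]] .
    ultimately show ?case
      by (intro exI[of _ "\<lambda>x v. ?h' (f x) * f' x v"]) auto
  qed
qed

lemma smooth_add:
  "smooth_on UNIV f \<Longrightarrow> smooth_on UNIV g \<Longrightarrow> smooth_on UNIV (\<lambda>x. f x + g x)"
  by (blast intro: smooth_hull_smooth smooth_hull.intros)

lemma smooth_mult:
  "smooth_on UNIV f \<Longrightarrow> smooth_on UNIV g \<Longrightarrow> smooth_on UNIV (\<lambda>x. f x * g x)"
  by (blast intro: smooth_hull_smooth smooth_hull.intros)

lemma smooth_comp: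
  "smooth_on UNIV h \<Longrightarrow> smooth_on UNIV f \<Longrightarrow> smooth_on UNIV (\<lambda>x. h (f x :: real))"
  by (blast intro: smooth_hull_smooth smooth_hull.intros)

lemma smooth_const: "smooth_on UNIV (\<lambda>x. c)"
  by (rule smooth_on_coinduct[where C="range (\<lambda>c x. c)"])
     (auto intro!: exI[of _ "\<lambda>_ _. 0"])

lemma smooth_linear:
  fixes f :: "'a::euclidean_space \<Rightarrow> real"
  assumes "bounded_linear f" shows "smooth_on UNIV f"
proof (rule smooth_on_coinduct[where C="insert f (range (\<lambda>c x. c))"])
  fix g :: "'a \<Rightarrow> real" assume "g \<in> insert f (range (\<lambda>c x. c))"
  then show "\<exists>f'. (\<forall>x. (g has_derivative f' x) (at x)) \<and>
        (\<forall>v. (\<lambda>x. f' x v) \<in> insert f (range (\<lambda>c x. c)))"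
    using bounded_linear_imp_has_derivative[OF assms] has_derivative_const
    by (elim insertE imageE) (force intro: exI[of _ "\<lambda>_. f"] exI[of _ "\<lambda>_ _. 0"])+
qed auto

lemma smooth_minus: "smooth_on UNIV f \<Longrightarrow> smooth_on UNIV (\<lambda>x. - f x)"
  using smooth_mult[OF smooth_const[of "-1"]] by simp

lemma smooth_diff:
  "smooth_on UNIV f \<Longrightarrow> smooth_on UNIV g \<Longrightarrow> smooth_on UNIV (\<lambda>x. f x - g x)"
  using smooth_add[OF _ smooth_minus, of f g] by simp

lemma smooth_power: "smooth_on UNIV f \<Longrightarrow> smooth_on UNIV (\<lambda>x. f x ^ n)"
  by (induction n) (auto intro: smooth_const smooth_mult)

lemma smooth_sum:
  "(\<And>i. i \<in> I \<Longrightarrow> smooth_on UNIV (f i)) \<Longrightarrow> smooth_on UNIV (\<lambda>x. \<Sum>i\<in>I. f i x)"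
  by (induction I rule: infinite_finite_induct) (auto intro: smooth_const smooth_add)

lemma smooth_continuous: "smooth_on UNIV f \<Longrightarrow> continuous_on UNIV f"
  unfolding smooth_on_def by (metis Ck_on.simps(1))

section \<open>Directional derivatives of smooth functions\<close>

lemma dir_deriv_eq:
  assumes "(f has_derivative f') (at x)" shows "dir_deriv v f x = f' v"
proof -
  have "((\<lambda>s. f (x + s *\<^sub>R v)) has_derivative (\<lambda>s. f' (s *\<^sub>R v))) (at 0)"
    by (rule has_derivative_compose[of "\<lambda>s. x + s *\<^sub>R v"]) (auto intro!: derivative_eq_intros assms)
  moreover have "f' (s *\<^sub>R v) = f' v * s" for s
    using linear_scale[OF has_derivative_linear[OF assms]] by simp
  ultimately have "((\<lambda>s. f (x + s *\<^sub>R v)) has_field_derivative f' v) (at 0)"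
    by (simp add: has_field_derivative_def)
  then show ?thesis by (simp add: dir_deriv_def DERIV_imp_deriv)
qed

lemma smooth_dir_deriv_eq:
  "smooth_on UNIV f \<Longrightarrow> dir_deriv v f = (\<lambda>x. frechet_derivative f (at x) v)"
  using dir_deriv_eq[OF smooth_has_derivative] by blast

lemma smooth_dir_deriv: "smooth_on UNIV f \<Longrightarrow> smooth_on UNIV (dir_deriv v f)"
  by (simp add: smooth_dir_deriv_eq smooth_on_frechet_derivative)

lemma DERIV_line:
  assumes "smooth_on UNIV f"
  shows "((\<lambda>s. f (x + s *\<^sub>R v)) has_field_derivative dir_deriv v f (x + s *\<^sub>R v)) (at s)"
proof -
  have "((\<lambda>s. f (x + s *\<^sub>R v)) has_derivative (\<lambda>r. frechet_derivative f (at (x + s *\<^sub>R v)) (r *\<^sub>R v))) (at s)"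
    by (rule has_derivative_compose[of "\<lambda>s. x + s *\<^sub>R v"])
       (auto intro!: derivative_eq_intros smooth_has_derivative[OF assms])
  moreover have "frechet_derivative f (at (x + s *\<^sub>R v)) (r *\<^sub>R v) = dir_deriv v f (x + s *\<^sub>R v) * r" for r
    using linear_scale[OF has_derivative_linear[OF smooth_has_derivative[OF assms]]]
    by (simp add: smooth_dir_deriv_eq[OF assms])
  ultimately show ?thesis
    by (simp add: has_field_derivative_def)
qed

lemma dir_deriv_mult:
  assumes "smooth_on UNIV f" "smooth_on UNIV g"
  shows "dir_deriv v (\<lambda>x. f x * g x) = (\<lambda>x. f x * dir_deriv v g x + dir_deriv v f x * g x)"
  using dir_deriv_eq[OF has_derivative_mult[OF smooth_has_derivative[OF assms(1)] smooth_has_derivative[OF assms(2)]]]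
  by (auto simp: smooth_dir_deriv_eq assms)

lemma dir_deriv_power:
  assumes "smooth_on UNIV f"
  shows "dir_deriv v (\<lambda>x. f x ^ n) = (\<lambda>x. real n * f x ^ (n - 1) * dir_deriv v f x)"
  using dir_deriv_eq[OF has_derivative_power[OF smooth_has_derivative[OF assms]]]
  by (auto simp: smooth_dir_deriv_eq assms)

lemma dir_deriv_scale:
  assumes "bounded_linear A" "A w = c *\<^sub>R v" "smooth_on UNIV f"
  shows "dir_deriv w (\<lambda>x. f (A x)) x = c * dir_deriv v f (A x)"
proof -
  have "dir_deriv w (\<lambda>x. f (A x)) x = frechet_derivative f (at (A x)) (c *\<^sub>R v)"
    using dir_deriv_eq[OF has_derivative_compose[OF bounded_linear_imp_has_derivative[OF assms(1)] smooth_has_derivative[OF assms(3)]]]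
    by (simp add: assms(2))
  also have "\<dots> = c * dir_deriv v f (A x)"
    using linear_scale[OF has_derivative_linear[OF smooth_has_derivative[OF assms(3)]]]
    by (simp add: smooth_dir_deriv_eq[OF assms(3)])
  finally show ?thesis .
qed

lemma smooth_scale:
  fixes A :: "'a::euclidean_space \<Rightarrow> 'b::euclidean_space"
  assumes "bounded_linear A" "smooth_on UNIV f"
  shows "smooth_on UNIV (\<lambda>x. f (A x))"
proof (rule smooth_on_coinduct[where C="{\<lambda>x. f (A x) |f. smooth_on UNIV f}"])
  fix g :: "'a \<Rightarrow> real" assume "g \<in> {\<lambda>x. f (A x) |f. smooth_on UNIV f}"
  then obtain f where f: "smooth_on UNIV f" "g = (\<lambda>x. f (A x))" by blast
  have "(g has_derivative (\<lambda>v. frechet_derivative f (at (A x)) (A v))) (at x)" for x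
    unfolding f(2)
    by (rule has_derivative_compose[OF bounded_linear_imp_has_derivative[OF assms(1)] smooth_has_derivative[OF f(1)]])
  moreover have "(\<lambda>x. frechet_derivative f (at (A x)) (A v)) \<in> {\<lambda>x. f (A x) |f. smooth_on UNIV f}" for v
    using smooth_on_frechet_derivative[OF f(1), of "A v"] by (intro CollectI exI[of _ "\<lambda>x. frechet_derivative f (at x) (A v)"]) auto
  ultimately show "\<exists>f'. (\<forall>x. (g has_derivative f' x) (at x)) \<and>
      (\<forall>v. (\<lambda>x. f' x v) \<in> {\<lambda>x. f (A x) |f. smooth_on UNIV f})"
    by (intro exI[of _ "\<lambda>x v. frechet_derivative f (at (A x)) (A v)"]) auto
qed (use assms in auto)

text \<open>Besides constants, this handles the two regions where the derivatives of a cutoff are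
  known: its plateau and the exterior of its support.\<close>

lemma dir_deriv_locally_constant:
  assumes "open O'" "\<And>y. y \<in> O' \<Longrightarrow> f y = c" "x \<in> O'" shows "dir_deriv v f x = 0"
proof -
  have "(f has_derivative (\<lambda>_. 0)) (at x)"
    by (rule has_derivative_transform_within_open[where f="\<lambda>_. c" and s="O'"]) (use assms in auto)
  then show ?thesis using dir_deriv_eq by metis
qed

subsection \<open>The differential operators as iterated directional derivatives\<close>

lemma time_deriv_Suc: "time_deriv (Suc i) u = dir_deriv (0, 1) (time_deriv i u)"
proof
  fix z :: "'a \<times> real"
  have "deriv (\<lambda>s. time_deriv i u (fst z, snd z + s)) 0 = deriv (\<lambda>s. time_deriv i u (fst z, s)) (snd z)"
    unfolding deriv_def using DERIV_shift[of "\<lambda>s. time_deriv i u (fst z, s)" _ 0 "snd z"] 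
    by (simp add: add.commute)
  then show "time_deriv (Suc i) u z = dir_deriv (0, 1) (time_deriv i u) z"
    by (cases z) (simp add: time_deriv_def dir_deriv_def)
qed

lemma time_deriv_0: "time_deriv 0 u = u"
  by (auto simp: time_deriv_def)

definition space_laplacian :: "('a::euclidean_space \<times> real \<Rightarrow> real) \<Rightarrow> 'a \<times> real \<Rightarrow> real" where
  "space_laplacian u z = (\<Sum>b\<in>Basis. dir_deriv (b, 0) (dir_deriv (b, 0) u) z)"

lemma space_polyharmonic_Suc:
  "space_polyharmonic (Suc m) u = (\<lambda>z. - space_laplacian (space_polyharmonic m u) z)"
proof
  fix z :: "'a \<times> real"
  have "dir_deriv b (\<lambda>y. F (y, t)) = (\<lambda>x. dir_deriv (b, 0) F (x, t))" for b t and F :: "'a \<times> real \<Rightarrow> real"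
    by (simp add: dir_deriv_def fun_eq_iff)
  then have "laplacian (\<lambda>y. F (y, snd z)) (fst z) = space_laplacian F z" for F :: "'a \<times> real \<Rightarrow> real"
    unfolding laplacian_def space_laplacian_def by (simp only: prod.collapse)
  from this[of "space_polyharmonic m u"] show "space_polyharmonic (Suc m) u z = - space_laplacian (space_polyharmonic m u) z"
    by (simp add: space_polyharmonic_def neg_laplacian_pow_def)
qed

lemma space_polyharmonic_0: "space_polyharmonic 0 u = u"
  by (auto simp: space_polyharmonic_def neg_laplacian_pow_def)

text \<open>The predicate records the order of differentiation because some properties degrade with
  it: a power of a cutoff loses one factor per derivative. The step is demanded only below the final
  order, so finitely many factors are enough.\<close>

lemma time_deriv_graded:
  assumes "P 0 u" "\<And>j f v. j < i \<Longrightarrow> P j f \<Longrightarrow> P (Suc j) (dir_deriv v f)"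
  shows "P i (time_deriv i u)"
  using assms
proof (induction i)
  case (Suc i)
  then show ?case by (simp add: time_deriv_Suc)
qed (simp add: time_deriv_0)

text \<open>The extra closure properties account for the sum over coordinate directions and for the
  sign in front of the Laplacian.\<close>

lemma space_polyharmonic_graded:
  assumes "P 0 u" "\<And>j f v. j < 2 * m \<Longrightarrow> P j f \<Longrightarrow> P (Suc j) (dir_deriv v f)"
    and "\<And>j. P j (\<lambda>x. 0)" "\<And>j f g. P j f \<Longrightarrow> P j g \<Longrightarrow> P j (\<lambda>x. f x + g x)"
    and "\<And>j f. P j f \<Longrightarrow> P j (\<lambda>x. - f x)"
  shows "P (2 * m) (space_polyharmonic m u)"
  using assms(2)
proof (induction m)
  case 0
  then show ?case by (simp add: space_polyharmonic_0 assms(1))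
next
  case (Suc m)
  have IH: "P (2 * m) (space_polyharmonic m u)" using Suc.IH Suc.prems by simp
  have "P (Suc (Suc (2 * m))) (dir_deriv v (dir_deriv v (space_polyharmonic m u)))" for v
    using Suc.prems[of "Suc (2*m)"] Suc.prems[of "2*m"] IH by simp
  then have "P (Suc (Suc (2 * m))) (\<lambda>z. \<Sum>b\<in>B. dir_deriv (b, 0) (dir_deriv (b, 0) (space_polyharmonic m u)) z)" for B
    by (induction B rule: infinite_finite_induct) (auto intro: assms)
  then have "P (Suc (Suc (2 * m))) (space_laplacian (space_polyharmonic m u))"
    by (simp add: space_laplacian_def[abs_def])
  then show ?case using assms(5) by (simp add: space_polyharmonic_Suc)
qed

lemma smooth_time_deriv: "smooth_on UNIV u \<Longrightarrow> smooth_on UNIV (time_deriv i u)"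
  by (rule time_deriv_graded[of "\<lambda>_. smooth_on UNIV"]) (auto intro: smooth_dir_deriv)

lemma smooth_space_polyharmonic: "smooth_on UNIV u \<Longrightarrow> smooth_on UNIV (space_polyharmonic m u)"
  by (rule space_polyharmonic_graded[of "\<lambda>_. smooth_on UNIV"])
     (auto intro: smooth_dir_deriv smooth_const smooth_add smooth_minus)

section \<open>A cutoff profile\<close>

text \<open>The factor (1/x)^n is included because differentiating exp(-1/x) produces powers of 1/x:
  the family is closed under differentiation up to linear combinations.\<close>

definition flat :: "nat \<Rightarrow> real \<Rightarrow> real" where
  "flat n x = (if x > 0 then (1 / x) ^ n * exp (- (1 / x)) else 0)"

lemma flat_tendsto_0: "(flat n \<longlongrightarrow> 0) (at 0)"
proof -
  have "((\<lambda>x::real. (1 / x) ^ n / exp (1 / x)) \<longlongrightarrow> 0) (at_right 0)"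
    using filterlim_compose[OF tendsto_power_div_exp_0 filterlim_inverse_at_top_right]
    by (simp add: inverse_eq_divide)
  then have "(flat n \<longlongrightarrow> 0) (at_right 0)"
    by (rule Lim_transform_eventually)
       (auto simp: eventually_at_filter flat_def exp_minus field_simps)
  moreover have "(flat n \<longlongrightarrow> 0) (at_left 0)"
    by (rule Lim_transform_eventually[OF tendsto_const])
       (auto simp: eventually_at_filter flat_def)
  ultimately show ?thesis
    using filterlim_split_at by blast
qed

lemma flat_has_real_derivative:
  "(flat n has_real_derivative (flat (n + 2) x - real n * flat (n + 1) x)) (at x)"
proof -
  consider "x > 0" | "x < 0" | "x = 0" by linarith
  then show ?thesis
  proof cases
    case 1
    have "((\<lambda>x. (1 / x) ^ n * exp (- (1 / x))) has_real_derivative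
        (flat (n + 2) x - real n * flat (n + 1) x)) (at x)"
    proof (rule DERIV_cong)
      show "((\<lambda>x. (1 / x) ^ n * exp (- (1 / x))) has_real_derivative
          (1 / x) ^ n * (exp (- (1 / x)) * (1 / x) ^ 2) + real n * (1 / x) ^ (n - 1) * (- ((1 / x) ^ 2)) * exp (- (1 / x))) (at x)"
        using 1 by (auto intro!: derivative_eq_intros simp: power2_eq_square)
      show "(1 / x) ^ n * (exp (- (1 / x)) * (1 / x) ^ 2) + real n * (1 / x) ^ (n - 1) * (- ((1 / x) ^ 2)) * exp (- (1 / x))
          = flat (n + 2) x - real n * flat (n + 1) x"
        using 1 by (cases n) (auto simp: flat_def power2_eq_square algebra_simps add_divide_distrib)
    qed
    then show ?thesis
      by (rule has_field_derivative_transform_within_open[where S = "{0<..}"]) (use 1 in \<open>auto simp: flat_def\<close>)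
  next
    case 2
    have "((\<lambda>x. 0) has_real_derivative 0) (at x)" by simp
    then have "(flat n has_real_derivative 0) (at x)"
      by (rule has_field_derivative_transform_within_open[where S = "{..<0}"]) (use 2 in \<open>auto simp: flat_def\<close>)
    then show ?thesis using 2 by (simp add: flat_def)
  next
    case 3
    \<comment> \<open>Away from 0 this difference quotient is \<open>flat (Suc n)\<close>, so
      differentiability at 0 is the limit already proved, one index higher.\<close>
    have "((\<lambda>y. (flat n y - flat n 0) / (y - 0)) \<longlongrightarrow> 0) (at 0)"
      by (rule Lim_transform_eventually[OF flat_tendsto_0[of "Suc n"]])
         (auto simp: eventually_at_filter flat_def)
    then show ?thesis using 3 by (simp add: has_field_derivative_iff flat_def)
  qed
qed

inductive_set flat_span :: "(real \<Rightarrow> real) set" where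
  "flat n \<in> flat_span"
| "f \<in> flat_span \<Longrightarrow> g \<in> flat_span \<Longrightarrow> (\<lambda>x. f x + g x) \<in> flat_span"
| "f \<in> flat_span \<Longrightarrow> (\<lambda>x. c * f x) \<in> flat_span"

lemma smooth_flat: "smooth_on UNIV (flat n)"
proof (rule smooth_on_coinduct[OF flat_span.intros(1)])
  fix f :: "real \<Rightarrow> real" assume "f \<in> flat_span"
  then have "\<exists>f'\<in>flat_span. \<forall>x. (f has_real_derivative f' x) (at x)"
  proof induction
    case (1 n)
    have "(\<lambda>x. flat (n + 2) x + (- real n) * flat (n + 1) x) \<in> flat_span"
      by (intro flat_span.intros)
    then show ?case
      using flat_has_real_derivative[of n]
      by (intro bexI[where x="\<lambda>x. flat (n + 2) x + (- real n) * flat (n + 1) x"]) auto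
  next
    case (2 f g)
    then obtain f' g' where "f' \<in> flat_span" "g' \<in> flat_span"
      "\<forall>x. (f has_real_derivative f' x) (at x)" "\<forall>x. (g has_real_derivative g' x) (at x)" by blast
    then show ?case
      by (intro bexI[where x="\<lambda>x. f' x + g' x"]) (auto intro: flat_span.intros DERIV_add)
  next
    case (3 f c)
    then obtain f' where "f' \<in> flat_span" "\<forall>x. (f has_real_derivative f' x) (at x)" by blast
    then show ?case
      by (intro bexI[where x="\<lambda>x. c * f' x"]) (auto intro: flat_span.intros DERIV_cmult)
  qed
  then obtain f' where f': "f' \<in> flat_span" "\<And>x. (f has_real_derivative f' x) (at x)" by blast
  then show "\<exists>f'. (\<forall>x. (f has_derivative f' x) (at x)) \<and> (\<forall>v. (\<lambda>x. f' x v) \<in> flat_span)"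
    using flat_span.intros(3)[OF f'(1)]
    by (intro exI[of _ "\<lambda>x v. v * f' x"])
       (auto simp: has_field_derivative_def mult_commute_abs)
qed

lemma flat_0_mono: "x \<le> y \<Longrightarrow> flat 0 x \<le> flat 0 y"
  by (auto simp: flat_def intro: divide_left_mono)

text \<open>Composing \<^term>\<open>flat 0\<close> with itself gives a plateau without any division by a function.\<close>

lemma smooth_plateau_exists:
  obtains b :: "real \<Rightarrow> real" where
    "smooth_on UNIV b" "\<And>s. 0 \<le> b s" "\<And>s. b s \<le> 1"
    "\<And>s. s \<le> 1 / 16 \<Longrightarrow> b s = 1" "\<And>s. s \<ge> 3 / 16 \<Longrightarrow> b s = 0"
proof
  \<comment> \<open>\<open>a\<close> is the value of \<open>flat 0 (s - 1 / 16)\<close> at s = 3/16: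
    from there on the outer argument in \<open>b\<close> is at most 0, while up to 1/16 it equals
    \<open>a\<close>. Since \<open>b\<close> will be applied to squares, 1/16 is the square of 1/4
    and 3/16 lies below the square of 1/2.\<close>
  define a where "a = flat 0 (1 / 8)"
  define b where "b = (\<lambda>s. (1 / flat 0 a) * flat 0 (a - flat 0 (s - 1 / 16)))"
  have a: "a > 0" by (simp add: a_def flat_def)
  then have fa: "flat 0 a > 0" by (simp add: flat_def)
  have nn: "flat 0 x \<ge> 0" for x by (simp add: flat_def)
  have lin: "smooth_on UNIV (\<lambda>s::real. s - 1 / 16)"
    using smooth_diff[OF smooth_linear[OF bounded_linear_ident] smooth_const] .
  show "smooth_on UNIV b"
    unfolding b_def
    by (rule smooth_mult[OF smooth_const smooth_comp[OF smooth_flat smooth_diff[OF smooth_const smooth_comp[OF smooth_flat lin]]]])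
  fix s
  show "0 \<le> b s" using nn fa by (simp add: b_def)
  have "flat 0 (a - flat 0 (s - 1 / 16)) \<le> flat 0 a" using nn by (intro flat_0_mono) simp
  then show "b s \<le> 1" using fa by (simp add: b_def)
  show "b s = 1" if "s \<le> 1 / 16"
  proof -
    have "flat 0 (s - 1 / 16) = 0" using that by (simp add: flat_def)
    then show ?thesis using fa by (simp add: b_def)
  qed
  show "b s = 0" if "s \<ge> 3 / 16"
  proof -
    have "a \<le> flat 0 (s - 1 / 16)" using that unfolding a_def by (intro flat_0_mono) simp
    then show ?thesis by (simp add: b_def flat_def)
  qed
qed

section \<open>Space-time cutoffs and their derivatives\<close>

lemma time_deriv_locally_constant:
  assumes "\<And>t. \<bar>t\<bar> < e \<Longrightarrow> \<phi> (x, t) = c" "e > 0" "i > 0"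
  shows "time_deriv i \<phi> (x, 0) = 0"
proof -
  have "(deriv ^^ i) (\<lambda>s. \<phi> (x, s)) t = (if i = 0 then c else 0)" if "\<bar>t\<bar> < e" for t i
    using that
  proof (induction i arbitrary: t)
    case (Suc i)
    have "((\<lambda>_. if i = 0 then c else 0) has_real_derivative 0) (at t)" by simp
    then have "((deriv ^^ i) (\<lambda>s. \<phi> (x, s)) has_real_derivative 0) (at t)"
      by (rule has_field_derivative_transform_within_open[where S = "{-e<..<e}"])
         (use Suc in auto)
    then show ?case by (simp add: DERIV_imp_deriv)
  qed (use assms in auto)
  then show ?thesis using assms by (simp add: time_deriv_def)
qed

text \<open>The derivative of \<open>w^(n+1) * G\<close> is \<open>w^n\<close> times
  \<open>w\<close> G' + (n+1) \<open>w\<close>' \<open>G\<close>, and the second factor is smooth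
  again: each derivative costs one factor of \<open>w\<close>.\<close>

lemma power_graded_dir_deriv:
  assumes w: "smooth_on UNIV w" and j: "Suc j \<le> M"
    and f: "\<exists>G. smooth_on UNIV G \<and> f = (\<lambda>z. w z ^ (M - j) * G z)"
  shows "\<exists>G. smooth_on UNIV G \<and> dir_deriv v f = (\<lambda>z. w z ^ (M - Suc j) * G z)"
proof -
  obtain G where G: "smooth_on UNIV G" "f = (\<lambda>z. w z ^ (M - j) * G z)" using f by blast
  define n where "n = M - Suc j"
  have n: "M - j = Suc n" using j by (simp add: n_def)
  define H where "H = (\<lambda>z. w z * dir_deriv v G z + (real (Suc n) * dir_deriv v w z) * G z)"
  have "dir_deriv v f = (\<lambda>z. w z ^ n * H z)"
    unfolding G n dir_deriv_mult[OF smooth_power[OF w] G(1)] dir_deriv_power[OF w] H_def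
    by (auto simp: algebra_simps)
  moreover have "smooth_on UNIV H"
    unfolding H_def by (intro smooth_add smooth_mult smooth_const smooth_dir_deriv w G)
  ultimately show ?thesis unfolding n_def by blast
qed

text \<open>
  A derivative of order \<open>j\<close> of \<open>w\<^sup>M\<close> still has the factor \<open>w\<^sup>M\<^sup>-\<^sup>j\<close>, which is at most
  \<open>w\<^sup>M\<^sup>/\<^sup>s\<close> as soon as \<open>M\<close> is large.
\<close>

lemma cutoff_profile_exists:
  fixes s :: real and k m :: nat
  assumes s: "s > 1" and k: "k \<ge> 1" and m: "m \<ge> 1"
  obtains \<Phi> :: "'a::euclidean_space \<times> real \<Rightarrow> real" and C where
    "smooth_on UNIV \<Phi>" "\<And>z. 0 \<le> \<Phi> z" "\<And>z. \<Phi> z \<le> 1"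
    "\<And>x t. \<Phi> (x, t) \<noteq> 0 \<Longrightarrow> norm x < 1 / 2 \<and> \<bar>t\<bar> < 1 / 2"
    "\<And>x t. norm x < 1 / 4 \<Longrightarrow> \<bar>t\<bar> < 1 / 4 \<Longrightarrow> \<Phi> (x, t) = 1"
    "\<And>i x. i > 0 \<Longrightarrow> time_deriv i \<Phi> (x, 0) = 0"
    "\<And>z. \<bar>(-1)^k * time_deriv k \<Phi> z + space_polyharmonic m \<Phi> z\<bar> \<le> C * \<Phi> z powr (1 / s)"
    "\<And>x t. norm x < 1 / 4 \<Longrightarrow> \<bar>t\<bar> < 1 / 4 \<Longrightarrow>
       (-1)^k * time_deriv k \<Phi> (x, t) + space_polyharmonic m \<Phi> (x, t) = 0"
    "C \<ge> 0"
proof -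
  obtain b :: "real \<Rightarrow> real" where b: "smooth_on UNIV b" "\<And>s. 0 \<le> b s" "\<And>s. b s \<le> 1"
    "\<And>s. s \<le> 1 / 16 \<Longrightarrow> b s = 1" "\<And>s. s \<ge> 3 / 16 \<Longrightarrow> b s = 0"
    using smooth_plateau_exists by blast
  \<comment> \<open>Squares avoid the singularity of the norm at the origin. Space and time are cut
    off separately, so the plateau contains a product of a ball and an interval, a shape that
    anisotropic rescaling preserves.\<close>
  define w :: "'a \<times> real \<Rightarrow> real" where "w = (\<lambda>z. b (fst z \<bullet> fst z) * b (snd z * snd z))"
  have fst_eq: "fst z \<bullet> fst z = (\<Sum>b\<in>Basis. (fst z \<bullet> b) * (fst z \<bullet> b))" for z :: "'a \<times> real"
    by (rule euclidean_inner)
  have smooth_w: "smooth_on UNIV w"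
    unfolding w_def fst_eq
    by (intro smooth_mult smooth_comp[OF b(1)] smooth_sum smooth_linear bounded_linear_inner_left_comp
        bounded_linear_fst bounded_linear_snd)
  have w01: "0 \<le> w z" "w z \<le> 1" for z
    using b(2,3) mult_mono[of "b (fst z \<bullet> fst z)" 1 "b (snd z * snd z)" 1] by (auto simp: w_def)
  have w_supp: "norm x < 1 / 2 \<and> \<bar>t\<bar> < 1 / 2" if "w (x, t) \<noteq> 0" for x t
  proof -
    have lt: "x \<bullet> x < 3 / 16" "t * t < 3 / 16"
      using that b(5)[of "x \<bullet> x"] b(5)[of "t * t"] by (force simp: w_def)+
    then have "norm x ^ 2 < (1 / 2) ^ 2" "\<bar>t\<bar> ^ 2 < (1 / 2) ^ 2"
      unfolding power2_norm_eq_inner by (simp_all add: power2_eq_square)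
    then show ?thesis by (metis abs_ge_zero norm_ge_zero power2_less_imp_less zero_le_divide_1_iff zero_le_numeral)
  qed
  have bx1: "b (x \<bullet> x) = 1" if "norm x < 1 / 4" for x :: 'a
    using that power_mono[of "norm x" "1 / 4" 2] unfolding power2_norm_eq_inner
    by (intro b(4)) (simp add: power2_eq_square)
  have bt1: "b (t * t) = 1" if "\<bar>t\<bar> < 1 / 4" for t
    using that power_mono[of "\<bar>t\<bar>" "1 / 4" 2] by (intro b(4)) (auto simp: power2_eq_square)
  \<comment> \<open>The second condition says M - j >= M/s for every order j <= k + 2m; as 0 <=
    \<open>w\<close> <= 1, this gives \<open>w^(M-j)\<close> <= \<open>w^M\<close> to the power 1/s.
    The first keeps at least one factor of \<open>w\<close>, so that derivatives vanish wherever
    \<open>w\<close> does.\<close>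
  obtain M :: nat where M: "real (k + 2 * m) + 1 \<le> real M" "real (k + 2 * m) \<le> real M * (1 - 1 / s)"
  proof -
    obtain M :: nat where "max (real (k + 2 * m) + 1) (real (k + 2 * m) / (1 - 1 / s)) \<le> real M"
      using real_arch_simple by blast
    moreover have "1 - 1 / s > 0" using s by simp
    ultimately show ?thesis by (intro that[of M]) (auto simp: pos_divide_le_eq)
  qed
  define \<Phi> where "\<Phi> = (\<lambda>z. w z ^ M)"
  define P where "P = (\<lambda>j f. \<exists>G. smooth_on UNIV G \<and> f = (\<lambda>z. w z ^ (M - j) * G z))"
  have P0: "P 0 \<Phi>" unfolding P_def \<Phi>_def by (intro exI[of _ "\<lambda>_. 1"]) (auto intro: smooth_const)
  have Pd: "P (Suc j) (dir_deriv v f)" if "j < k + 2 * m" "P j f" for j f v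
    using power_graded_dir_deriv[OF smooth_w, of j M f v] that M(1) unfolding P_def by auto
  have "P k (time_deriv k \<Phi>)"
    using Pd by (intro time_deriv_graded[of P] P0) auto
  moreover have "P (2 * m) (space_polyharmonic m \<Phi>)"
  proof (rule space_polyharmonic_graded[of P])
    fix j f g assume "P j f" "P j g"
    then obtain F G where "smooth_on UNIV F" "f = (\<lambda>z. w z ^ (M - j) * F z)"
      "smooth_on UNIV G" "g = (\<lambda>z. w z ^ (M - j) * G z)" by (auto simp: P_def)
    then show "P j (\<lambda>x. f x + g x)"
      unfolding P_def by (intro exI[of _ "\<lambda>z. F z + G z"]) (auto simp: algebra_simps intro: smooth_add)
  next
    fix j f assume "P j f"
    then obtain F where "smooth_on UNIV F" "f = (\<lambda>z. w z ^ (M - j) * F z)" by (auto simp: P_def)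
    then show "P j (\<lambda>x. - f x)"
      unfolding P_def by (intro exI[of _ "\<lambda>z. - F z"]) (auto intro: smooth_minus)
  next
    show "P j (\<lambda>_. 0)" for j
      unfolding P_def by (intro exI[of _ "\<lambda>_. 0"]) (auto intro: smooth_const)
  qed (use P0 Pd in auto)
  moreover have bound: "\<exists>C\<ge>0. \<forall>z. \<bar>f z\<bar> \<le> C * \<Phi> z powr (1 / s)" if "P j f" "j \<le> k + 2 * m" for j f
  proof -
    from that(1) obtain G where G: "smooth_on UNIV G" "f = (\<lambda>z. w z ^ (M - j) * G z)"
      unfolding P_def by blast
    \<comment> \<open>\<open>G\<close> is only locally bounded; this suffices because
      \<open>w\<close> is supported inside the ball.\<close>
    have "compact (G ` cball 0 2)"
      using smooth_continuous[OF G(1)] by (intro compact_continuous_image) (auto intro: continuous_on_subset)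
    then obtain C where C: "\<And>z. z \<in> cball 0 2 \<Longrightarrow> \<bar>G z\<bar> \<le> C"
      using compact_imp_bounded[of "G ` cball 0 2"] unfolding bounded_iff by (metis image_eqI real_norm_def)
    have "C \<ge> 0" using C[of 0] by force
    moreover have "\<bar>f z\<bar> \<le> C * \<Phi> z powr (1 / s)" for z
    proof (cases "w z = 0")
      case True
      moreover have "0 < M - j" using M(1) that(2) by linarith
      ultimately show ?thesis using \<open>C \<ge> 0\<close> G(2) by (simp add: power_0_left)
    next
      case False
      then have pos: "0 < w z" using w01(1)[of z] by simp
      have "z \<in> cball 0 2"
      proof -
        obtain x t where z: "z = (x, t)" by (cases z)
        have "norm z \<le> norm x + \<bar>t\<bar>" using norm_Pair_le[of x t] by (simp add: z)
        then show ?thesis using w_supp[of x t] False z by auto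
      qed
      moreover have "w z ^ (M - j) \<le> \<Phi> z powr (1 / s)"
      proof -
        have "\<Phi> z powr (1 / s) = w z powr (real M * (1 / s))"
          using pos by (simp add: \<Phi>_def powr_powr flip: powr_realpow)
        moreover have "w z ^ (M - j) = w z powr (real M - real j)"
          using that M pos by (simp flip: powr_realpow add: of_nat_diff)
        moreover have "real M * (1 / s) \<le> real M - real j"
          using that M by (simp add: algebra_simps)
        ultimately show ?thesis using powr_mono'[OF _ w01, of _ _ z] by simp
      qed
      ultimately have "w z ^ (M - j) * \<bar>G z\<bar> \<le> \<Phi> z powr (1 / s) * C"
        using C by (intro mult_mono) auto
      then show ?thesis using G(2) w01(1)[of z] by (simp add: abs_mult mult.commute)
    qed
    ultimately show ?thesis by blast
  qed
  ultimately obtain C1 C2 where C: "C1 \<ge> 0" "\<And>z. \<bar>time_deriv k \<Phi> z\<bar> \<le> C1 * \<Phi> z powr (1 / s)"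
     "C2 \<ge> 0" "\<And>z. \<bar>space_polyharmonic m \<Phi> z\<bar> \<le> C2 * \<Phi> z powr (1 / s)"
    using bound[of k "time_deriv k \<Phi>"] bound[of "2 * m" "space_polyharmonic m \<Phi>"]
    by (metis le_add1 le_add2)
  \<comment> \<open>Grade 0 admits the value 1 on the plateau, but from the first derivative on the
    constant must be 0. Both parts of the operator have positive order since k, m >= 1.\<close>
  define Q where "Q = (\<lambda>(j::nat) (f :: 'a \<times> real \<Rightarrow> real). \<exists>c. (j > 0 \<longrightarrow> c = 0) \<and> (\<forall>y\<in>ball 0 (1 / 4) \<times> {-(1 / 4)<..<1 / 4}. f y = c))"
  have plateau: "\<Phi> (x, t) = 1" if "norm x < 1 / 4" "\<bar>t\<bar> < 1 / 4" for x t
    using bx1[OF that(1)] bt1[OF that(2)] by (simp add: \<Phi>_def w_def)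
  have Q0: "Q 0 \<Phi>" unfolding Q_def using plateau by (intro exI[of _ 1]) auto
  have Qd: "Q (Suc j) (dir_deriv v f)" if "Q j f" for j f v
  proof -
    from that obtain c where c: "\<And>y. y \<in> ball 0 (1 / 4) \<times> {-(1 / 4)<..<1 / 4} \<Longrightarrow> f y = c"
      unfolding Q_def by blast
    have "dir_deriv v f y = 0" if "y \<in> ball 0 (1 / 4) \<times> {-(1 / 4)<..<1 / 4}" for y
      by (rule dir_deriv_locally_constant[OF _ c that]) (simp_all add: open_Times)
    then show ?thesis unfolding Q_def by blast
  qed
  have Qt: "Q k (time_deriv k \<Phi>)" by (intro time_deriv_graded[of Q] Q0 Qd)
  have Qs: "Q (2 * m) (space_polyharmonic m \<Phi>)"
    by (rule space_polyharmonic_graded[of Q]) (use Q0 Qd in \<open>auto simp: Q_def\<close>)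
  show ?thesis
  proof (rule that[of \<Phi> "C1 + C2"])
    show "smooth_on UNIV \<Phi>" unfolding \<Phi>_def by (intro smooth_power smooth_w)
    show "0 \<le> \<Phi> z" "\<Phi> z \<le> 1" for z using w01 by (auto simp: \<Phi>_def power_le_one)
    show "norm x < 1 / 2 \<and> \<bar>t\<bar> < 1 / 2" if "\<Phi> (x, t) \<noteq> 0" for x t
      using that M(1) w_supp by (auto simp: \<Phi>_def power_0_left split: if_splits)
    show "\<Phi> (x, t) = 1" if "norm x < 1 / 4" "\<bar>t\<bar> < 1 / 4" for x t using plateau that .
    show "time_deriv i \<Phi> (x, 0) = 0" if "i > 0" for i x
      by (rule time_deriv_locally_constant[of "1 / 4" _ _ "b (x \<bullet> x) ^ M"])
         (use that bt1 in \<open>auto simp: \<Phi>_def w_def\<close>)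
    show "\<bar>(-1)^k * time_deriv k \<Phi> z + space_polyharmonic m \<Phi> z\<bar> \<le> (C1 + C2) * \<Phi> z powr (1 / s)" for z
    proof -
      have "\<bar>(-1)^k * time_deriv k \<Phi> z + space_polyharmonic m \<Phi> z\<bar> \<le> \<bar>time_deriv k \<Phi> z\<bar> + \<bar>space_polyharmonic m \<Phi> z\<bar>"
        by (rule order_trans[OF abs_triangle_ineq]) (simp add: abs_mult)
      then show ?thesis using C(2)[of z] C(4)[of z] by (simp add: algebra_simps)
    qed
    show "(-1)^k * time_deriv k \<Phi> (x, t) + space_polyharmonic m \<Phi> (x, t) = 0"
      if "norm x < 1 / 4" "\<bar>t\<bar> < 1 / 4" for x t
    proof -
      have "(x, t) \<in> ball 0 (1 / 4) \<times> {-(1 / 4)<..<1 / 4}" using that by auto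
      then show ?thesis using Qt Qs k m unfolding Q_def by fastforce
    qed
    show "C1 + C2 \<ge> 0" using C by simp
  qed
qed

subsection \<open>Anisotropic rescaling\<close>

lemma dir_deriv_cmult:
  assumes "smooth_on UNIV f"
  shows "dir_deriv v (\<lambda>x. c * f x) = (\<lambda>x. c * dir_deriv v f x)"
proof -
  have "dir_deriv v (\<lambda>_. c) x = 0" for x
    by (rule dir_deriv_locally_constant[of UNIV]) auto
  then show ?thesis using dir_deriv_mult[OF smooth_const assms] by simp
qed

definition rescale :: "real \<Rightarrow> real \<Rightarrow> 'a::euclidean_space \<times> real \<Rightarrow> 'a \<times> real" where
  "rescale R T z = (fst z /\<^sub>R R, snd z / T)"

lemma bounded_linear_rescale: "bounded_linear (rescale R T)"
  unfolding rescale_def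
  by (intro bounded_linear_Pair bounded_linear_scaleR_right[THEN bounded_linear_compose] bounded_linear_fst
        bounded_linear_divide[THEN bounded_linear_compose] bounded_linear_snd)

lemma time_deriv_rescale:
  assumes "smooth_on UNIV f"
  shows "time_deriv i (\<lambda>z. f (rescale R T z)) = (\<lambda>z. (1 / T) ^ i * time_deriv i f (rescale R T z))"
proof (induction i)
  case (Suc i)
  have "dir_deriv (0, 1) (\<lambda>z. (1 / T) ^ i * time_deriv i f (rescale R T z))
      = (\<lambda>z. (1 / T) ^ i * dir_deriv (0, 1) (\<lambda>z. time_deriv i f (rescale R T z)) z)"
    by (rule dir_deriv_cmult[OF smooth_scale[OF bounded_linear_rescale smooth_time_deriv[OF assms]]])
  also have "dir_deriv (0, 1) (\<lambda>z. time_deriv i f (rescale R T z))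
      = (\<lambda>z. (1 / T) * dir_deriv (0, 1) (time_deriv i f) (rescale R T z))"
    by (rule ext, rule dir_deriv_scale[where A="rescale R T" and v="(0, 1)" and f="time_deriv i f"])
       (simp_all add: bounded_linear_rescale smooth_time_deriv assms, simp add: rescale_def)
  finally show ?case by (simp add: time_deriv_Suc Suc.IH)
qed (simp add: time_deriv_0)

lemma space_polyharmonic_rescale:
  assumes "smooth_on UNIV f"
  shows "space_polyharmonic m (\<lambda>z. f (rescale R T z))
       = (\<lambda>z. (1 / R) ^ (2 * m) * space_polyharmonic m f (rescale R T z))"
proof (induction m)
  case (Suc m)
  let ?g = "space_polyharmonic m f" and ?c = "(1 / R) ^ (2 * m)"
  have sg: "smooth_on UNIV ?g" using assms by (rule smooth_space_polyharmonic)
  have *: "dir_deriv (b, 0) (\<lambda>z. c * g (rescale R T z))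
      = (\<lambda>z. c * (1 / R) * dir_deriv (b, 0) g (rescale R T z))" if "smooth_on UNIV g" for b c g
  proof -
    have "dir_deriv (b, 0) (\<lambda>z. c * g (rescale R T z)) = (\<lambda>z. c * dir_deriv (b, 0) (\<lambda>z. g (rescale R T z)) z)"
      by (rule dir_deriv_cmult[OF smooth_scale[OF bounded_linear_rescale that]])
    also have "dir_deriv (b, 0) (\<lambda>z. g (rescale R T z)) = (\<lambda>z. (1 / R) * dir_deriv (b, 0) g (rescale R T z))"
      by (rule ext, rule dir_deriv_scale[where A="rescale R T" and v="(b, 0)" and f=g])
         (simp_all add: bounded_linear_rescale that, simp add: rescale_def divide_inverse)
    finally show ?thesis by (simp add: mult.assoc)
  qed
  have "dir_deriv (b, 0) (dir_deriv (b, 0) (\<lambda>z. ?c * ?g (rescale R T z)))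
      = (\<lambda>z. (?c * (1 / R) * (1 / R)) * dir_deriv (b, 0) (dir_deriv (b, 0) ?g) (rescale R T z))" for b
    unfolding *[OF sg] *[OF smooth_dir_deriv[OF sg]] ..
  then show ?case
    by (simp only: space_polyharmonic_Suc Suc.IH space_laplacian_def)
       (simp add: sum_distrib_left power2_eq_square power_add algebra_simps)
qed (simp add: space_polyharmonic_0)

text \<open>The support is kept within half the scale so that any two of its points are less than
  \<open>R\<close> apart in space, where \<open>K R\<close> bounds the kernel from below.\<close>

lemma test_function_rescale:
  fixes \<Phi> :: "'a::euclidean_space \<times> real \<Rightarrow> real"
  assumes "smooth_on UNIV \<Phi>" "\<And>z. 0 \<le> \<Phi> z"
    and supp: "\<And>x t. \<Phi> (x, t) \<noteq> 0 \<Longrightarrow> norm x < 1 / 2 \<and> \<bar>t\<bar> < 1 / 2"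
    and R: "R > 0" and T: "T > 0"
  shows "test_function (\<lambda>z. \<Phi> (rescale R T z))"
    and "\<And>x t. \<Phi> (rescale R T (x, t)) \<noteq> 0 \<Longrightarrow> norm x < R / 2 \<and> \<bar>t\<bar> < T / 2"
proof -
  show *: "norm x < R / 2 \<and> \<bar>t\<bar> < T / 2" if "\<Phi> (rescale R T (x, t)) \<noteq> 0" for x t
    using supp[of "x /\<^sub>R R" "t / T"] that R T by (simp add: rescale_def field_simps abs_mult)
  have "{z. \<Phi> (rescale R T z) \<noteq> 0} \<subseteq> ball 0 (R / 2) \<times> {-(T / 2)..T / 2}"
    using * by force
  then have "bounded {z. \<Phi> (rescale R T z) \<noteq> 0}"
    by (rule bounded_subset[rotated]) (intro bounded_Times bounded_ball bounded_closed_interval)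
  then show "test_function (\<lambda>z. \<Phi> (rescale R T z))"
    using assms smooth_scale[OF bounded_linear_rescale assms(1)]
    by (simp add: test_function_def compact_closure)
qed

section \<open>The nonlinear estimate\<close>

text \<open>Above the level \<open>\<mu>\<close> one has X <= mu (X/mu)^s, which is the second term.
  This truncation takes the place of Young's inequality and leaves the level free.\<close>

lemma split_young:
  fixes X \<mu> s :: real
  assumes "X \<ge> 0" "\<mu> > 0" "s > 1"
  shows "X \<le> \<mu> + \<mu> powr (1 - s) * X powr s"
proof (cases "X \<le> \<mu>")
  case True
  then show ?thesis using assms by (simp add: add_increasing2)
next
  case False
  have "X = X powr (1 - s) * X powr s" using False assms by (simp flip: powr_add)
  also have "\<dots> \<le> \<mu> powr (1 - s) * X powr s"
    using False assms by (intro mult_right_mono powr_mono2') auto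
  finally show ?thesis using assms by simp
qed

text \<open>The same truncation with exponent 2, in the extended reals: \<open>g\<close> will be a
  slice integral that may be infinite, and then the right-hand side is infinite too.\<close>

lemma split_square:
  fixes g :: ennreal and \<nu> :: real
  assumes "\<nu> > 0"
  shows "g \<le> ennreal \<nu> + ennreal (1 / \<nu>) * g\<^sup>2"
proof (cases g)
  case (real r)
  have "r \<le> \<nu> + \<nu> powr (1 - 2) * r powr 2" using split_young[of r \<nu> 2] real assms by simp
  also have "\<nu> powr (1 - 2) * r powr 2 = (1 / \<nu>) * r\<^sup>2"
    using real assms by (cases "r = 0") (simp_all add: powr_minus_divide powr_numeral)
  finally have "ennreal r \<le> ennreal (\<nu> + (1 / \<nu>) * r\<^sup>2)" by (rule ennreal_leI)
  also have "ennreal (\<nu> + (1 / \<nu>) * r\<^sup>2) = ennreal \<nu> + ennreal (1 / \<nu>) * g\<^sup>2"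
    using real assms by (subst ennreal_plus) (auto simp: ennreal_mult ennreal_power simp del: times_divide_eq_left)
  finally show ?thesis using real by simp
next
  case top
  then show ?thesis using assms by (simp add: ennreal_mult_top top_power_ennreal)
qed

lemma nn_integral_time_space:
  fixes f :: "'a::euclidean_space \<times> real \<Rightarrow> ennreal"
  assumes "f \<in> borel_measurable borel"
  shows "(\<integral>\<^sup>+t. \<integral>\<^sup>+x. f (x, t) \<partial>lborel \<partial>lborel) = (\<integral>\<^sup>+z. f z \<partial>lborel)"
  using lborel_pair.nn_integral_snd[of f] assms by (simp add: lborel_prod)

lemma borel_measurable_slice:
  fixes f :: "'a::euclidean_space \<times> real \<Rightarrow> ennreal"
  assumes "f \<in> borel_measurable borel"
  shows "(\<lambda>x. f (x, t)) \<in> borel_measurable borel"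
    and "(\<lambda>t. \<integral>\<^sup>+x. f (x, t) \<partial>lborel) \<in> borel_measurable borel"
proof -
  have [measurable]: "f \<in> borel_measurable (lborel \<Otimes>\<^sub>M lborel)" using assms by (simp add: lborel_prod)
  show "(\<lambda>x. f (x, t)) \<in> borel_measurable borel"
    using measurable_compose[OF _ assms, of "\<lambda>x. (x, t)" borel] by (simp add: borel_prod[symmetric])
  have "(\<lambda>t. \<integral>\<^sup>+x. f (x, t) \<partial>lborel) \<in> borel_measurable lborel"
    by measurable
  then show "(\<lambda>t. \<integral>\<^sup>+x. f (x, t) \<partial>lborel) \<in> borel_measurable borel" by simp
qed

text \<open>Truncating \<open>X\<close> pointwise leaves the plain integral of \<open>X^s\<close>,
  but the nonlinear term controls only the squares of its slice integrals. A second truncation, of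
  the slice integrals, bridges the gap at the cost of the length \<open>T\<close> of the time
  interval.\<close>

lemma nonlinear_estimate:
  fixes X :: "'a::euclidean_space \<times> real \<Rightarrow> real"
  assumes [measurable]: "X \<in> borel_measurable borel"
    and X0: "\<And>z. 0 \<le> X z"
    and supp: "\<And>x t. X (x, t) \<noteq> 0 \<Longrightarrow> norm x < R \<and> 0 < t \<and> t < T"
    and pos: "s > 1" "\<mu> > 0" "R > 0" "T > 0"
  shows "(\<integral>\<^sup>+z. X z \<partial>lborel) \<le>
    ennreal ((unit_ball_vol (DIM('a)) + 1) * \<mu> * R ^ DIM('a) * T)
     + ennreal (\<mu> powr (1 - 2 * s) / R ^ DIM('a)) * (\<integral>\<^sup>+t. (\<integral>\<^sup>+x. ennreal (X (x, t) powr s) \<partial>lborel)\<^sup>2 \<partial>lborel)"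
proof -
  define \<omega> where "\<omega> = unit_ball_vol (DIM('a))"
  define g where "g = (\<lambda>t. \<integral>\<^sup>+x. ennreal (X (x, t) powr s) \<partial>lborel)"
  \<comment> \<open>With this level the error mu^(1-s) nu of the second truncation is mu R^N, the
    same order as the error mu times the volume of the ball from the first. Together they give the
    factor \<open>unit_ball_vol\<close> + 1.\<close>
  define \<nu> where "\<nu> = \<mu> powr s * R ^ DIM('a)"
  have \<nu>: "\<nu> > 0" using pos by (simp add: \<nu>_def)
  have \<omega>: "\<omega> \<ge> 0" by (simp add: \<omega>_def)
  have [measurable]: "(\<lambda>z. ennreal (X z powr s)) \<in> borel_measurable borel" by measurable
  note [measurable] = borel_measurable_slice[OF this]
  have [measurable]: "g \<in> borel_measurable borel" unfolding g_def by measurable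
  let ?I = "indicator {0<..<T} :: real \<Rightarrow> ennreal"
  have slice: "(\<integral>\<^sup>+x. X (x, t) \<partial>lborel) \<le>
     ennreal (\<mu> * (\<omega> * R ^ DIM('a)) + \<mu> powr (1 - s) * \<nu>) * ?I t + ennreal (\<mu> powr (1 - s) / \<nu>) * (g t)\<^sup>2" for t
  proof (cases "t \<in> {0<..<T}")
    case False
    then have "X (x, t) = 0" for x using supp[of x t] by auto
    then show ?thesis by simp
  next
    case True
    have "(\<integral>\<^sup>+x. X (x, t) \<partial>lborel) \<le>
        (\<integral>\<^sup>+x. ennreal \<mu> * indicator (ball 0 R) x + ennreal (\<mu> powr (1 - s)) * ennreal (X (x, t) powr s) \<partial>lborel)"
    proof (rule nn_integral_mono)
      fix x
      show "ennreal (X (x, t)) \<le> ennreal \<mu> * indicator (ball 0 R) x + ennreal (\<mu> powr (1 - s)) * ennreal (X (x, t) powr s)"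
      proof (cases "X (x, t) = 0")
        case False
        have "ennreal (X (x, t)) \<le> ennreal (\<mu> + \<mu> powr (1 - s) * X (x, t) powr s)"
          by (intro ennreal_leI split_young X0 pos)
        moreover have "x \<in> ball 0 R" using supp False by simp
        ultimately show ?thesis using pos by (simp add: ennreal_mult)
      qed simp
    qed
    also have "\<dots> = ennreal \<mu> * emeasure lborel (ball (0::'a) R) + ennreal (\<mu> powr (1 - s)) * g t"
      unfolding g_def by (subst nn_integral_add) (measurable, auto simp: nn_integral_cmult nn_integral_cmult_indicator)
    also have "\<dots> \<le> ennreal \<mu> * emeasure lborel (ball (0::'a) R)
        + ennreal (\<mu> powr (1 - s)) * (ennreal \<nu> + ennreal (1 / \<nu>) * (g t)\<^sup>2)"
      by (intro add_left_mono mult_left_mono split_square \<nu>) simp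
    also have "\<dots> = ennreal (\<mu> * (\<omega> * R ^ DIM('a)) + \<mu> powr (1 - s) * \<nu>) + ennreal (\<mu> powr (1 - s) / \<nu>) * (g t)\<^sup>2"
    proof -
      have "ennreal (\<mu> powr (1 - s)) * (ennreal \<nu> + ennreal (1 / \<nu>) * (g t)\<^sup>2)
          = ennreal (\<mu> powr (1 - s) * \<nu>) + ennreal (\<mu> powr (1 - s) * (1 / \<nu>)) * (g t)\<^sup>2"
        using \<nu> by (simp add: distrib_left ennreal_mult mult.assoc del: times_divide_eq_right)
      moreover have "ennreal \<mu> * emeasure lborel (ball (0::'a) R) = ennreal (\<mu> * (\<omega> * R ^ DIM('a)))"
        using pos by (simp add: emeasure_ball \<omega>_def ennreal_mult)
      ultimately show ?thesis using pos \<nu> \<omega> by (simp add: add.assoc)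
    qed
    finally show ?thesis using True by simp
  qed
  have "(\<integral>\<^sup>+z. X z \<partial>lborel) = (\<integral>\<^sup>+t. \<integral>\<^sup>+x. X (x, t) \<partial>lborel \<partial>lborel)"
    by (subst nn_integral_time_space[of "\<lambda>z. ennreal (X z)"]) auto
  also have "\<dots> \<le> (\<integral>\<^sup>+t. ennreal (\<mu> * (\<omega> * R ^ DIM('a)) + \<mu> powr (1 - s) * \<nu>) * ?I t
       + ennreal (\<mu> powr (1 - s) / \<nu>) * (g t)\<^sup>2 \<partial>lborel)"
    by (intro nn_integral_mono slice)
  also have "\<dots> = ennreal (\<mu> * (\<omega> * R ^ DIM('a)) + \<mu> powr (1 - s) * \<nu>) * ennreal T
       + ennreal (\<mu> powr (1 - s) / \<nu>) * (\<integral>\<^sup>+t. (g t)\<^sup>2 \<partial>lborel)"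
    using pos by (subst nn_integral_add) (auto simp: nn_integral_cmult nn_integral_cmult_indicator)
  also have "ennreal (\<mu> * (\<omega> * R ^ DIM('a)) + \<mu> powr (1 - s) * \<nu>) * ennreal T
       = ennreal ((\<mu> * (\<omega> * R ^ DIM('a)) + \<mu> powr (1 - s) * \<nu>) * T)"
    using pos \<nu> \<omega> by (intro ennreal_mult[symmetric]) auto
  also have "\<mu> powr (1 - s) * \<nu> = \<mu> * R ^ DIM('a)"
    using pos by (simp add: \<nu>_def flip: powr_add mult.assoc)
  also have "\<mu> powr (1 - s) / \<nu> = \<mu> powr (1 - 2 * s) / R ^ DIM('a)"
    using pos by (simp add: \<nu>_def field_simps flip: powr_add)
  finally show ?thesis by (simp add: g_def \<omega>_def algebra_simps)
qed

text \<open>The integrand on the left is the geometric mean of the two on the right; this is the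
  origin of the exponent (p+q)/2.\<close>

lemma Cauchy_Schwarz_weighted:
  fixes v \<phi> :: "'a::euclidean_space \<Rightarrow> real"
  assumes [measurable]: "v \<in> borel_measurable borel" "\<phi> \<in> borel_measurable borel"
    and nn: "\<And>x. 0 \<le> v x" "\<And>x. 0 \<le> \<phi> x"
  shows "(\<integral>\<^sup>+x. ennreal (v x powr ((p + q) / 2) * \<phi> x) \<partial>lborel)\<^sup>2
    \<le> (\<integral>\<^sup>+x. ennreal (v x powr p * \<phi> x) \<partial>lborel) * (\<integral>\<^sup>+x. ennreal (v x powr q * \<phi> x) \<partial>lborel)"
proof -
  have half: "ennreal (sqrt (v x powr r * \<phi> x)) ^ 2 = ennreal (v x powr r * \<phi> x)" for r x
    using nn[of x] by (simp add: ennreal_power)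
  have prod: "ennreal (sqrt (v x powr p * \<phi> x)) * ennreal (sqrt (v x powr q * \<phi> x))
     = ennreal (v x powr ((p + q) / 2) * \<phi> x)" for x
  proof -
    have "(v x powr ((p + q) / 2))\<^sup>2 = v x powr p * v x powr q"
      by (simp add: power2_eq_square flip: powr_add)
    then have "sqrt (v x powr p * \<phi> x) * sqrt (v x powr q * \<phi> x) = sqrt ((v x powr ((p + q) / 2) * \<phi> x)\<^sup>2)"
      unfolding power_mult_distrib real_sqrt_mult[symmetric] by (simp add: power2_eq_square algebra_simps)
    then show ?thesis using nn[of x] by (simp add: ennreal_mult[symmetric])
  qed
  show ?thesis
    using Cauchy_Schwarz_nn_integral[of "\<lambda>x. ennreal (sqrt (v x powr p * \<phi> x))" lborel
        "\<lambda>x. ennreal (sqrt (v x powr q * \<phi> x))"]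
    by (simp add: half prod)
qed

section \<open>Testing a weak solution\<close>

lemma half_space_measurable: "half_space \<in> sets (borel :: ('a::euclidean_space \<times> real) measure)"
  by (auto simp: half_space_def open_Times)

lemma mem_half_space: "(x, t) \<in> half_space \<longleftrightarrow> 0 < t"
  by (auto simp: half_space_def)

text \<open>A weak solution is only Lebesgue measurable, on compact subsets of the closed
  half-space, whereas slicing by Tonelli is done for Borel functions. Measurability is assembled
  from an exhaustion by balls; extension by 0 to t <= 0 lets later integrals run over the whole
  space.\<close>

lemma Lp_loc_borel_representative:
  fixes u :: "'a::euclidean_space \<times> real \<Rightarrow> real"
  assumes "Lp_loc p closed_half_space u"
  obtains v where "v \<in> borel_measurable borel" "\<And>z. 0 \<le> v z" "\<And>x t. t \<le> 0 \<Longrightarrow> v (x, t) = 0"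
    "AE z in lborel. z \<in> half_space \<longrightarrow> v z = \<bar>u z\<bar>"
proof -
  let ?C = "\<lambda>n. closed_half_space \<inter> cball (0 :: 'a \<times> real) (real n)"
  have "closed (closed_half_space :: ('a \<times> real) set)"
    by (auto simp: closed_half_space_def closed_Times)
  then have "compact (?C n)" for n
    by (simp add: closed_Int_compact)
  then have m: "(\<lambda>z. indicator (?C n) z *\<^sub>R u z) \<in> borel_measurable lebesgue" for n
    using assms by (auto simp: Lp_loc_def set_borel_measurable_def)
  have "(\<lambda>n. indicator (?C n) z *\<^sub>R u z) \<longlonglongrightarrow> indicator closed_half_space z *\<^sub>R u z" for z
  proof -
    obtain N where N: "norm z \<le> real N" using real_arch_simple by blast
    have "\<forall>\<^sub>F n in sequentially. indicator (?C n) z *\<^sub>R u z = indicator closed_half_space z *\<^sub>R u z"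
      using eventually_ge_at_top[of N] by eventually_elim (use N in \<open>auto simp: indicator_def\<close>)
    then show ?thesis by (rule tendsto_eventually)
  qed
  then have "(\<lambda>z. indicator closed_half_space z *\<^sub>R u z) \<in> borel_measurable lebesgue"
    by (rule borel_measurable_LIMSEQ_real) (rule m)
  then obtain v0 where v0: "v0 \<in> borel_measurable lborel"
      "AE z in lborel. indicator closed_half_space z *\<^sub>R u z = v0 z"
    using completion_ex_borel_measurable_real by blast
  define v where "v = (\<lambda>z. indicator half_space z * \<bar>v0 z\<bar>)"
  have "v \<in> borel_measurable borel"
    using v0(1) half_space_measurable unfolding v_def by measurable
  moreover have "AE z in lborel. z \<in> half_space \<longrightarrow> v z = \<bar>u z\<bar>"
    using v0(2) by eventually_elim (auto simp: v_def half_space_def closed_half_space_def indicator_def)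
  ultimately show ?thesis
    by (intro that[of v]) (auto simp: v_def half_space_def)
qed

text \<open>Fubini for null sets freezes the first coordinate, whereas time is the second one; hence
  the swap.\<close>

lemma AE_time_slices:
  fixes P :: "'a::euclidean_space \<times> real \<Rightarrow> bool"
  assumes "AE z in lborel. P z"
  shows "AE t in lborel. AE x in lborel. P (x, t)"
proof -
  have "AE z in lborel \<Otimes>\<^sub>M lborel. P z" unfolding lborel_prod by (rule assms)
  then have "AE z in distr (lborel \<Otimes>\<^sub>M lborel) (lborel \<Otimes>\<^sub>M lborel) (\<lambda>(t, x). (x, t)). P z"
    by (subst (asm) lborel_pair.distr_pair_swap)
  then have "AE z in lborel \<Otimes>\<^sub>M lborel. P (case z of (t, x) \<Rightarrow> (x, t))"
    by (rule AE_distrD[rotated]) simp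
  then show ?thesis using lborel_pair.AE_pair by fastforce
qed

lemma AE_snd:
  assumes "AE t in lborel. Q t"
  shows "AE z in (lborel :: ('a::euclidean_space \<times> real) measure). Q (snd z)"
proof -
  obtain N where N: "N \<in> null_sets lborel" "{t. \<not> Q t} \<subseteq> N"
    using assms by (auto elim!: AE_E simp: null_sets_def)
  then have "UNIV \<times> N \<in> null_sets (lborel \<Otimes>\<^sub>M lborel :: ('a \<times> real) measure)"
    by (intro lborel.times_in_null_sets2) auto
  then show ?thesis
    using N(2) by (intro AE_I'[of "UNIV \<times> N"]) (auto simp: lborel_prod)
qed

text \<open>\<open>K 0\<close> may have any sign, but the point \<open>fst z\<close> is a null set.
  Where the integrand fails to be integrable, the integral is 0 by default, so the second claim
  holds at every \<open>z\<close>.\<close>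

lemma conv_nonneg:
  fixes z :: "'a::euclidean_space \<times> real"
  assumes "\<And>r. r > 0 \<Longrightarrow> K r > 0"
  shows "AE y in lborel. conv_integrand K p u z y \<ge> 0" "conv K p u z \<ge> 0"
proof -
  have "AE y in lborel. y \<noteq> fst z" by (rule AE_lborel_singleton)
  then show *: "AE y in lborel. conv_integrand K p u z y \<ge> 0"
    by eventually_elim (auto simp: conv_integrand_def intro!: mult_nonneg_nonneg less_imp_le[OF assms])
  show "conv K p u z \<ge> 0"
    unfolding conv_def by (intro integral_nonneg_AE AE_completion *)
qed

text \<open>On the support the kernel is at least \<open>K R\<close>, so the convolution dominates
  \<open>K R\<close> times a slice integral that depends on \<open>t\<close> alone. What remains is
  a product of two slice integrals at the same time, to which Cauchy-Schwarz applies slice by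
  slice.\<close>

lemma rhs_lower_bound:
  fixes u v \<phi> :: "'a::euclidean_space \<times> real \<Rightarrow> real"
  assumes Kpos: "\<And>r. r > 0 \<Longrightarrow> K r > 0" and Kinf: "\<And>r. 0 < r \<Longrightarrow> r < R \<Longrightarrow> K R \<le> K r"
    and R: "R > 0"
    and fin: "AE z in lebesgue. z \<in> half_space \<longrightarrow> integrable lebesgue (conv_integrand K p u z)"
    and v[measurable]: "v \<in> borel_measurable borel"
    and v0: "\<And>z. 0 \<le> v z" "\<And>x t. t \<le> 0 \<Longrightarrow> v (x, t) = 0"
    and vu: "AE z in lborel. z \<in> half_space \<longrightarrow> v z = \<bar>u z\<bar>"
    and \<phi>[measurable]: "\<phi> \<in> borel_measurable borel" and \<phi>01: "\<And>z. 0 \<le> \<phi> z" "\<And>z. \<phi> z \<le> 1"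
    and supp: "\<And>x t. \<phi> (x, t) \<noteq> 0 \<Longrightarrow> norm x < R / 2"
  shows "ennreal (K R) * (\<integral>\<^sup>+t. (\<integral>\<^sup>+x. ennreal (v (x, t) powr ((p + q) / 2) * \<phi> (x, t)) \<partial>lborel)\<^sup>2 \<partial>lborel)
     \<le> (\<integral>\<^sup>+z. ennreal (rhs_term K p q u z * \<phi> z) * indicator half_space z \<partial>lebesgue)"
proof -
  define F where "F = (\<lambda>r z. ennreal (v z powr r * \<phi> z))"
  have [measurable]: "F r \<in> borel_measurable borel" for r unfolding F_def by measurable
  define A where "A = (\<lambda>t. \<integral>\<^sup>+x. F p (x, t) \<partial>lborel)"
  have [measurable]: "A \<in> borel_measurable borel" unfolding A_def by (rule borel_measurable_slice) measurable
  have mA: "(\<lambda>z :: 'a \<times> real. A (snd z)) \<in> borel_measurable borel"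
    by (rule measurable_compose[of snd borel borel])
       (auto intro!: borel_measurable_continuous_onI continuous_on_snd continuous_on_id)
  have KR: "K R > 0" using Kpos R by blast
  \<comment> \<open>The convolution at \<open>z\<close> sees \<open>u\<close> on the entire slice at
    time \<open>snd z\<close>, so \<open>v\<close> must agree with the absolute value of
    \<open>u\<close> almost everywhere on that slice, for almost every \<open>z\<close>.\<close>
  have good: "AE z in lborel. AE y in lborel. (y, snd z) \<in> half_space \<longrightarrow> v (y, snd z) = \<bar>u (y, snd z)\<bar>"
    using AE_snd[OF AE_time_slices[OF vu]] .
  have fin': "AE z in lborel. z \<in> half_space \<longrightarrow> integrable lebesgue (conv_integrand K p u z)"
    using fin by (simp add: AE_completion_iff)
  have "AE z in lborel. ennreal (K R) * (A (snd z) * F q z) \<le> ennreal (rhs_term K p q u z * \<phi> z) * indicator half_space z"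
    using good fin' vu
  proof eventually_elim
    case (elim z)
    obtain x t where z: "z = (x, t)" by (cases z)
    show ?case
    proof (cases "0 < t \<and> \<phi> z \<noteq> 0")
      case False
      then show ?thesis using v0(2)[of t x] by (auto simp: F_def z)
    next
      case True
      then have int: "integrable lebesgue (conv_integrand K p u z)" and vz: "v z = \<bar>u z\<bar>"
        using elim by (auto simp: z mem_half_space)
      have x: "norm x < R / 2" using True supp[of x t] unfolding z by blast
      have "AE y in lborel. y \<noteq> x" by (rule AE_lborel_singleton)
      then have "AE y in lborel. ennreal (K R) * F p (y, t) \<le> ennreal (conv_integrand K p u z y)"
        using elim(1)
      proof eventually_elim
        case (elim y)
        show ?case
        proof (cases "\<phi> (y, t) = 0")
          case False
          then have "norm y < R / 2" by (rule supp)
          then have lt: "norm (x - y) < R" using x norm_triangle_ineq4[of x y] by linarith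
          have vy: "v (y, t) = \<bar>u (y, t)\<bar>" using elim True by (simp add: z mem_half_space)
          have "0 \<le> K (norm (x - y))" using elim Kpos[of "norm (x - y)"] by simp
          then have "K R * (v (y, t) powr p * \<phi> (y, t)) \<le> K (norm (x - y)) * (v (y, t) powr p * 1)"
            using elim lt KR \<phi>01 by (intro mult_mono Kinf) auto
          then show ?thesis using KR by (simp add: F_def conv_integrand_def z vy ennreal_mult'[symmetric] ennreal_leI)
        qed (simp add: F_def)
      qed
      then have "(\<integral>\<^sup>+y. ennreal (K R) * F p (y, t) \<partial>lborel) \<le> (\<integral>\<^sup>+y. ennreal (conv_integrand K p u z y) \<partial>lebesgue)"
        unfolding nn_integral_completion by (rule nn_integral_mono_AE)
      also have "\<dots> = ennreal (conv K p u z)"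
        unfolding conv_def
        by (rule nn_integral_eq_integral[OF int]) (intro AE_completion conv_nonneg Kpos)
      also have "(\<integral>\<^sup>+y. ennreal (K R) * F p (y, t) \<partial>lborel) = ennreal (K R) * A t"
        unfolding A_def by (rule nn_integral_cmult) (simp add: borel_measurable_slice)
      finally have "ennreal (K R) * A t * F q z \<le> ennreal (conv K p u z) * F q z"
        by (intro mult_right_mono) auto
      also have "\<dots> = ennreal (rhs_term K p q u z * \<phi> z)"
        using conv_nonneg(2)[of K p u z, OF Kpos] \<phi>01(1)
        by (simp add: F_def rhs_term_def vz ennreal_mult[symmetric] mult.assoc)
      finally show ?thesis using True by (simp add: z mem_half_space mult.assoc)
    qed
  qed
  then have "(\<integral>\<^sup>+z. ennreal (K R) * (A (snd z) * F q z) \<partial>lborel)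
     \<le> (\<integral>\<^sup>+z. ennreal (rhs_term K p q u z * \<phi> z) * indicator half_space z \<partial>lebesgue)"
    unfolding nn_integral_completion by (rule nn_integral_mono_AE)
  moreover have "ennreal (K R) * (\<integral>\<^sup>+t. (\<integral>\<^sup>+x. F ((p + q) / 2) (x, t) \<partial>lborel)\<^sup>2 \<partial>lborel)
     \<le> (\<integral>\<^sup>+z. ennreal (K R) * (A (snd z) * F q z) \<partial>lborel)"
  proof -
    have "(\<integral>\<^sup>+x. F ((p + q) / 2) (x, t) \<partial>lborel)\<^sup>2 \<le> A t * (\<integral>\<^sup>+x. F q (x, t) \<partial>lborel)" for t
    proof -
      have [measurable]: "(\<lambda>x. v (x, t)) \<in> borel_measurable borel" "(\<lambda>x. \<phi> (x, t)) \<in> borel_measurable borel"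
        using measurable_compose[OF _ v, of "\<lambda>x. (x, t)" borel] measurable_compose[OF _ \<phi>, of "\<lambda>x. (x, t)" borel]
        by (simp_all add: borel_prod[symmetric])
      show ?thesis unfolding A_def F_def by (rule Cauchy_Schwarz_weighted) (use v0 \<phi>01 in auto)
    qed
    then have "(\<integral>\<^sup>+t. (\<integral>\<^sup>+x. F ((p + q) / 2) (x, t) \<partial>lborel)\<^sup>2 \<partial>lborel) \<le> (\<integral>\<^sup>+t. A t * (\<integral>\<^sup>+x. F q (x, t) \<partial>lborel) \<partial>lborel)"
      by (rule nn_integral_mono)
    also have "\<dots> = (\<integral>\<^sup>+t. (\<integral>\<^sup>+x. A t * F q (x, t) \<partial>lborel) \<partial>lborel)"
      by (subst nn_integral_cmult) (auto intro: borel_measurable_slice)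
    also have "\<dots> = (\<integral>\<^sup>+z. A (snd z) * F q z \<partial>lborel)"
      using mA nn_integral_time_space[of "\<lambda>z. A (snd z) * F q z"] by simp
    finally show ?thesis
      using mA by (subst nn_integral_cmult) (auto intro: mult_left_mono)
  qed
  ultimately show ?thesis unfolding F_def by simp
qed

text \<open>Finiteness is recorded separately because the later absorption depends on it; it holds
  since \<open>\<phi>\<close> is bounded with compact support and the right-hand side is locally
  integrable up to t = 0.\<close>

lemma weak_solution_test_bound:
  fixes u :: "'a::euclidean_space \<times> real \<Rightarrow> real"
  assumes sol: "weak_solution k m K p q U u" and k: "k \<ge> 1"
    and Kpos: "\<And>r. r > 0 \<Longrightarrow> K r > 0"
    and test: "test_function \<phi>"
    and flat: "\<And>i x. i > 0 \<Longrightarrow> time_deriv i \<phi> (x, 0) = 0"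
    and init: "0 \<le> (LINT x|lebesgue. U (k - 1) x * \<phi> (x, 0))"
  defines "L \<equiv> \<lambda>z. (-1)^k * time_deriv k \<phi> z + space_polyharmonic m \<phi> z"
  shows "(\<integral>\<^sup>+z. ennreal (rhs_term K p q u z * \<phi> z) * indicator half_space z \<partial>lebesgue) < \<infinity>"
    and "(\<integral>\<^sup>+z. ennreal (rhs_term K p q u z * \<phi> z) * indicator half_space z \<partial>lebesgue)
       \<le> (\<integral>\<^sup>+z. ennreal \<bar>u z * L z\<bar> * indicator half_space z \<partial>lebesgue)"
proof -
  let ?f = "\<lambda>z. indicator half_space z * (rhs_term K p q u z * \<phi> z)"
  have weak: "set_integrable lebesgue half_space (\<lambda>z. u z * L z)"
     "(\<Sum>i=1..k. (-1)^i * (LINT x|lebesgue. U (k - i) x * time_deriv (i - 1) \<phi> (x, 0)))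
            + (LINT z:half_space|lebesgue. u z * L z)
          \<ge> (LINT z:half_space|lebesgue. rhs_term K p q u z * \<phi> z)"
    using sol test by (auto simp: weak_solution_def Let_def L_def)
  define S where "S = closure {z. \<phi> z \<noteq> 0}"
  have S: "compact S" using test by (simp add: S_def test_function_def)
  have \<phi>0: "\<phi> z = 0" if "z \<notin> S" for z using that closure_subset[of "{z. \<phi> z \<noteq> 0}"] unfolding S_def by blast
  have \<phi>: "\<phi> z \<ge> 0" "smooth_on UNIV \<phi>" for z using test unfolding test_function_def by blast+
  have "compact (\<phi> ` S)"
    using smooth_continuous[OF \<phi>(2)] S by (intro compact_continuous_image) (auto intro: continuous_on_subset)
  then obtain B where B: "\<And>z. z \<in> S \<Longrightarrow> \<bar>\<phi> z\<bar> \<le> B"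
    using compact_imp_bounded[of "\<phi> ` S"] unfolding bounded_iff by (metis image_eqI real_norm_def)
  have "closed (closed_half_space :: ('a \<times> real) set)"
    by (auto simp: closed_half_space_def closed_Times)
  then have "compact (closed_half_space \<inter> S)" using S by (rule closed_Int_compact)
  then have "set_integrable lebesgue (closed_half_space \<inter> S) (rhs_term K p q u)"
    using sol by (auto simp: weak_solution_def L1_loc_def)
  then have i1: "integrable lebesgue (\<lambda>z. indicator (closed_half_space \<inter> S) z * rhs_term K p q u z)"
    by (simp add: set_integrable_def)
  have [measurable]: "\<phi> \<in> borel_measurable borel"
    using smooth_continuous[OF \<phi>(2)] by (rule borel_measurable_continuous_onI)
  have hs: "half_space \<in> sets (lebesgue :: ('a \<times> real) measure)" "S \<in> sets (lebesgue :: ('a \<times> real) measure)"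
    using half_space_measurable compact_imp_closed[OF S] by auto
  have [measurable]: "\<phi> \<in> borel_measurable lebesgue" by (simp add: measurable_completion)
  have "?f = (\<lambda>z. (indicator (closed_half_space \<inter> S) z * rhs_term K p q u z) * (indicator half_space z * \<phi> z))"
    using \<phi>0 by (auto simp: fun_eq_iff indicator_def half_space_def closed_half_space_def)
  then have m: "?f \<in> borel_measurable lebesgue"
    using borel_measurable_integrable[OF i1] hs by simp
  have int: "integrable lebesgue ?f"
  proof (rule Bochner_Integration.integrable_bound[OF integrable_mult_right[OF i1, of B] m])
    show "AE z in lebesgue. norm (?f z) \<le> norm (B * (indicator (closed_half_space \<inter> S) z * rhs_term K p q u z))"
    proof (rule AE_I2)
      fix z :: "'a \<times> real"
      show "norm (?f z) \<le> norm (B * (indicator (closed_half_space \<inter> S) z * rhs_term K p q u z))"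
        using \<phi>0[of z] B[of z] mult_right_mono[of "\<bar>\<phi> z\<bar>" "\<bar>B\<bar>" "\<bar>rhs_term K p q u z\<bar>"]
        by (auto simp: indicator_def half_space_def closed_half_space_def abs_mult mult.commute)
    qed
  qed
  have f0: "0 \<le> ?f z" for z
    using conv_nonneg(2)[of K p u z, OF Kpos] \<phi>(1)[of z] by (simp add: rhs_term_def)
  have eq: "(\<integral>\<^sup>+z. ennreal (rhs_term K p q u z * \<phi> z) * indicator half_space z \<partial>lebesgue) = ennreal (integral\<^sup>L lebesgue ?f)"
    by (subst nn_integral_eq_integral[symmetric, OF int])
       (use f0 in \<open>auto intro!: nn_integral_cong simp: indicator_def\<close>)
  then show "(\<integral>\<^sup>+z. ennreal (rhs_term K p q u z * \<phi> z) * indicator half_space z \<partial>lebesgue) < \<infinity>" by simp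
  \<comment> \<open>Only i = 1 survives: it pairs \<open>U (k - 1)\<close> with the derivative of
    order 0 and carries the sign -1, so \<open>init\<close> makes it nonpositive.\<close>
  have "(\<Sum>i=1..k. (-1)^i * (LINT x|lebesgue. U (k - i) x * time_deriv (i - 1) \<phi> (x, 0)))
      = (\<Sum>i\<in>{1}. (-1)^i * (LINT x|lebesgue. U (k - i) x * time_deriv (i - 1) \<phi> (x, 0)))"
    using k by (intro sum.mono_neutral_right) (auto simp: flat)
  also have "\<dots> \<le> 0" using init by (simp add: time_deriv_0)
  finally have "integral\<^sup>L lebesgue ?f \<le> (LINT z:half_space|lebesgue. u z * L z)"
    using weak(2) by (simp add: set_lebesgue_integral_def)
  also have "\<dots> \<le> (LINT z|lebesgue. \<bar>indicator half_space z * (u z * L z)\<bar>)"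
    unfolding set_lebesgue_integral_def using weak(1)
    by (intro integral_mono) (auto simp: set_integrable_def)
  finally have "ennreal (integral\<^sup>L lebesgue ?f) \<le> ennreal (LINT z|lebesgue. \<bar>indicator half_space z * (u z * L z)\<bar>)"
    by (rule ennreal_leI)
  also have "\<dots> = (\<integral>\<^sup>+z. ennreal \<bar>indicator half_space z * (u z * L z)\<bar> \<partial>lebesgue)"
    using weak(1) by (intro nn_integral_eq_integral[symmetric]) (auto simp: set_integrable_def)
  also have "\<dots> = (\<integral>\<^sup>+z. ennreal \<bar>u z * L z\<bar> * indicator half_space z \<partial>lebesgue)"
    by (auto intro!: nn_integral_cong simp: indicator_def)
  finally show "(\<integral>\<^sup>+z. ennreal (rhs_term K p q u z * \<phi> z) * indicator half_space z \<partial>lebesgue)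
       \<le> (\<integral>\<^sup>+z. ennreal \<bar>u z * L z\<bar> * indicator half_space z \<partial>lebesgue)"
    by (simp add: eq)
qed

section \<open>The limit of large cutoffs\<close>

text \<open>For nonnegative \<open>f\<close> this is the square of the norm of L^2 in time with
  values in L^1 in space, not the norm itself.\<close>

definition mixed_norm :: "('a::euclidean_space \<times> real \<Rightarrow> real) \<Rightarrow> ennreal" where
  "mixed_norm f = (\<integral>\<^sup>+t. (\<integral>\<^sup>+x. ennreal (f (x, t)) \<partial>lborel)\<^sup>2 \<partial>lborel)"

lemma mixed_norm_mono:
  "(\<And>z. f z \<le> g z) \<Longrightarrow> mixed_norm f \<le> mixed_norm g"
  unfolding mixed_norm_def by (intro nn_integral_mono power_mono ennreal_leI) auto

lemma mixed_norm_measurable: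
  fixes f :: "'a::euclidean_space \<times> real \<Rightarrow> real"
  assumes "f \<in> borel_measurable borel"
  shows "(\<lambda>x. ennreal (f (x, t))) \<in> borel_measurable borel"
    "(\<lambda>t. \<integral>\<^sup>+x. ennreal (f (x, t)) \<partial>lborel) \<in> borel_measurable borel"
  using borel_measurable_slice[of "\<lambda>z. ennreal (f z)"] assms by auto

lemma tendsto_square_ennreal:
  fixes f :: "'b \<Rightarrow> ennreal"
  shows "(f \<longlongrightarrow> a) F \<Longrightarrow> ((\<lambda>x. (f x)\<^sup>2) \<longlongrightarrow> a\<^sup>2) F"
  unfolding power2_eq_square by (rule tendsto_mult_ennreal) auto

lemma mixed_norm_eq_0:
  fixes f :: "'a::euclidean_space \<times> real \<Rightarrow> real"
  assumes [measurable]: "f \<in> borel_measurable borel" and f0: "\<And>z. 0 \<le> f z" and "mixed_norm f = 0"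
  shows "AE z in lborel. f z = 0"
proof -
  note [measurable] = mixed_norm_measurable[OF assms(1)]
  have "AE t in lborel. (\<integral>\<^sup>+x. ennreal (f (x, t)) \<partial>lborel)\<^sup>2 = 0"
    using assms(3) unfolding mixed_norm_def by (subst (asm) nn_integral_0_iff_AE) auto
  then have "(\<integral>\<^sup>+t. \<integral>\<^sup>+x. ennreal (f (x, t)) \<partial>lborel \<partial>lborel) = 0"
    by (subst nn_integral_0_iff_AE) (auto simp: power2_eq_square)
  then have "(\<integral>\<^sup>+z. ennreal (f z) \<partial>lborel) = 0"
    by (subst (asm) nn_integral_time_space[of "\<lambda>z. ennreal (f z)"]) auto
  then have "AE z in lborel. ennreal (f z) = 0"
    by (subst (asm) nn_integral_0_iff_AE) auto
  then show ?thesis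
    by eventually_elim (use f0 in \<open>auto simp: ennreal_eq_0_iff intro: antisym\<close>)
qed

text \<open>Monotone convergence, first within each time slice and then in time.\<close>

lemma mixed_norm_incseq:
  fixes f :: "nat \<Rightarrow> 'a::euclidean_space \<times> real \<Rightarrow> real"
  assumes [measurable]: "\<And>n. f n \<in> borel_measurable borel"
    and inc: "\<And>n z. f n z \<le> f (Suc n) z" and lim: "\<And>z. (\<lambda>n. f n z) \<longlonglongrightarrow> g z"
  shows "(\<lambda>n. mixed_norm (f n)) \<longlonglongrightarrow> mixed_norm g"
proof -
  note [measurable] = mixed_norm_measurable[OF assms(1)]
  have "(\<lambda>n. \<integral>\<^sup>+x. ennreal (f n (x, t)) \<partial>lborel) \<longlonglongrightarrow> (\<integral>\<^sup>+x. ennreal (g (x, t)) \<partial>lborel)" for t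
    by (rule nn_integral_LIMSEQ)
       (auto simp: incseq_Suc_iff le_fun_def intro!: ennreal_leI inc tendsto_ennrealI lim)
  from tendsto_square_ennreal[OF this] show ?thesis
    unfolding mixed_norm_def
    by (intro nn_integral_LIMSEQ)
       (auto simp: incseq_Suc_iff le_fun_def intro!: power_mono nn_integral_mono ennreal_leI inc)
qed

text \<open>Dominated convergence twice: a finite mixed norm makes almost every slice integral of
  \<open>g\<close> finite, which supplies the inner majorant, and the squares of these integrals are
  the outer one.\<close>

lemma mixed_norm_tendsto_0:
  fixes f :: "nat \<Rightarrow> 'a::euclidean_space \<times> real \<Rightarrow> real"
  assumes [measurable]: "\<And>n. f n \<in> borel_measurable borel" "g \<in> borel_measurable borel"
    and le: "\<And>n z. f n z \<le> g z" and lim: "\<And>z. (\<lambda>n. f n z) \<longlonglongrightarrow> 0"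
    and fin: "mixed_norm g < \<infinity>"
  shows "(\<lambda>n. mixed_norm (f n)) \<longlonglongrightarrow> 0"
proof -
  note [measurable] = mixed_norm_measurable[OF assms(1)] mixed_norm_measurable[OF assms(2)]
  have "AE t in lborel. (\<integral>\<^sup>+x. ennreal (g (x, t)) \<partial>lborel)\<^sup>2 \<noteq> \<infinity>"
    using fin unfolding mixed_norm_def by (intro nn_integral_PInf_AE) auto
  then have "AE t in lborel. (\<lambda>n. (\<integral>\<^sup>+x. ennreal (f n (x, t)) \<partial>lborel)\<^sup>2) \<longlonglongrightarrow> 0"
  proof eventually_elim
    case (elim t)
    have "(\<lambda>n. \<integral>\<^sup>+x. ennreal (f n (x, t)) \<partial>lborel) \<longlonglongrightarrow> (\<integral>\<^sup>+x. 0 \<partial>(lborel :: 'a measure))"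
    proof (rule nn_integral_dominated_convergence)
      show "(\<integral>\<^sup>+x. ennreal (g (x, t)) \<partial>lborel) < \<infinity>"
        using elim by (auto simp: less_top power_eq_top_ennreal)
      show "AE x in lborel. (\<lambda>n. ennreal (f n (x, t))) \<longlonglongrightarrow> 0"
        using tendsto_ennrealI[OF lim] by simp
    qed (auto intro!: ennreal_leI le)
    from tendsto_square_ennreal[OF this] show ?case by simp
  qed
  then have "(\<lambda>n. mixed_norm (f n)) \<longlonglongrightarrow> (\<integral>\<^sup>+t. 0 \<partial>(lborel :: real measure))"
    unfolding mixed_norm_def
    by (intro nn_integral_dominated_convergence[where w = "\<lambda>t. (\<integral>\<^sup>+x. ennreal (g (x, t)) \<partial>lborel)\<^sup>2"])
       (use fin in \<open>auto simp: mixed_norm_def intro!: power_mono nn_integral_mono ennreal_leI le\<close>)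
  then show ?thesis by simp
qed

text \<open>The multiple of \<open>J\<close> is moved to the left, which is legitimate in the
  extended reals only because \<open>J\<close> is finite.\<close>

lemma absorb_half:
  fixes J A :: ennreal
  assumes "J \<le> A + ennreal c * J" "c \<le> 1 / 2" "J < \<infinity>" "c \<ge> 0"
  shows "J \<le> 2 * A"
proof (cases A)
  case (real a)
  obtain j where j: "J = ennreal j" "j \<ge> 0" using assms(3) by (cases J) auto
  have "ennreal j \<le> ennreal (a + c * j)" using assms(1,4) real j by (simp add: ennreal_mult)
  then have "j \<le> a + c * j" using real j assms(4) by (simp add: ennreal_le_iff del: ennreal_plus)
  also have "c * j \<le> (1 / 2) * j" using assms(2) j by (intro mult_right_mono)
  finally have "j \<le> 2 * a" by simp
  then have "ennreal j \<le> ennreal (2 * a)" by (rule ennreal_leI)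
  then show ?thesis using j real by (simp add: ennreal_mult)
qed (simp add: ennreal_mult_top)

text \<open>Neither the radii nor the cutoffs are assumed monotone, so the functions with
  \<open>\<phi> n\<close> cannot be compared with each other. The fixed boxes \<open>P j\<close>
  mediate: each lies in the plateau for all large n. Limits are taken in the order n, then j, then l
  to 0.\<close>

lemma vanishing_by_exhaustion:
  fixes w :: "'a::euclidean_space \<times> real \<Rightarrow> real" and \<phi> :: "nat \<Rightarrow> 'a \<times> real \<Rightarrow> real"
  assumes [measurable]: "w \<in> borel_measurable borel" "\<And>n. \<phi> n \<in> borel_measurable borel"
    and w0: "\<And>z. 0 \<le> w z" and \<phi>01: "\<And>n z. 0 \<le> \<phi> n z" "\<And>n z. \<phi> n z \<le> 1"
    and r: "filterlim r at_top sequentially"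
    and plateau: "\<And>n x t. norm x < r n \<Longrightarrow> \<bar>t\<bar> < r n \<Longrightarrow> \<phi> n (x, t) = 1"
    and D[measurable]: "\<And>n. D n \<in> sets borel"
    and D_far: "\<And>n x t. (x, t) \<in> D n \<Longrightarrow> norm x < r n \<Longrightarrow> \<bar>t\<bar> < r n \<Longrightarrow> False"
    and est: "\<And>n l. 0 < l \<Longrightarrow> mixed_norm (\<lambda>z. w z * \<phi> n z) \<le>
        ennreal (a * l) + ennreal (b * l powr (- e)) * mixed_norm (\<lambda>z. w z * \<phi> n z * indicator (D n) z)"
    and fin: "\<And>n. mixed_norm (\<lambda>z. w z * \<phi> n z) < \<infinity>"
    and e: "e > 0" and a: "a \<ge> 0" and b: "b \<ge> 0"
  shows "AE z in lborel. w z = 0"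
proof -
  define P where "P = (\<lambda>j::nat. ball (0::'a) (real j) \<times> {-real j<..<real j})"
  have [measurable]: "P j \<in> sets borel" for j by (auto simp: P_def open_Times)
  define G where "G = (\<lambda>j. mixed_norm (\<lambda>z. w z * indicator (P j) z))"
  have G_le: "\<forall>\<^sub>F n in sequentially. G j \<le> mixed_norm (\<lambda>z. w z * \<phi> n z)" for j
  proof -
    have "\<forall>\<^sub>F n in sequentially. real j \<le> r n" using r by (simp add: filterlim_at_top)
    then show ?thesis
    proof eventually_elim
      case (elim n)
      have "indicator (P j) z \<le> \<phi> n z" for z
        using plateau[of "fst z" n "snd z"] elim \<phi>01(1)[of n z]
        by (cases "z \<in> P j") (auto simp: P_def)
      then show ?case unfolding G_def by (intro mixed_norm_mono mult_left_mono w0)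
    qed
  qed
  have G_lim: "G \<longlonglongrightarrow> mixed_norm w"
    unfolding G_def
  proof (rule mixed_norm_incseq)
    fix z :: "'a \<times> real"
    obtain N where N: "norm (fst z) + \<bar>snd z\<bar> < real N" using reals_Archimedean2 by blast
    have "\<forall>\<^sub>F n in sequentially. w z * indicator (P n) z = w z"
      using eventually_ge_at_top[of N]
    proof eventually_elim
      case (elim n)
      then have "norm (fst z) < real n" "\<bar>snd z\<bar> < real n" using N norm_ge_zero[of "fst z"] by linarith+
      then show ?case by (auto simp: P_def indicator_def mem_Times_iff)
    qed
    then show "(\<lambda>n. w z * indicator (P n) z) \<longlonglongrightarrow> w z" by (rule tendsto_eventually)
  next
    fix n and z :: "'a \<times> real"
    show "w z * indicator (P n) z \<le> w z * indicator (P (Suc n)) z"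
      by (intro mult_left_mono w0) (auto simp: P_def indicator_def)
  qed measurable
  \<comment> \<open>As e > 0, a large l brings the feedback coefficient down to 1/2, and the
    resulting bound does not depend on n.\<close>
  obtain l0 where l0: "l0 > 0" "b * l0 powr (- e) \<le> 1 / 2"
  proof -
    have "((\<lambda>x. b * x powr (- e)) \<longlongrightarrow> b * 0) at_top"
      using e by (intro tendsto_mult tendsto_const tendsto_neg_powr filterlim_ident) auto
    then have "\<forall>\<^sub>F x in at_top. b * x powr (- e) < 1 / 2" by (rule order_tendstoD) simp
    then have "\<forall>\<^sub>F x in at_top. b * x powr (- e) < 1 / 2 \<and> x > 0"
      using eventually_gt_at_top[of 0] by eventually_elim simp
    then obtain x where "b * x powr (- e) < 1 / 2" "x > 0"
      using eventually_happens[of _ "at_top :: real filter"] trivial_limit_at_top_linorder by blast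
    then show ?thesis by (intro that[of x]) auto
  qed
  have D_le: "mixed_norm (\<lambda>z. w z * \<phi> n z * indicator (D n) z) \<le> mixed_norm (\<lambda>z. w z * \<phi> n z)" for n
    by (intro mixed_norm_mono) (auto simp: indicator_def w0 \<phi>01)
  have J_bound: "mixed_norm (\<lambda>z. w z * \<phi> n z) \<le> 2 * ennreal (a * l0)" for n
  proof (rule absorb_half[OF _ l0(2) fin])
    show "mixed_norm (\<lambda>z. w z * \<phi> n z) \<le> ennreal (a * l0) + ennreal (b * l0 powr (- e)) * mixed_norm (\<lambda>z. w z * \<phi> n z)"
      by (rule order_trans[OF est[OF l0(1)]]) (intro add_left_mono mult_left_mono D_le, simp)
  qed (use b in simp)
  have "G j \<le> 2 * ennreal (a * l0)" for j
  proof -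
    obtain n where "G j \<le> mixed_norm (\<lambda>z. w z * \<phi> n z)"
      using eventually_happens[OF G_le[of j]] by auto
    then show ?thesis using J_bound order_trans by blast
  qed
  then have "mixed_norm w \<le> 2 * ennreal (a * l0)"
    by (intro LIMSEQ_le_const2[OF G_lim]) auto
  then have w_fin: "mixed_norm w < \<infinity>"
    by (rule le_less_trans) (simp add: ennreal_mult_less_top)
  \<comment> \<open>The uniform bound has just made \<open>mixed_norm w\<close> finite, so
    \<open>w\<close> is a majorant; every fixed point eventually lies outside
    \<open>D n\<close>.\<close>
  have D_lim: "(\<lambda>n. mixed_norm (\<lambda>z. w z * \<phi> n z * indicator (D n) z)) \<longlonglongrightarrow> 0"
  proof (rule mixed_norm_tendsto_0[OF _ _ _ _ w_fin])
    fix z :: "'a \<times> real"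
    have "\<forall>\<^sub>F n in sequentially. norm (fst z) + \<bar>snd z\<bar> + 1 \<le> r n" using r by (simp add: filterlim_at_top)
    then have "\<forall>\<^sub>F n in sequentially. w z * \<phi> n z * indicator (D n) z = 0"
    proof eventually_elim
      case (elim n)
      then have "norm (fst z) < r n" "\<bar>snd z\<bar> < r n" using norm_ge_zero[of "fst z"] by linarith+
      then have "z \<notin> D n" using D_far[of "fst z" "snd z" n] by auto
      then show ?case by simp
    qed
    then show "(\<lambda>n. w z * \<phi> n z * indicator (D n) z) \<longlonglongrightarrow> 0" by (rule tendsto_eventually)
  next
    show "w z * \<phi> n z * indicator (D n) z \<le> w z" for n z
      using mult_left_mono[OF \<phi>01(2)[of n z] w0[of z]] w0[of z] by (auto simp: indicator_def)
  qed measurable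
  \<comment> \<open>For fixed l the remainder disappears as n grows, however large its coefficient;
    only afterwards may l become small.\<close>
  have small: "mixed_norm w \<le> ennreal (a * l)" if "l > 0" for l
  proof (rule LIMSEQ_le_const2[OF G_lim], intro exI allI impI)
    fix j
    have "(\<lambda>n. ennreal (b * l powr (- e)) * mixed_norm (\<lambda>z. w z * \<phi> n z * indicator (D n) z)) \<longlonglongrightarrow> ennreal (b * l powr (- e)) * 0"
      by (rule tendsto_mult_ennreal[OF tendsto_const D_lim]) auto
    then have "(\<lambda>n. ennreal (a * l) + ennreal (b * l powr (- e)) * mixed_norm (\<lambda>z. w z * \<phi> n z * indicator (D n) z)) \<longlonglongrightarrow> ennreal (a * l) + ennreal (b * l powr (- e)) * 0"
      by (intro tendsto_add tendsto_const)
    then have "(\<lambda>n. ennreal (a * l) + ennreal (b * l powr (- e)) * mixed_norm (\<lambda>z. w z * \<phi> n z * indicator (D n) z)) \<longlonglongrightarrow> ennreal (a * l)"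
      by simp
    then show "G j \<le> ennreal (a * l)"
    proof (rule tendsto_lowerbound)
      show "\<forall>\<^sub>F n in sequentially. G j \<le> ennreal (a * l) + ennreal (b * l powr (- e)) * mixed_norm (\<lambda>z. w z * \<phi> n z * indicator (D n) z)"
        using G_le[of j] by eventually_elim (use est[OF that] order_trans in blast)
    qed simp
  qed
  have "mixed_norm w \<le> 0"
  proof (rule ennreal_le_epsilon)
    fix \<epsilon> :: real assume "\<epsilon> > 0"
    have "mixed_norm w \<le> ennreal (a * (\<epsilon> / (a + 1)))" using a \<open>\<epsilon> > 0\<close> by (intro small) auto
    also have "\<dots> \<le> ennreal \<epsilon>" using a \<open>\<epsilon> > 0\<close> by (intro ennreal_leI) (simp add: field_simps)
    finally show "mixed_norm w \<le> 0 + ennreal \<epsilon>" by simp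
  qed
  then show ?thesis by (intro mixed_norm_eq_0 w0) auto
qed

section \<open>Nonexistence\<close>

text \<open>The time scale T satisfies T^k = R^(2m), so the two parts of the operator acquire the
  same factor.\<close>

lemma test_operator_rescale:
  assumes "smooth_on UNIV \<Phi>" "k \<ge> 1" "R > 0"
  shows "(-1)^k * time_deriv k (\<lambda>z. \<Phi> (rescale R (R powr (2 * real m / real k)) z)) z
      + space_polyharmonic m (\<lambda>z. \<Phi> (rescale R (R powr (2 * real m / real k)) z)) z
    = R powr (- (2 * real m)) * ((-1)^k * time_deriv k \<Phi> (rescale R (R powr (2 * real m / real k)) z)
      + space_polyharmonic m \<Phi> (rescale R (R powr (2 * real m / real k)) z))"
proof -
  have "(1 / R powr (2 * real m / real k)) ^ k = R powr (- (2 * real m))"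
    using assms by (simp add: powr_minus_divide power_divide powr_powr flip: powr_realpow)
  moreover have "(1 / R) ^ (2 * m) = R powr (- (2 * real m))"
    using assms powr_realpow[of R "2 * m"] by (simp add: powr_minus_divide power_divide)
  ultimately show ?thesis
    by (simp add: time_deriv_rescale space_polyharmonic_rescale assms(1) algebra_simps)
qed

lemma ennreal_divide_estimate:
  fixes J J' :: ennreal
  assumes "ennreal K * J \<le> ennreal c * (ennreal A + ennreal B * J')"
    and "K > 0" "c \<ge> 0" "A \<ge> 0" "B \<ge> 0" "c * A / K \<le> A'" "c * B / K \<le> B'"
  shows "J \<le> ennreal A' + ennreal B' * J'"
proof -
  have "ennreal (1 / K) * ennreal K = 1" using assms(2) by (simp flip: ennreal_mult)
  then have "J = ennreal (1 / K) * (ennreal K * J)" by (simp add: mult.assoc[symmetric])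
  also have "\<dots> \<le> ennreal (1 / K) * (ennreal c * (ennreal A + ennreal B * J'))"
    using assms(1) by (rule mult_left_mono) simp
  also have "\<dots> = ennreal (c * A / K) + ennreal (c * B / K) * J'"
  proof -
    have "ennreal (1 / K) * (ennreal c * ennreal A) = ennreal (c * A / K)"
      using assms by (simp flip: ennreal_mult)
    moreover have "ennreal (1 / K) * (ennreal c * ennreal B) = ennreal (c * B / K)"
      using assms by (simp flip: ennreal_mult)
    ultimately show ?thesis by (simp add: distrib_left mult.assoc[symmetric])
  qed
  also have "\<dots> \<le> ennreal A' + ennreal B' * J'"
    using assms by (intro add_mono mult_right_mono ennreal_leI) auto
  finally show ?thesis .
qed

text \<open>The coefficients on the right are free of \<open>R\<close>; this uniformity is what
  makes the passage to large radii possible. \<open>D\<close> is the complement of the rescaled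
  plateau, hence contains every point at which the operator applied to \<open>\<phi>\<close> is
  nonzero.\<close>

lemma scaled_estimate:
  fixes u v :: "'a::euclidean_space \<times> real \<Rightarrow> real" and m k :: nat and p q R \<delta> :: real
  defines "s \<equiv> (p + q) / 2" and "\<theta> \<equiv> 2 * real m / real k"
  defines "\<alpha> \<equiv> (2 * real DIM('a) + \<theta>) / (p + q) - real DIM('a) + 2 * real m * (1 - 1 / real k)"
  assumes k: "k \<ge> 1" and pq: "p > 0" "q > 0" "p + q > 2"
    and sol: "weak_solution k m K p q U u"
    and Kpos: "\<And>r. r > 0 \<Longrightarrow> K r > 0" and Kinf: "\<And>r. 0 < r \<Longrightarrow> r < R \<Longrightarrow> K R \<le> K r"
    and R: "R > 0" and \<delta>: "\<delta> > 0" "\<delta> \<le> K R * R powr \<alpha>"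
    and v[measurable]: "v \<in> borel_measurable borel"
    and v0: "\<And>z. 0 \<le> v z" "\<And>x t. t \<le> 0 \<Longrightarrow> v (x, t) = 0"
    and vu: "AE z in lborel. z \<in> half_space \<longrightarrow> v z = \<bar>u z\<bar>"
    and \<Phi>: "smooth_on UNIV \<Phi>" "\<And>z. 0 \<le> \<Phi> z" "\<And>z. \<Phi> z \<le> 1"
    "\<And>x t. \<Phi> (x, t) \<noteq> 0 \<Longrightarrow> norm x < 1 / 2 \<and> \<bar>t\<bar> < 1 / 2"
    "\<And>i x. i > 0 \<Longrightarrow> time_deriv i \<Phi> (x, 0) = 0"
    "\<And>z. \<bar>(-1)^k * time_deriv k \<Phi> z + space_polyharmonic m \<Phi> z\<bar> \<le> C * \<Phi> z powr (1 / s)"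
    "\<And>x t. norm x < 1 / 4 \<Longrightarrow> \<bar>t\<bar> < 1 / 4 \<Longrightarrow>
       (-1)^k * time_deriv k \<Phi> (x, t) + space_polyharmonic m \<Phi> (x, t) = 0"
    "C \<ge> 0"
  defines "\<phi> \<equiv> \<lambda>z. \<Phi> (rescale R (R powr \<theta>) z)"
  assumes init: "0 \<le> (LINT x|lebesgue. U (k - 1) x * \<phi> (x, 0))"
  defines "D \<equiv> - (ball 0 (R / 4) \<times> {-(R powr \<theta> / 4)<..<R powr \<theta> / 4})"
  shows "mixed_norm (\<lambda>z. v z powr s * \<phi> z) < \<infinity>"
    and "l > 0 \<Longrightarrow> mixed_norm (\<lambda>z. v z powr s * \<phi> z) \<le>
        ennreal (C * (unit_ball_vol DIM('a) + 1) / \<delta> * l) +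
        ennreal (C / \<delta> * l powr (- (2 * s - 1))) * mixed_norm (\<lambda>z. v z powr s * \<phi> z * indicator D z)"
proof -
  define T where "T = R powr \<theta>"
  have T: "T > 0" using R by (simp add: T_def)
  have s: "s > 1" using pq by (simp add: s_def)
  have KR: "K R > 0" using Kpos R by blast
  have test: "test_function \<phi>" and supp: "\<And>x t. \<phi> (x, t) \<noteq> 0 \<Longrightarrow> norm x < R / 2 \<and> \<bar>t\<bar> < T / 2"
    using test_function_rescale[OF \<Phi>(1,2,4) R T] unfolding \<phi>_def T_def by blast+
  have \<phi>01: "0 \<le> \<phi> z" "\<phi> z \<le> 1" for z using \<Phi> by (auto simp: \<phi>_def)
  have [measurable]: "\<phi> \<in> borel_measurable borel"
    using smooth_continuous test unfolding test_function_def by (blast intro: borel_measurable_continuous_onI)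
  have [measurable]: "D \<in> sets borel" unfolding D_def by (intro borel_open borel_comp open_Times) auto
  have flat: "time_deriv i \<phi> (x, 0) = 0" if "i > 0" for i x
    using \<Phi>(5)[OF that] unfolding \<phi>_def time_deriv_rescale[OF \<Phi>(1)] by (simp add: rescale_def)
  have fin: "AE z in lebesgue. z \<in> half_space \<longrightarrow> integrable lebesgue (conv_integrand K p u z)"
    using sol by (simp add: weak_solution_def)
  let ?rhs = "\<integral>\<^sup>+z. ennreal (rhs_term K p q u z * \<phi> z) * indicator half_space z \<partial>lebesgue"
  let ?L = "\<lambda>z. (-1)^k * time_deriv k \<phi> z + space_polyharmonic m \<phi> z"
  have low: "ennreal (K R) * mixed_norm (\<lambda>z. v z powr s * \<phi> z) \<le> ?rhs"
    unfolding mixed_norm_def s_def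
    by (rule rhs_lower_bound[OF Kpos Kinf R fin v v0 vu _ \<phi>01]) (use supp in auto)
  have rhs: "?rhs < \<infinity>" "?rhs \<le> (\<integral>\<^sup>+z. ennreal \<bar>u z * ?L z\<bar> * indicator half_space z \<partial>lebesgue)"
    using weak_solution_test_bound[OF sol k Kpos test flat init] by auto
  show "mixed_norm (\<lambda>z. v z powr s * \<phi> z) < \<infinity>"
    using le_less_trans[OF low rhs(1)] KR by (auto simp: ennreal_mult_less_top)
  assume l: "l > 0"
  \<comment> \<open>The exponent 1/s is the one in the bound for the profile; it makes
    \<open>X^s\<close> equal to the density of the mixed norm, restricted to
    \<open>D\<close>.\<close>
  define X where "X = (\<lambda>z. v z * \<phi> z powr (1 / s) * indicator D z)"
  have [measurable]: "X \<in> borel_measurable borel" unfolding X_def by measurable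
  have X_powr: "X z powr s = v z powr s * \<phi> z * indicator D z" for z
    using s v0(1)[of z] \<phi>01(1)[of z]
    by (auto simp: X_def powr_mult powr_powr indicator_def)
  have op: "\<bar>?L z\<bar> \<le> C * R powr (- (2 * real m)) * (\<phi> z powr (1 / s) * indicator D z)" for z
  proof -
    let ?z = "rescale R T z"
    have eq: "?L z = R powr (- (2 * real m)) * ((-1)^k * time_deriv k \<Phi> ?z + space_polyharmonic m \<Phi> ?z)"
      unfolding \<phi>_def T_def \<theta>_def by (rule test_operator_rescale[OF \<Phi>(1) k R])
    show ?thesis
    proof (cases "z \<in> D")
      case True
      then show ?thesis
        using mult_left_mono[OF \<Phi>(6)[of ?z], of "R powr (- (2 * real m))"]
        unfolding eq abs_mult by (simp add: \<phi>_def T_def mult_ac)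
    next
      case False
      then have "norm (fst z /\<^sub>R R) < 1 / 4" "\<bar>snd z / T\<bar> < 1 / 4"
        using R T by (auto simp: D_def T_def[symmetric] mem_Times_iff field_simps abs_if)
      from \<Phi>(7)[OF this] have "?L z = 0" unfolding eq by (simp add: rescale_def)
      then show ?thesis using False by simp
    qed
  qed
  \<comment> \<open>Up to factors free of R, c A is R^(-2m - beta + N + theta) and c B is R^(-2m -
    beta + 2 s beta - N). This beta equates the two exponents, and their common value is
    -alpha.\<close>
  define \<beta> where "\<beta> = (2 * real DIM('a) + \<theta>) / (2 * s)"
  define \<mu> where "\<mu> = l * R powr (- \<beta>)"
  define c where "c = C * R powr (- (2 * real m))"
  define A where "A = (unit_ball_vol (DIM('a)) + 1) * \<mu> * R ^ DIM('a) * T"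
  define B where "B = \<mu> powr (1 - 2 * s) / R ^ DIM('a)"
  have "?rhs \<le> (\<integral>\<^sup>+z. ennreal \<bar>u z * ?L z\<bar> * indicator half_space z \<partial>lborel)"
    using rhs(2) by (simp add: nn_integral_completion)
  also have "\<dots> \<le> (\<integral>\<^sup>+z. ennreal c * ennreal (X z) \<partial>lborel)"
  proof (rule nn_integral_mono_AE)
    show "AE z in lborel. ennreal \<bar>u z * ?L z\<bar> * indicator half_space z \<le> ennreal c * ennreal (X z)"
      using vu
    proof eventually_elim
      case (elim z)
      show ?case
      proof (cases "z \<in> half_space")
        case True
        have "\<bar>u z * ?L z\<bar> \<le> v z * (c * (\<phi> z powr (1 / s) * indicator D z))"
          unfolding abs_mult c_def using elim True v0(1)[of z] op[of z] by (intro mult_mono) auto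
        also have "\<dots> = c * X z" by (simp add: X_def)
        finally have "ennreal \<bar>u z * ?L z\<bar> \<le> ennreal (c * X z)" by (rule ennreal_leI)
        then show ?thesis using True \<Phi>(8) v0(1)[of z] by (simp add: ennreal_mult c_def X_def)
      qed simp
    qed
  qed
  also have "\<dots> = ennreal c * (\<integral>\<^sup>+z. ennreal (X z) \<partial>lborel)"
    by (rule nn_integral_cmult) simp
  also have "(\<integral>\<^sup>+z. ennreal (X z) \<partial>lborel) \<le> ennreal A + ennreal B * mixed_norm (\<lambda>z. X z powr s)"
    unfolding A_def B_def mixed_norm_def
  proof (rule nonlinear_estimate)
    show "norm x < R \<and> 0 < t \<and> t < T" if "X (x, t) \<noteq> 0" for x t
    proof -
      have "\<phi> (x, t) \<noteq> 0" "v (x, t) \<noteq> 0" using that by (auto simp: X_def)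
      then show ?thesis using supp[of x t] v0(2)[of t x] R T by (cases "t \<le> 0") auto
    qed
    show "0 \<le> X z" for z using v0(1)[of z] by (simp add: X_def)
    show "\<mu> > 0" using l R by (simp add: \<mu>_def)
  qed (use s R T in auto)
  finally have "?rhs \<le> ennreal c * (ennreal A + ennreal B * mixed_norm (\<lambda>z. X z powr s))"
    by (simp add: mult_left_mono)
  with low have "ennreal (K R) * mixed_norm (\<lambda>z. v z powr s * \<phi> z)
      \<le> ennreal c * (ennreal A + ennreal B * mixed_norm (\<lambda>z. v z powr s * \<phi> z * indicator D z))"
    unfolding X_powr by (rule order_trans)
  then show "mixed_norm (\<lambda>z. v z powr s * \<phi> z) \<le>
        ennreal (C * (unit_ball_vol DIM('a) + 1) / \<delta> * l) +
        ennreal (C / \<delta> * l powr (- (2 * s - 1))) * mixed_norm (\<lambda>z. v z powr s * \<phi> z * indicator D z)"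
  proof (rule ennreal_divide_estimate[OF _ KR])
    have \<alpha>\<beta>: "\<alpha> = \<beta> - real DIM('a) + 2 * real m - \<theta>"
    proof -
      have "2 * s = p + q" by (simp add: s_def)
      then show ?thesis by (simp add: \<alpha>_def \<beta>_def \<theta>_def right_diff_distrib)
    qed
    have \<beta>s: "\<beta> * (2 * s) = 2 * real DIM('a) + \<theta>" using s by (simp add: \<beta>_def)
    have RN: "R ^ DIM('a) = R powr real DIM('a)" using R by (simp add: powr_realpow)
    \<comment> \<open>Here the growth condition enters: \<open>\<delta>\<close> <= K(R) R^alpha
      trades 1/K(R) for R^alpha / \<open>\<delta>\<close>, which cancels the remaining power of
      R.\<close>
    have inv: "y / K R \<le> y * R powr \<alpha> / \<delta>" if "y \<ge> 0" for y
      using mult_left_mono[OF \<delta>(2) that] \<delta>(1) KR by (simp add: field_simps)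
    show "c \<ge> 0" using \<Phi>(8) by (simp add: c_def)
    show "A \<ge> 0" "B \<ge> 0" using l R T by (simp_all add: A_def B_def \<mu>_def)
    have "c * A / K R \<le> c * A * R powr \<alpha> / \<delta>" using \<open>c \<ge> 0\<close> \<open>A \<ge> 0\<close> by (intro inv) simp
    also have "c * A * R powr \<alpha> = C * (unit_ball_vol DIM('a) + 1) * l *
        R powr (- (2 * real m) + - \<beta> + real DIM('a) + \<theta> + \<alpha>)"
      unfolding powr_add by (simp add: c_def A_def \<mu>_def T_def RN)
    also have "- (2 * real m) + - \<beta> + real DIM('a) + \<theta> + \<alpha> = 0" by (simp add: \<alpha>\<beta>)
    finally show "c * A / K R \<le> C * (unit_ball_vol DIM('a) + 1) / \<delta> * l"
      using R by simp
    have "c * B / K R \<le> c * B * R powr \<alpha> / \<delta>" using \<open>c \<ge> 0\<close> \<open>B \<ge> 0\<close> by (intro inv) simp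
    also have "c * B * R powr \<alpha> = C * l powr (1 - 2 * s) *
        R powr (- (2 * real m) + (- \<beta>) * (1 - 2 * s) + - real DIM('a) + \<alpha>)"
    proof -
      have "\<mu> powr (1 - 2 * s) = l powr (1 - 2 * s) * R powr ((- \<beta>) * (1 - 2 * s))"
        unfolding \<mu>_def using l R by (simp only: powr_mult powr_powr powr_ge_zero)
      then show ?thesis
        unfolding powr_add using R by (simp add: c_def B_def RN powr_minus_divide)
    qed
    also have "- (2 * real m) + (- \<beta>) * (1 - 2 * s) + - real DIM('a) + \<alpha> = 0"
      using \<beta>s by (simp add: \<alpha>\<beta> algebra_simps)
    finally show "c * B / K R \<le> C / \<delta> * l powr (- (2 * s - 1))"
      using R by simp
  qed
qed

text \<open>Nonnegative data give the sign for every n. For data with positive integral, the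
  pairings converge to that integral by dominated convergence, so the sign is known only for large
  n.\<close>

lemma cutoff_initial_data:
  fixes \<psi> :: "nat \<Rightarrow> 'a::euclidean_space \<Rightarrow> real"
  assumes data: "(AE x in lebesgue. f x \<ge> 0) \<or> integrable lebesgue f \<and> (LINT x|lebesgue. f x) > 0"
    and [measurable]: "\<And>n. \<psi> n \<in> borel_measurable borel"
    and \<psi>01: "\<And>n x. 0 \<le> \<psi> n x" "\<And>n x. \<psi> n x \<le> 1"
    and lim: "\<And>x. \<forall>\<^sub>F n in sequentially. \<psi> n x = 1"
  shows "\<forall>\<^sub>F n in sequentially. 0 \<le> (LINT x|lebesgue. f x * \<psi> n x)"
  using data
proof
  assume "AE x in lebesgue. f x \<ge> 0"
  then have "AE x in lebesgue. 0 \<le> f x * \<psi> n x" for n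
    by eventually_elim (simp add: \<psi>01)
  then show ?thesis by (simp add: integral_nonneg_AE)
next
  assume f: "integrable lebesgue f \<and> (LINT x|lebesgue. f x) > 0"
  have "(\<lambda>n. LINT x|lebesgue. f x * \<psi> n x) \<longlonglongrightarrow> (LINT x|lebesgue. f x)"
  proof (rule integral_dominated_convergence)
    show "f \<in> borel_measurable lebesgue" using f by auto
    moreover have "\<psi> n \<in> borel_measurable lebesgue" for n by (simp add: measurable_completion)
    ultimately show "(\<lambda>x. f x * \<psi> n x) \<in> borel_measurable lebesgue" for n by simp
    show "integrable lebesgue (\<lambda>x. norm (f x))" using f by auto
    show "AE x in lebesgue. (\<lambda>n. f x * \<psi> n x) \<longlonglongrightarrow> f x"
    proof (rule AE_I2)
      fix x
      have "\<forall>\<^sub>F n in sequentially. f x * \<psi> n x = f x" using lim[of x] by eventually_elim simp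
      then show "(\<lambda>n. f x * \<psi> n x) \<longlonglongrightarrow> f x" by (rule tendsto_eventually)
    qed
    show "AE x in lebesgue. norm (f x * \<psi> n x) \<le> norm (f x)" for n
      using \<psi>01 by (intro AE_I2) (simp add: abs_mult mult_left_le)
  qed
  then have "\<forall>\<^sub>F n in sequentially. 0 < (LINT x|lebesgue. f x * \<psi> n x)"
    using f by (auto dest: order_tendstoD)
  then show ?thesis by eventually_elim simp
qed

lemma weak_solution_eq_0:
  fixes u :: "'a::euclidean_space \<times> real \<Rightarrow> real" and m k :: nat and p q :: real
  assumes m: "m \<ge> 1" and k: "k \<ge> 1" and pq: "p > 0" "q > 0" "p + q > 2"
    and Kpos: "\<And>r. r > 0 \<Longrightarrow> K r > 0" and Kinf: "\<exists>R0. \<forall>R>R0. (INF r\<in>{0<..<R}. K r) = K R"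
    and growth: "Limsup at_top (\<lambda>R. ereal (K R * R powr
         ((2 * real DIM('a) + 2 * real m / real k) / (p + q) - real DIM('a)
           + 2 * real m * (1 - 1 / real k)))) > 0"
    and sol: "weak_solution k m K p q U u"
    and data: "(AE x in lebesgue. U (k - 1) x \<ge> 0) \<or>
      integrable lebesgue (U (k - 1)) \<and> (LINT x|lebesgue. U (k - 1) x) > 0"
  shows "AE z in lebesgue. z \<in> half_space \<longrightarrow> u z = 0"
proof -
  define s where "s = (p + q) / 2"
  define \<theta> where "\<theta> = 2 * real m / real k"
  define \<alpha> where "\<alpha> = (2 * real DIM('a) + \<theta>) / (p + q) - real DIM('a) + 2 * real m * (1 - 1 / real k)"
  have s: "s > 1" and \<theta>: "\<theta> > 0" using pq m k by (simp_all add: s_def \<theta>_def)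
  obtain \<Phi> :: "'a \<times> real \<Rightarrow> real" and C where \<Phi>:
    "smooth_on UNIV \<Phi>" "\<And>z. 0 \<le> \<Phi> z" "\<And>z. \<Phi> z \<le> 1"
    "\<And>x t. \<Phi> (x, t) \<noteq> 0 \<Longrightarrow> norm x < 1 / 2 \<and> \<bar>t\<bar> < 1 / 2"
    "\<And>x t. norm x < 1 / 4 \<Longrightarrow> \<bar>t\<bar> < 1 / 4 \<Longrightarrow> \<Phi> (x, t) = 1"
    "\<And>i x. i > 0 \<Longrightarrow> time_deriv i \<Phi> (x, 0) = 0"
    "\<And>z. \<bar>(-1)^k * time_deriv k \<Phi> z + space_polyharmonic m \<Phi> z\<bar> \<le> C * \<Phi> z powr (1 / s)"
    "\<And>x t. norm x < 1 / 4 \<Longrightarrow> \<bar>t\<bar> < 1 / 4 \<Longrightarrow>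
       (-1)^k * time_deriv k \<Phi> (x, t) + space_polyharmonic m \<Phi> (x, t) = 0"
    "C \<ge> 0"
    using cutoff_profile_exists[OF s k m] by blast
  obtain v where v[measurable]: "v \<in> borel_measurable borel"
    and v0: "\<And>z. 0 \<le> v z" "\<And>x t. t \<le> 0 \<Longrightarrow> v (x, t) = 0"
    and vu: "AE z in lborel. z \<in> half_space \<longrightarrow> v z = \<bar>u z\<bar>"
  proof -
    have "Lp_loc p closed_half_space u" using sol by (simp add: weak_solution_def)
    then show ?thesis by (rule Lp_loc_borel_representative) (rule that)
  qed
  obtain R0 where R0: "\<forall>R>R0. (INF r\<in>{0<..<R}. K r) = K R" using Kinf by blast
  \<comment> \<open>Any number strictly between 0 and the upper limit is exceeded for arbitrarily
    large radii, though not for all of them.\<close>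
  obtain \<delta> where \<delta>: "\<delta> > 0" "\<exists>\<^sub>F R in at_top. \<delta> < K R * R powr \<alpha>"
  proof -
    obtain d where d: "0 < ereal d" "ereal d < Limsup at_top (\<lambda>R. ereal (K R * R powr \<alpha>))"
      using ereal_dense2[OF growth] by (auto simp: \<alpha>_def \<theta>_def)
    have "\<not> (\<forall>\<^sub>F R in at_top. ereal (K R * R powr \<alpha>) \<le> ereal d)"
      using d(2) Limsup_bounded[of "\<lambda>R. ereal (K R * R powr \<alpha>)" "ereal d" at_top] leD by blast
    then have "\<exists>\<^sub>F R in at_top. d < K R * R powr \<alpha>"
      by (simp add: frequently_def not_less)
    then show ?thesis using d(1) that by simp
  qed
  \<comment> \<open>Radii beyond n make the sequence tend to infinity, those beyond
    \<open>R0\<close> give access to the infimum condition, and those beyond 1 are positive.\<close>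
  have "\<exists>R. real n < R \<and> max R0 1 < R \<and> \<delta> < K R * R powr \<alpha>" for n
    using frequently_eventually_frequently[OF \<delta>(2)
        eventually_conj[OF eventually_gt_at_top[of "real n"] eventually_gt_at_top[of "max R0 1"]]]
    by (blast dest: frequently_ex)
  then obtain r where r: "\<And>n. real n < r n" "\<And>n. max R0 1 < r n" "\<And>n. \<delta> < K (r n) * r n powr \<alpha>"
    by metis
  have r_top: "filterlim r at_top sequentially"
    by (rule filterlim_at_top_mono[OF filterlim_real_sequentially]) (use r(1) in \<open>auto intro!: always_eventually less_imp_le\<close>)
  have r_powr_top: "\<forall>\<^sub>F n in sequentially. Z \<le> r n powr \<theta>" for Z
  proof -
    have "\<forall>\<^sub>F n in sequentially. max 1 Z powr (1 / \<theta>) \<le> r n" using r_top by (simp add: filterlim_at_top)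
    then show ?thesis
    proof eventually_elim
      case (elim n)
      have "max 1 Z = (max 1 Z powr (1 / \<theta>)) powr \<theta>" using \<theta> by (simp add: powr_powr)
      also have "\<dots> \<le> r n powr \<theta>" using \<theta> elim by (intro powr_mono2) auto
      finally show ?case by simp
    qed
  qed
  \<comment> \<open>The rescaled plateau has half-widths r/4 in space and r^theta/4 in time. The
    smaller of them serves as a single radius, and it tends to infinity because theta > 0.\<close>
  define \<rho> where "\<rho> = (\<lambda>n. min (r n / 4) (r n powr \<theta> / 4))"
  have \<rho>_top: "filterlim \<rho> at_top sequentially"
    unfolding filterlim_at_top \<rho>_def
  proof
    fix Z :: real
    have "\<forall>\<^sub>F n in sequentially. 4 * Z \<le> r n" "\<forall>\<^sub>F n in sequentially. 4 * Z \<le> r n powr \<theta>"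
      using r_top r_powr_top by (auto simp: filterlim_at_top)
    then show "\<forall>\<^sub>F n in sequentially. Z \<le> min (r n / 4) (r n powr \<theta> / 4)"
      by eventually_elim simp
  qed
  define \<phi> where "\<phi> = (\<lambda>n z. \<Phi> (rescale (r n) (r n powr \<theta>) z))"
  have r0: "r n > 0" for n using r(2)[of n] by simp
  have \<phi>1: "\<phi> n (x, t) = 1" if "norm x < \<rho> n" "\<bar>t\<bar> < \<rho> n" for n x t
    unfolding \<phi>_def rescale_def using that r0[of n] by (auto intro!: \<Phi>(5) simp: \<rho>_def field_simps)
  have \<phi>01: "0 \<le> \<phi> n z" "\<phi> n z \<le> 1" for n z using \<Phi> by (auto simp: \<phi>_def)
  have cont: "continuous_on UNIV (\<phi> n)" for n
    unfolding \<phi>_def by (rule smooth_continuous[OF smooth_scale[OF bounded_linear_rescale \<Phi>(1)]])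
  then have [measurable]: "\<phi> n \<in> borel_measurable borel" for n
    by (rule borel_measurable_continuous_onI)
  have "\<forall>\<^sub>F n in sequentially. 0 \<le> (LINT x|lebesgue. U (k - 1) x * \<phi> n (x, 0))"
  proof (rule cutoff_initial_data[OF data])
    show "(\<lambda>x. \<phi> n (x, 0)) \<in> borel_measurable borel" for n
      by (intro borel_measurable_continuous_onI continuous_on_compose2[OF cont])
         (auto intro!: continuous_intros)
    show "\<forall>\<^sub>F n in sequentially. \<phi> n (x, 0) = 1" for x
    proof -
      have "\<forall>\<^sub>F n in sequentially. norm x + 1 \<le> \<rho> n" using \<rho>_top by (simp add: filterlim_at_top)
      then show ?thesis
      proof eventually_elim
        case (elim n)
        then have "norm x < \<rho> n" "0 < \<rho> n" using norm_ge_zero[of x] by linarith+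
        then show ?case by (simp add: \<phi>1)
      qed
    qed
  qed (use \<phi>01 in auto)
  then obtain n0 where n0: "\<And>n. n \<ge> n0 \<Longrightarrow> 0 \<le> (LINT x|lebesgue. U (k - 1) x * \<phi> n (x, 0))"
    by (auto simp: eventually_sequentially)
  define D where "D = (\<lambda>n. - (ball (0::'a) (r n / 4) \<times> {-(r n powr \<theta> / 4)<..<r n powr \<theta> / 4}))"
  \<comment> \<open>Positivity bounds \<open>K\<close> below on the interval, so its infimum there
    is a genuine lower bound and not a default value.\<close>
  have K_le: "K (r n) \<le> K y" if "0 < y" "y < r n" for n y
  proof -
    have "(INF y\<in>{0<..<r n}. K y) \<le> K y"
      using that Kpos by (intro cINF_lower bdd_belowI2[where m=0]) (auto intro: less_imp_le)
    then show ?thesis using R0 r(2)[of n] by auto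
  qed
  \<comment> \<open>The shift by \<open>n0\<close> discards the finitely many cutoffs for which the
    pairing with the initial datum may be negative.\<close>
  have "AE z in lborel. v z powr s = 0"
  proof (rule vanishing_by_exhaustion[where r="\<lambda>n. \<rho> (n + n0)" and \<phi>="\<lambda>n. \<phi> (n + n0)" and D="\<lambda>n. D (n + n0)"
        and a="C * (unit_ball_vol DIM('a) + 1) / \<delta>" and b="C / \<delta>" and e="2 * s - 1"])
    show "filterlim (\<lambda>n. \<rho> (n + n0)) at_top sequentially"
      using \<rho>_top by (simp add: filterlim_sequentially_iff_filterlim_real filterlim_compose[OF _ filterlim_add_const_nat_at_top])
    show "D (n + n0) \<in> sets borel" for n
      unfolding D_def by (intro borel_comp borel_open open_Times) auto
    show False if "(x, t) \<in> D (n + n0)" "norm x < \<rho> (n + n0)" "\<bar>t\<bar> < \<rho> (n + n0)" for x t n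
      using that by (auto simp: D_def \<rho>_def)
    have init: "0 \<le> (LINT x|lebesgue. U (k - 1) x * \<Phi> (rescale (r (n + n0)) (r (n + n0) powr \<theta>) (x, 0)))" for n
      using n0[of "n + n0", OF le_add2] unfolding \<phi>_def .
    note est = scaled_estimate[where u=u and p=p and q=q and m=m and k=k, folded s_def \<theta>_def, folded \<alpha>_def,
        OF k pq sol Kpos K_le r0 \<delta>(1) less_imp_le[OF r(3)] v v0 vu \<Phi>(1-4,6-9)]
    show "mixed_norm (\<lambda>z. v z powr s * \<phi> (n + n0) z) < \<infinity>" for n
      unfolding \<phi>_def by (rule est(1)) (assumption | rule init)+
    show "mixed_norm (\<lambda>z. v z powr s * \<phi> (n + n0) z)
         \<le> ennreal (C * (unit_ball_vol DIM('a) + 1) / \<delta> * l) +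
           ennreal (C / \<delta> * l powr - (2 * s - 1)) *
           mixed_norm (\<lambda>z. v z powr s * \<phi> (n + n0) z * indicator (D (n + n0)) z)" if "0 < l" for n l
      unfolding \<phi>_def D_def by (rule est(2)) (assumption | rule init that)+
  qed (use \<phi>1 \<phi>01 s \<Phi>(9) \<delta>(1) in auto)
  then have "AE z in lborel. z \<in> half_space \<longrightarrow> u z = 0"
    using vu by eventually_elim auto
  then show ?thesis by (rule AE_completion)
qed

section \<open>A decaying profile\<close>

text \<open>An algebra of bounded functions, stable under differentiation, that contains the
  logarithmic derivatives of the profile. Every derivative of the profile is therefore the profile
  times a member.\<close>

inductive_set symbols :: "('a::euclidean_space \<Rightarrow> real) set" where
  const: "(\<lambda>_. c) \<in> symbols"
| odd: "(\<lambda>x. (x \<bullet> b) / (1 + (x \<bullet> b)\<^sup>2)) \<in> symbols"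
| even: "(\<lambda>x. 1 / (1 + (x \<bullet> b)\<^sup>2)) \<in> symbols"
| add: "f \<in> symbols \<Longrightarrow> g \<in> symbols \<Longrightarrow> (\<lambda>x. f x + g x) \<in> symbols"
| mult: "f \<in> symbols \<Longrightarrow> g \<in> symbols \<Longrightarrow> (\<lambda>x. f x * g x) \<in> symbols"

lemma symbols_cmult: "f \<in> symbols \<Longrightarrow> (\<lambda>x. c * f x) \<in> symbols"
  by (rule symbols.mult[OF symbols.const])

lemma symbols_sum: "(\<And>i. i \<in> I \<Longrightarrow> f i \<in> symbols) \<Longrightarrow> (\<lambda>x. \<Sum>i\<in>I. f i x) \<in> symbols"
  by (induction I rule: infinite_finite_induct) (auto intro: symbols.const symbols.add)

lemma symbols_bounded:
  assumes "f \<in> symbols" shows "\<exists>B. \<forall>x. \<bar>f x\<bar> \<le> B"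
  using assms
proof induction
  case (odd b)
  have "\<bar>y\<bar> \<le> 1 + y\<^sup>2" for y :: real
  proof -
    have "0 \<le> (\<bar>y\<bar> - 1)\<^sup>2" by simp
    then have "2 * \<bar>y\<bar> \<le> 1 + y\<^sup>2" by (simp add: power2_diff)
    then show ?thesis by linarith
  qed
  then show ?case by (intro exI[of _ 1]) (auto simp: abs_divide divide_le_eq add_pos_nonneg)
next
  case (even b)
  then show ?case by (intro exI[of _ 1]) (auto simp: divide_le_eq add_pos_nonneg)
next
  case (add f g)
  then obtain A B where "\<forall>x. \<bar>f x\<bar> \<le> A" "\<forall>x. \<bar>g x\<bar> \<le> B" by blast
  then show ?case
    by (intro exI[of _ "A + B"] allI) (meson abs_triangle_ineq add_mono order_trans)
next
  case (mult f g)
  then obtain A B where AB: "\<forall>x. \<bar>f x\<bar> \<le> A" "\<forall>x. \<bar>g x\<bar> \<le> B" by blast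
  then have "\<bar>f x * g x\<bar> \<le> A * B" for x
    unfolding abs_mult by (meson abs_ge_zero mult_mono order_trans)
  then show ?case by blast
qed auto

text \<open>With a = y/(1+y^2) and c = 1/(1+y^2) one has a' = c - 2 a^2 and c' = -2 a c, so the
  generators differentiate into the algebra.\<close>

lemma symbols_derivative:
  assumes "f \<in> symbols"
  shows "\<exists>f'. (\<forall>x. (f has_derivative f' x) (at x)) \<and> (\<forall>v. (\<lambda>x. f' x v) \<in> symbols)"
  using assms
proof induction
  case (const c)
  show ?case by (intro exI[of _ "\<lambda>_ _. 0"]) (auto intro: symbols.const)
next
  case (odd b)
  let ?a = "\<lambda>x. (x \<bullet> b) / (1 + (x \<bullet> b)\<^sup>2)" and ?c = "\<lambda>x. 1 / (1 + (x \<bullet> b)\<^sup>2)"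
  have "(?a has_derivative (\<lambda>v. (v \<bullet> b) * (?c x + (- 2) * (?a x * ?a x)))) (at x)" for x
  proof -
    have nz: "1 + (x \<bullet> b)\<^sup>2 \<noteq> 0" by (metis add_pos_nonneg less_numeral_extra(1,3) zero_le_power2)
    have "((\<lambda>y. y / (1 + y\<^sup>2)) has_real_derivative (?c x + (- 2) * (?a x * ?a x))) (at (x \<bullet> b))"
    proof (rule DERIV_cong)
      show "((\<lambda>y. y / (1 + y\<^sup>2)) has_real_derivative
          (1 * (1 + (x \<bullet> b)\<^sup>2) - (x \<bullet> b) * (2 * (x \<bullet> b))) / ((1 + (x \<bullet> b)\<^sup>2) * (1 + (x \<bullet> b)\<^sup>2))) (at (x \<bullet> b))"
        using nz by (auto intro!: derivative_eq_intros)
      have "(1 * D - y * (2 * y)) / (D * D) = 1 / D + (- 2) * (y / D * (y / D))" if "D \<noteq> 0" for y D :: real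
        using that by (simp add: field_simps)
      from this[OF nz] show "(1 * (1 + (x \<bullet> b)\<^sup>2) - (x \<bullet> b) * (2 * (x \<bullet> b))) / ((1 + (x \<bullet> b)\<^sup>2) * (1 + (x \<bullet> b)\<^sup>2))
          = ?c x + (- 2) * (?a x * ?a x)" .
    qed
    from has_derivative_compose[OF has_derivative_inner_left[OF has_derivative_ident] this[unfolded has_field_derivative_def]]
    show ?thesis by (simp add: mult.commute)
  qed
  moreover have "(\<lambda>x. (v \<bullet> b) * (?c x + (- 2) * (?a x * ?a x))) \<in> symbols" for v
    by (intro symbols_cmult symbols.add symbols.mult symbols.even symbols.odd)
  ultimately show ?case
    by (intro exI[of _ "\<lambda>x v. (v \<bullet> b) * (?c x + (- 2) * (?a x * ?a x))"]) blast
next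
  case (even b)
  let ?a = "\<lambda>x. (x \<bullet> b) / (1 + (x \<bullet> b)\<^sup>2)" and ?c = "\<lambda>x. 1 / (1 + (x \<bullet> b)\<^sup>2)"
  have "(?c has_derivative (\<lambda>v. (v \<bullet> b) * ((- 2) * (?a x * ?c x)))) (at x)" for x
  proof -
    have nz: "1 + (x \<bullet> b)\<^sup>2 \<noteq> 0" by (metis add_pos_nonneg less_numeral_extra(1,3) zero_le_power2)
    have "((\<lambda>y. 1 / (1 + y\<^sup>2)) has_real_derivative ((- 2) * (?a x * ?c x))) (at (x \<bullet> b))"
      using nz by (auto intro!: derivative_eq_intros simp: field_simps power2_eq_square)
    from has_derivative_compose[OF has_derivative_inner_left[OF has_derivative_ident] this[unfolded has_field_derivative_def]]
    show ?thesis by (simp add: mult.commute)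
  qed
  moreover have "(\<lambda>x. (v \<bullet> b) * ((- 2) * (?a x * ?c x))) \<in> symbols" for v
    by (intro symbols_cmult symbols.mult symbols.even symbols.odd)
  ultimately show ?case
    by (intro exI[of _ "\<lambda>x v. (v \<bullet> b) * ((- 2) * (?a x * ?c x))"]) blast
next
  case (add f g)
  then obtain f' g' where
    "\<forall>x. (f has_derivative f' x) (at x)" "\<forall>v. (\<lambda>x. f' x v) \<in> symbols"
    "\<forall>x. (g has_derivative g' x) (at x)" "\<forall>v. (\<lambda>x. g' x v) \<in> symbols" by blast
  then show ?case
    by (intro exI[of _ "\<lambda>x v. f' x v + g' x v"])
       (auto intro: symbols.add has_derivative_add)
next
  case (mult f g)
  then obtain f' g' where fg:
    "\<forall>x. (f has_derivative f' x) (at x)" "\<forall>v. (\<lambda>x. f' x v) \<in> symbols"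
    "\<forall>x. (g has_derivative g' x) (at x)" "\<forall>v. (\<lambda>x. g' x v) \<in> symbols" by blast
  then have "(\<lambda>x. f x * g' x v + f' x v * g x) \<in> symbols" for v
    using symbols.add[OF symbols.mult[OF mult.hyps(1), of "\<lambda>x. g' x v"] symbols.mult[OF _ mult.hyps(2), of "\<lambda>x. f' x v"]]
    by blast
  with fg show ?case
    by (intro exI[of _ "\<lambda>x v. f x * g' x v + f' x v * g x"]) (blast intro: has_derivative_mult)
qed

text \<open>This is exp(-M t) times the product of the (1 + x_i^2)^(-n), written as one exponential
  so that each derivative is the function itself times the derivative of the exponent.\<close>

definition profile :: "nat \<Rightarrow> real \<Rightarrow> 'a::euclidean_space \<times> real \<Rightarrow> real" where
  "profile n M z = exp (- (real n * (\<Sum>b\<in>Basis. ln (1 + (fst z \<bullet> b)\<^sup>2))) - M * snd z)"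

definition profile_log_deriv :: "nat \<Rightarrow> real \<Rightarrow> 'a::euclidean_space \<times> real \<Rightarrow> 'a \<Rightarrow> real" where
  "profile_log_deriv n M v x =
     (\<Sum>b\<in>Basis. (- 2 * real n * (fst v \<bullet> b)) * ((x \<bullet> b) / (1 + (x \<bullet> b)\<^sup>2))) + (- M * snd v)"

lemma profile_has_derivative:
  "(profile n M has_derivative (\<lambda>v. profile n M z * profile_log_deriv n M v (fst z))) (at z)"
proof -
  have "((\<lambda>z. ln (1 + (fst z \<bullet> b)\<^sup>2)) has_derivative
      (\<lambda>v. 2 * ((fst z \<bullet> b) / (1 + (fst z \<bullet> b)\<^sup>2)) * (fst v \<bullet> b))) (at z)" for b
  proof -
    have "1 + (fst z \<bullet> b)\<^sup>2 > 0" by (simp add: add_pos_nonneg)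
    then have "((\<lambda>y. ln (1 + y\<^sup>2)) has_real_derivative 2 * ((fst z \<bullet> b) / (1 + (fst z \<bullet> b)\<^sup>2))) (at (fst z \<bullet> b))"
      by (auto intro!: derivative_eq_intros)
    from has_derivative_compose[OF has_derivative_inner_left[OF has_derivative_fst[OF has_derivative_ident]]
        this[unfolded has_field_derivative_def]]
    show ?thesis .
  qed
  then have "((\<lambda>z. - (real n * (\<Sum>b\<in>Basis. ln (1 + (fst z \<bullet> b)\<^sup>2))) - M * snd z) has_derivative
      (\<lambda>v. - (real n * (\<Sum>b\<in>Basis. 2 * ((fst z \<bullet> b) / (1 + (fst z \<bullet> b)\<^sup>2)) * (fst v \<bullet> b))) - M * snd v)) (at z)"
    by (intro derivative_intros)
  note has_derivative_compose[OF this DERIV_exp[unfolded has_field_derivative_def]]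
  moreover have "profile_log_deriv n M v (fst z) =
      - (real n * (\<Sum>b\<in>Basis. 2 * ((fst z \<bullet> b) / (1 + (fst z \<bullet> b)\<^sup>2)) * (fst v \<bullet> b))) - M * snd v" for v
    by (simp add: profile_log_deriv_def sum_distrib_left sum_negf mult_ac)
  ultimately show ?thesis
    unfolding profile_def[symmetric] by (simp add: mult.commute)
qed

lemma profile_log_deriv_symbol: "profile_log_deriv n M v \<in> symbols"
  unfolding profile_log_deriv_def[abs_def]
  by (intro symbols.add symbols.const symbols_sum symbols_cmult symbols.odd)

text \<open>\<open>f'\<close> is chosen before \<open>M\<close>, which enters only through the
  logarithmic derivative; this prepares for symbols that do not depend on \<open>M\<close>.\<close>

lemma profile_symbol_derivative:
  assumes "f \<in> symbols"
  shows "\<exists>f'. (\<forall>v. f' v \<in> symbols) \<and> (\<forall>M z. ((\<lambda>z. profile n M z * f (fst z)) has_derivative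
      (\<lambda>v. profile n M z * (profile_log_deriv n M v (fst z) * f (fst z) + f' v (fst z)))) (at z))"
proof -
  obtain f' where f': "\<forall>x. (f has_derivative f' x) (at x)" "\<forall>v. (\<lambda>x. f' x v) \<in> symbols"
    using symbols_derivative[OF assms] by blast
  have "((\<lambda>z. profile n M z * f (fst z)) has_derivative
      (\<lambda>v. profile n M z * (profile_log_deriv n M v (fst z) * f (fst z) + f' (fst z) (fst v)))) (at z)" for M z
  proof -
    have "((\<lambda>z. f (fst z)) has_derivative (\<lambda>v. f' (fst z) (fst v))) (at z)"
      by (rule has_derivative_compose[OF has_derivative_fst[OF has_derivative_ident]]) (use f' in blast)
    from has_derivative_mult[OF profile_has_derivative this] show ?thesis
      by (simp add: algebra_simps)
  qed
  then show ?thesis using f'(2) by (intro exI[of _ "\<lambda>v x. f' x (fst v)"]) auto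
qed

lemma smooth_profile_symbol:
  assumes "f \<in> symbols"
  shows "smooth_on UNIV (\<lambda>z. profile n M z * f (fst z))"
proof (rule smooth_on_coinduct[where C="{\<lambda>z. profile n M z * f (fst z) |f. f \<in> symbols}"])
  show "(\<lambda>z. profile n M z * f (fst z)) \<in> {\<lambda>z. profile n M z * f (fst z) |f. f \<in> symbols}"
    using assms by blast
next
  fix g :: "'a \<times> real \<Rightarrow> real" assume "g \<in> {\<lambda>z. profile n M z * f (fst z) |f. f \<in> symbols}"
  then obtain f where f: "f \<in> symbols" "g = (\<lambda>z. profile n M z * f (fst z))" by blast
  obtain f' where f': "\<forall>v. f' v \<in> symbols" "\<forall>z. (g has_derivative
      (\<lambda>v. profile n M z * (profile_log_deriv n M v (fst z) * f (fst z) + f' v (fst z)))) (at z)"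
    using profile_symbol_derivative[OF f(1)] unfolding f(2) by blast
  have "(\<lambda>x. profile_log_deriv n M v x * f x + f' v x) \<in> symbols" for v
    using symbols.add[OF symbols.mult[OF profile_log_deriv_symbol f(1)] f'(1)[rule_format]] .
  then have "(\<lambda>z. profile n M z * (profile_log_deriv n M v (fst z) * f (fst z) + f' v (fst z)))
      \<in> {\<lambda>z. profile n M z * f (fst z) |f. f \<in> symbols}" for v
    by (intro CollectI exI[of _ "\<lambda>x. profile_log_deriv n M v x * f x + f' v x"]) auto
  with f'(2) show "\<exists>f'. (\<forall>x. (g has_derivative f' x) (at x)) \<and>
      (\<forall>v. (\<lambda>x. f' x v) \<in> {\<lambda>z. profile n M z * f (fst z) |f. f \<in> symbols})"
    by (intro exI[of _ "\<lambda>z v. profile n M z * (profile_log_deriv n M v (fst z) * f (fst z) + f' v (fst z))"]) blast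
qed

lemma smooth_profile: "smooth_on UNIV (profile n M)"
  using smooth_profile_symbol[OF symbols.const[of 1]] by simp

lemma profile_space_deriv:
  assumes "f \<in> symbols"
  shows "\<exists>g\<in>symbols. \<forall>M. dir_deriv (b, 0) (\<lambda>z. profile n M z * f (fst z)) = (\<lambda>z. profile n M z * g (fst z))"
proof -
  obtain f' where f': "\<forall>v. f' v \<in> symbols" "\<forall>M z. ((\<lambda>z. profile n M z * f (fst z)) has_derivative
      (\<lambda>v. profile n M z * (profile_log_deriv n M v (fst z) * f (fst z) + f' v (fst z)))) (at z)"
    using profile_symbol_derivative[OF assms] by blast
  \<comment> \<open>A purely spatial direction does not see the decay in time, so one symbol serves
    all \<open>M\<close>.\<close>
  have eq: "profile_log_deriv n M (b, 0) = profile_log_deriv n 0 (b, 0)" for M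
    by (simp add: profile_log_deriv_def fun_eq_iff)
  have "dir_deriv (b, 0) (\<lambda>z. profile n M z * f (fst z)) =
     (\<lambda>z. profile n M z * (profile_log_deriv n 0 (b, 0) (fst z) * f (fst z) + f' (b, 0) (fst z)))" for M
    by (rule ext, subst eq[symmetric, of M], rule dir_deriv_eq) (use f'(2) in blast)
  moreover have "(\<lambda>x. profile_log_deriv n 0 (b, 0) x * f x + f' (b, 0) x) \<in> symbols"
    using symbols.add[OF symbols.mult[OF profile_log_deriv_symbol assms] f'(1)[rule_format]] .
  ultimately show ?thesis
    by (intro bexI[of _ "\<lambda>x. profile_log_deriv n 0 (b, 0) x * f x + f' (b, 0) x"]) auto
qed

text \<open>The symbol precedes \<open>M\<close> in the quantifiers because \<open>M\<close> will
  later be chosen in terms of a bound for it.\<close>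

lemma profile_polyharmonic:
  "\<exists>g\<in>symbols. \<forall>M. space_polyharmonic m (profile n M :: 'a::euclidean_space \<times> real \<Rightarrow> real) = (\<lambda>z. profile n M z * g (fst z))"
proof (induction m)
  case 0
  show ?case by (rule bexI[OF _ symbols.const[of 1]]) (simp add: space_polyharmonic_0)
next
  case (Suc m)
  then obtain f :: "'a \<Rightarrow> real" where f: "f \<in> symbols"
    "\<And>M. space_polyharmonic m (profile n M) = (\<lambda>z. profile n M z * f (fst z))" by blast
  have "\<exists>g\<in>symbols. \<forall>M. dir_deriv (b, 0) (dir_deriv (b, 0) (\<lambda>z. profile n M z * f (fst z))) = (\<lambda>z. profile n M z * g (fst z))" for b
  proof -
    obtain g where g: "g \<in> symbols"
      "\<And>M. dir_deriv (b, 0) (\<lambda>z. profile n M z * f (fst z)) = (\<lambda>z. profile n M z * g (fst z))"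
      using profile_space_deriv[OF f(1)] by blast
    show ?thesis unfolding g(2) by (rule profile_space_deriv[OF g(1)])
  qed
  then obtain g where g: "\<And>b. g b \<in> symbols"
    "\<And>b M. dir_deriv (b, 0) (dir_deriv (b, 0) (\<lambda>z. profile n M z * f (fst z))) = (\<lambda>z. profile n M z * g b (fst z))"
    by metis
  have "space_polyharmonic (Suc m) (profile n M) = (\<lambda>z. profile n M z * ((- 1) * (\<Sum>b\<in>Basis. g b (fst z))))" for M
    by (simp add: space_polyharmonic_Suc f(2) space_laplacian_def g(2) sum_distrib_left sum_negf)
  moreover have "(\<lambda>x. (- 1) * (\<Sum>b\<in>Basis. g b x)) \<in> symbols"
    by (intro symbols_cmult symbols_sum g)
  ultimately show ?case by (intro bexI[of _ "\<lambda>x. (- 1) * (\<Sum>b\<in>Basis. g b x)"]) auto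
qed

lemma profile_time_deriv:
  "time_deriv i (profile n M :: 'a::euclidean_space \<times> real \<Rightarrow> real) = (\<lambda>z. (- M) ^ i * profile n M z)"
proof (induction i)
  case (Suc i)
  have "dir_deriv (0, 1) (profile n M) = (\<lambda>z :: 'a \<times> real. - M * profile n M z)"
    by (rule ext, subst dir_deriv_eq[OF profile_has_derivative]) (simp add: profile_log_deriv_def)
  then show ?case
    by (simp add: time_deriv_Suc Suc.IH dir_deriv_cmult smooth_profile mult_ac)
qed (simp add: time_deriv_0)

lemma profile_pos: "profile n M z > 0"
  by (simp add: profile_def)

lemma profile_split: "profile n M (x, t) = profile n 0 (x, 0) * exp (- M * t)"
  by (simp add: profile_def exp_diff exp_minus divide_inverse)

lemma profile_le_1: "profile n 0 (x, 0) \<le> 1"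
  by (simp add: profile_def sum_nonneg)

subsection \<open>The convolution of the profile\<close>

text \<open>The arctangent is a primitive on one half-line, and reflection gives the other. Counting
  the point 0 twice is harmless for an upper bound.\<close>

lemma nn_integral_inverse_1_plus_square:
  "(\<integral>\<^sup>+y. ennreal (1 / (1 + y\<^sup>2)) \<partial>lborel) < \<infinity>"
proof -
  let ?f = "\<lambda>y::real. 1 / (1 + y\<^sup>2)"
  have half: "(\<integral>\<^sup>+y. ennreal (?f y) * indicator {0..} y \<partial>lborel) = ennreal (pi / 2 - arctan 0)"
  proof (rule nn_integral_FTC_atLeast)
    show "(arctan has_real_derivative ?f y) (at y)" for y
      using DERIV_arctan[of y] by (simp add: divide_inverse)
  qed (auto intro: tendsto_arctan_at_top)
  have "(\<integral>\<^sup>+y. ennreal (?f y) * indicator {..0} y \<partial>lborel)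
      = (\<integral>\<^sup>+y. ennreal (?f (0 + (- 1) * y)) * indicator {..0} (0 + (- 1) * y) \<partial>lborel)"
    by (subst nn_integral_real_affine[of _ "- 1" 0]) auto
  also have "\<dots> = (\<integral>\<^sup>+y. ennreal (?f y) * indicator {0..} y \<partial>lborel)"
    by (intro nn_integral_cong) (auto simp: indicator_def)
  finally have "(\<integral>\<^sup>+y. ennreal (?f y) * indicator {0..} y + ennreal (?f y) * indicator {..0} y \<partial>lborel) < \<infinity>"
    by (subst nn_integral_add) (auto simp: half)
  then show ?thesis
    by (rule le_less_trans[rotated]) (intro nn_integral_mono, auto simp: indicator_def)
qed

text \<open>The integrand is a product of functions of one coordinate each, and n p >= 1 makes every
  factor at most 1/(1+y^2).\<close>

lemma profile_powr_integrable:
  assumes "real n * p \<ge> 1"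
  shows "integrable lborel (\<lambda>y::'a::euclidean_space. profile n 0 (y, 0) powr p)"
proof -
  let ?g = "\<lambda>y::real. exp (- (real n * p) * ln (1 + y\<^sup>2))"
  have meas: "(\<lambda>y::'a. profile n 0 (y, 0)) \<in> borel_measurable borel"
    by (intro borel_measurable_continuous_onI continuous_on_compose2[OF smooth_continuous[OF smooth_profile]])
       (auto intro!: continuous_intros)
  have eq: "profile n 0 (y, 0) powr p = (\<Prod>b\<in>Basis. ?g (y \<bullet> b))" for y :: 'a
    by (simp add: profile_def powr_def sum_distrib_left algebra_simps flip: exp_sum sum_negf)
  have "?g y \<le> 1 / (1 + y\<^sup>2)" for y
  proof -
    have "1 * ln (1 + y\<^sup>2) \<le> real n * p * ln (1 + y\<^sup>2)" using assms by (intro mult_right_mono) auto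
    then have "?g y \<le> exp (- ln (1 + y\<^sup>2))" by simp
    also have "\<dots> = 1 / (1 + y\<^sup>2)" by (simp add: exp_minus add_pos_nonneg divide_inverse)
    finally show ?thesis .
  qed
  then have "(\<integral>\<^sup>+y. ennreal (?g y) \<partial>lborel) \<le> (\<integral>\<^sup>+y. ennreal (1 / (1 + y\<^sup>2)) \<partial>lborel)"
    by (intro nn_integral_mono ennreal_leI)
  then have fin: "(\<integral>\<^sup>+y. ennreal (?g y) \<partial>lborel) < \<infinity>"
    using nn_integral_inverse_1_plus_square by (rule le_less_trans)
  have "(\<integral>\<^sup>+y. ennreal (profile n 0 (y, 0) powr p) \<partial>(lborel :: 'a measure)) = (\<integral>\<^sup>+y. (\<Prod>b\<in>Basis. ennreal (?g (y \<bullet> b))) \<partial>(lborel :: 'a measure))"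
    unfolding eq by (simp add: prod_ennreal)
  also have "\<dots> = (\<Prod>b\<in>(Basis :: 'a set). (\<integral>\<^sup>+y. ennreal (?g y) \<partial>lborel))"
    by (rule nn_integral_lborel_prod) auto
  also have "\<dots> < \<infinity>" using fin by (simp add: power_less_top_ennreal)
  finally show ?thesis
    using meas by (intro integrableI_nonneg) auto
qed

lemma nn_integral_lborel_reflect:
  fixes x :: "'a::euclidean_space"
  assumes [measurable]: "h \<in> borel_measurable borel"
  shows "(\<integral>\<^sup>+y. h (x - y) \<partial>lborel) = (\<integral>\<^sup>+y. h y \<partial>lborel)"
  by (subst (2) lborel_affine[of "- 1" x]) (simp_all add: nn_integral_density nn_integral_distr)

text \<open>Near the singularity, \<open>K\<close> is integrable and \<open>W\<close> is at most 1;
  far from it, \<open>K\<close> is bounded and \<open>W\<close> is integrable. Translation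
  invariance makes the bound uniform in \<open>x\<close>.\<close>

lemma kernel_convolution_bound:
  fixes K :: "real \<Rightarrow> real" and W :: "'a::euclidean_space \<Rightarrow> real"
  assumes contK: "continuous_on {0<..} K" and Kpos: "\<And>r. r > 0 \<Longrightarrow> K r > 0"
    and Kloc: "L1_loc UNIV (\<lambda>x::'a. K (norm x))"
    and Kinf: "\<exists>R0. \<forall>R>R0. (INF r\<in>{0<..<R}. K r) = K R"
    and W: "W \<in> borel_measurable borel" "\<And>x. 0 \<le> W x" "\<And>x. W x \<le> 1" "integrable lborel W"
  obtains B where "B \<ge> 0" "\<And>x. integrable lebesgue (\<lambda>y. K (norm (x - y)) * W y)"
    "\<And>x. (LINT y|lebesgue. K (norm (x - y)) * W y) \<le> B"
    "(\<lambda>x. LINT y|lebesgue. K (norm (x - y)) * W y) \<in> borel_measurable borel"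
proof -
  note [measurable] = W(1)
  obtain R0 where R0: "\<forall>R>R0. (INF r\<in>{0<..<R}. K r) = K R" using Kinf by blast
  define R1 where "R1 = max 1 (R0 + 1)"
  have R1: "R1 > 0" "R1 > R0" by (auto simp: R1_def)
  \<comment> \<open>For r > \<open>R1\<close> the point \<open>R1\<close> lies in the interval over
    which K(r) is the infimum.\<close>
  have K_far: "K r \<le> K R1" if "r > R1" for r
  proof -
    have "(INF y\<in>{0<..<r}. K y) \<le> K R1"
      using that R1 Kpos by (intro cINF_lower bdd_belowI2[where m=0]) (auto intro: less_imp_le)
    then show ?thesis using R0 R1 that by auto
  qed
  \<comment> \<open>\<open>K\<close> is continuous only on the positive reals and arbitrary
    elsewhere. \<open>K'\<close> is a Borel function that agrees with it on all nonnegative reals,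
    hence on norms.\<close>
  define K' where "K' = (\<lambda>r. indicator {0<..} r *\<^sub>R K r + indicator {..0} r * K 0)"
  have [measurable]: "K' \<in> borel_measurable borel"
    using borel_measurable_continuous_on_indicator[OF _ contK] unfolding K'_def by measurable
  have "K (norm x) = K' (norm x)" for x :: 'a
    by (simp add: K'_def indicator_def)
  then have meas[measurable]: "(\<lambda>x::'a. K (norm x)) \<in> borel_measurable borel"
    by simp
  let ?h = "\<lambda>x::'a. indicator (cball 0 R1) x * K (norm x)"
  have h_meas: "?h \<in> borel_measurable borel"
    by (intro borel_measurable_times borel_measurable_indicator meas) auto
  have h_int: "integrable lborel ?h"
  proof -
    have "set_integrable lebesgue (cball 0 R1) (\<lambda>x::'a. K (norm x))"
      using Kloc by (auto simp: L1_loc_def)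
    then have "integrable lebesgue ?h" by (simp add: set_integrable_def)
    with h_meas show ?thesis by (simp add: integrable_completion)
  qed
  define A where "A = integral\<^sup>L lborel (\<lambda>x. \<bar>?h x\<bar>)"
  define B where "B = A + K R1 * integral\<^sup>L lborel W"
  have A: "A \<ge> 0" by (simp add: A_def)
  have KR1: "K R1 > 0" using Kpos R1 by blast
  have W_int: "integral\<^sup>L lborel W \<ge> 0" using W(2) by simp
  have B: "B \<ge> 0" using A KR1 W_int by (simp add: B_def)
  let ?f = "\<lambda>x y. K (norm (x - y)) * W y"
  have f_meas[measurable]: "?f x \<in> borel_measurable borel" for x
    using measurable_compose[OF _ meas, of "\<lambda>y. x - y" borel] by measurable
  have f_nn: "AE y in lborel. 0 \<le> ?f x y" for x
  proof -
    have "AE y in lborel. y \<noteq> x" by (rule AE_lborel_singleton)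
    then show ?thesis by eventually_elim (auto intro!: mult_nonneg_nonneg less_imp_le[OF Kpos] W)
  qed
  have bound: "(\<integral>\<^sup>+y. ennreal (?f x y) \<partial>lborel) \<le> ennreal B" for x
  proof -
    have "(\<integral>\<^sup>+y. ennreal (?f x y) \<partial>lborel) \<le> (\<integral>\<^sup>+y. ennreal \<bar>?h (x - y)\<bar> + ennreal (K R1) * ennreal (W y) \<partial>lborel)"
    proof (rule nn_integral_mono_AE)
      have "AE y in lborel. y \<noteq> x" by (rule AE_lborel_singleton)
      then show "AE y in lborel. ennreal (?f x y) \<le> ennreal \<bar>?h (x - y)\<bar> + ennreal (K R1) * ennreal (W y)"
      proof eventually_elim
        case (elim y)
        then have pos: "K (norm (x - y)) > 0" by (intro Kpos) simp
        have "?f x y \<le> \<bar>?h (x - y)\<bar> + K R1 * W y"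
        proof (cases "norm (x - y) \<le> R1")
          case True
          then have "?f x y \<le> \<bar>?h (x - y)\<bar>"
            using pos W(3)[of y] by (simp add: mult_left_le)
          then show ?thesis using KR1 W(2)[of y] by (simp add: add_increasing2)
        next
          case False
          then have "?f x y \<le> K R1 * W y" using K_far W(2) by (intro mult_right_mono) auto
          then show ?thesis using False by simp
        qed
        then have "ennreal (?f x y) \<le> ennreal (\<bar>?h (x - y)\<bar> + K R1 * W y)" by (rule ennreal_leI)
        then show ?case using KR1 W(2)[of y] by (simp add: ennreal_mult)
      qed
    qed
    also have "\<dots> = (\<integral>\<^sup>+y. ennreal \<bar>?h (x - y)\<bar> \<partial>lborel) + ennreal (K R1) * (\<integral>\<^sup>+y. ennreal (W y) \<partial>lborel)"
      using measurable_compose[OF _ h_meas, of "\<lambda>y. x - y" borel]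
      by (subst nn_integral_add) (auto simp: nn_integral_cmult)
    also have "(\<integral>\<^sup>+y. ennreal \<bar>?h (x - y)\<bar> \<partial>lborel) = (\<integral>\<^sup>+y. ennreal \<bar>?h y\<bar> \<partial>lborel)"
      by (rule nn_integral_lborel_reflect[of "\<lambda>y. ennreal \<bar>?h y\<bar>"]) (use h_meas in auto)
    also have "\<dots> = ennreal A"
      unfolding A_def using h_int by (intro nn_integral_eq_integral) auto
    also have "(\<integral>\<^sup>+y. ennreal (W y) \<partial>lborel) = ennreal (integral\<^sup>L lborel W)"
      using W by (intro nn_integral_eq_integral) auto
    finally show ?thesis
      using A KR1 W_int by (simp add: B_def ennreal_mult)
  qed
  have int: "integrable lborel (?f x)" for x
    using f_nn[of x] bound[of x] by (intro integrableI_nonneg) (auto intro: le_less_trans)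
  show ?thesis
  proof (rule that[OF B])
    show "integrable lebesgue (?f x)" for x using int by (simp add: integrable_completion)
    have eq: "(LINT y|lebesgue. ?f x y) = (LINT y|lborel. ?f x y)" for x by (simp add: integral_completion)
    have "ennreal (LINT y|lborel. ?f x y) \<le> ennreal B" for x
      using nn_integral_eq_integral[OF int f_nn, of x] bound[of x] by simp
    then show "(LINT y|lebesgue. ?f x y) \<le> B" for x
      unfolding eq using B by (simp add: ennreal_le_iff)
    have "(\<lambda>(x, y). x - y :: 'a) \<in> borel_measurable (borel \<Otimes>\<^sub>M borel)" by measurable
    from measurable_compose[OF this meas]
    have "(\<lambda>x. LINT y|lborel. ?f x y) \<in> borel_measurable borel"
      by (intro lborel.borel_measurable_lebesgue_integral) (auto simp: case_prod_unfold intro!: borel_measurable_times measurable_compose[OF measurable_snd])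
    then show "(\<lambda>x. LINT y|lebesgue. ?f x y) \<in> borel_measurable borel" by (simp add: eq)
  qed
qed

section \<open>Green's formula on the half-space\<close>

text \<open>In a Euclidean space this is compactness of the support, in a form that passes directly
  to products and derivatives.\<close>

definition vanishes_far :: "('b::real_normed_vector \<Rightarrow> real) \<Rightarrow> bool" where
  "vanishes_far \<psi> \<longleftrightarrow> (\<exists>r. \<forall>z. r < norm z \<longrightarrow> \<psi> z = 0)"

lemma vanishes_far_mult: "vanishes_far g \<Longrightarrow> vanishes_far (\<lambda>z. f z * g z)"
  by (auto simp: vanishes_far_def)

lemma vanishes_far_uminus: "vanishes_far g \<Longrightarrow> vanishes_far (\<lambda>z. - g z)"
  by (auto simp: vanishes_far_def)

lemma vanishes_far_dir_deriv:
  fixes \<psi> :: "'b::euclidean_space \<Rightarrow> real"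
  assumes "vanishes_far \<psi>" shows "vanishes_far (dir_deriv v \<psi>)"
proof -
  obtain r where r: "\<And>z. r < norm z \<Longrightarrow> \<psi> z = 0" using assms by (auto simp: vanishes_far_def)
  have "open {z :: 'b. r < norm z}" by (intro open_Collect_less continuous_intros)
  then have "dir_deriv v \<psi> z = 0" if "r < norm z" for z
    by (rule dir_deriv_locally_constant[where c=0]) (use r that in auto)
  then show ?thesis by (auto simp: vanishes_far_def)
qed

lemma vanishes_far_sum:
  assumes "finite I" "\<And>i. i \<in> I \<Longrightarrow> vanishes_far (f i)" shows "vanishes_far (\<lambda>z. \<Sum>i\<in>I. f i z)"
  using assms
proof (induction I)
  case (insert i I)
  then have "vanishes_far (f i)" "vanishes_far (\<lambda>z. \<Sum>i\<in>I. f i z)" by auto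
  then obtain r s where "\<forall>z. r < norm z \<longrightarrow> f i z = 0" "\<forall>z. s < norm z \<longrightarrow> (\<Sum>i\<in>I. f i z) = 0"
    unfolding vanishes_far_def by blast
  then show ?case using insert by (auto simp: vanishes_far_def intro!: exI[of _ "max r s"])
qed (simp add: vanishes_far_def)

lemma vanishes_far_bounded:
  fixes \<psi> :: "'b::euclidean_space \<Rightarrow> real"
  assumes "continuous_on UNIV \<psi>" "vanishes_far \<psi>"
  obtains C where "C \<ge> 0" "\<And>z. \<bar>\<psi> z\<bar> \<le> C"
proof -
  obtain r where r: "\<And>z. r < norm z \<Longrightarrow> \<psi> z = 0" using assms by (auto simp: vanishes_far_def)
  have "bounded (\<psi> ` cball 0 r)"
    using assms by (intro compact_imp_bounded compact_continuous_image) (auto intro: continuous_on_subset)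
  then obtain C where C: "\<forall>z\<in>cball 0 r. \<bar>\<psi> z\<bar> \<le> C" by (auto simp: bounded_iff)
  have "\<bar>\<psi> z\<bar> \<le> max C 0" for z
    using C r[of z] by (cases "r < norm z") (auto simp: le_max_iff_disj)
  then show ?thesis by (intro that[of "max C 0"]) auto
qed

lemma vanishes_far_integrable:
  fixes \<psi> :: "'b::euclidean_space \<Rightarrow> real"
  assumes "continuous_on UNIV \<psi>" "vanishes_far \<psi>"
  shows "integrable lborel \<psi>"
proof -
  obtain r where r: "\<And>z. r < norm z \<Longrightarrow> \<psi> z = 0" using assms by (auto simp: vanishes_far_def)
  have "integrable lborel (\<lambda>z. indicator (cball 0 r) z *\<^sub>R \<psi> z)"
    using assms by (intro borel_integrable_compact) (auto intro: continuous_on_subset)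
  also have "(\<lambda>z. indicator (cball 0 r) z *\<^sub>R \<psi> z) = \<psi>"
    using r by (auto simp: fun_eq_iff indicator_def not_le)
  finally show ?thesis .
qed

lemma test_function_vanishes_far:
  assumes "test_function \<phi>" shows "vanishes_far \<phi>"
proof -
  have "bounded {z. \<phi> z \<noteq> 0}" using assms by (simp add: test_function_def compact_closure)
  then obtain r where "\<forall>z\<in>{z. \<phi> z \<noteq> 0}. norm z \<le> r" by (auto simp: bounded_iff)
  then show ?thesis unfolding vanishes_far_def by (intro exI[of _ r]) force
qed

lemma integrable_half_space:
  fixes f :: "'a::euclidean_space \<times> real \<Rightarrow> real"
  assumes "continuous_on UNIV f" "vanishes_far f"
  shows "integrable lborel (\<lambda>z. indicator half_space z * f z)"
  using integrable_mult_indicator[OF _ vanishes_far_integrable[OF assms], of half_space] half_space_measurable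
  by simp

text \<open>
  Translations along \<open>(b, 0)\<close> preserve the half-space, so the integrals of all difference quotients
  in that direction vanish.
\<close>

lemma integral_half_space_space_deriv:
  fixes H :: "'a::euclidean_space \<times> real \<Rightarrow> real"
  assumes H: "smooth_on UNIV H" "vanishes_far H"
  shows "(\<integral>z. indicator half_space z * dir_deriv (b, 0) H z \<partial>lborel) = 0"
proof -
  define v where "v = (b, 0 :: real)"
  define h where "h = (\<lambda>n. 1 / real (Suc n))"
  have h: "0 < h n" "h n \<le> 1" for n by (auto simp: h_def)
  have h_lim: "h \<longlonglongrightarrow> 0" unfolding h_def by (rule lim_1_over_n[THEN LIMSEQ_Suc])
  have contH: "continuous_on UNIV H" by (rule smooth_continuous[OF H(1)])
  have contD: "continuous_on UNIV (dir_deriv v H)" by (rule smooth_continuous[OF smooth_dir_deriv[OF H(1)]])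
  obtain C where C: "C \<ge> 0" "\<And>z. \<bar>dir_deriv v H z\<bar> \<le> C"
    using vanishes_far_bounded[OF contD vanishes_far_dir_deriv[OF H(2)]] by blast
  obtain r where r: "\<And>z. r < norm z \<Longrightarrow> H z = 0" using H(2) by (auto simp: vanishes_far_def)
  let ?q = "\<lambda>n z. (H (z + h n *\<^sub>R v) - H z) / h n"
  have [measurable]: "H \<in> borel_measurable borel" "dir_deriv v H \<in> borel_measurable borel"
    "half_space \<in> sets (borel :: ('a \<times> real) measure)"
    using contH contD half_space_measurable by (auto intro: borel_measurable_continuous_onI)
  have contS: "continuous_on UNIV (\<lambda>z. H (z + c))" for c
    by (rule continuous_on_compose2[OF contH]) (auto intro!: continuous_intros)
  then have [measurable]: "(\<lambda>z. H (z + c)) \<in> borel_measurable borel" for c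
    by (rule borel_measurable_continuous_onI)
  have lim: "(\<lambda>n. \<integral>z. indicator half_space z * ?q n z \<partial>lborel) \<longlonglongrightarrow> (\<integral>z. indicator half_space z * dir_deriv v H z \<partial>lborel)"
  \<comment> \<open>By the mean value theorem the difference quotients are bounded by
    \<open>C\<close>, the bound for the derivative; as \<open>h n\<close> <= 1, all of them vanish
    outside one ball.\<close>
  proof (rule integral_dominated_convergence[where w="\<lambda>z. C * indicator (cball 0 (r + norm v)) z"])
    show "AE z in lborel. (\<lambda>n. indicator half_space z * ?q n z) \<longlonglongrightarrow> indicator half_space z * dir_deriv v H z"
    proof (rule AE_I2)
      fix z :: "'a \<times> real"
      have "((\<lambda>s. (H (z + s *\<^sub>R v) - H z) / s) \<longlongrightarrow> dir_deriv v H z) (at 0)"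
        using DERIV_line[OF H(1), of z v 0] by (simp add: has_field_derivative_iff)
      then have "(\<lambda>n. ?q n z) \<longlonglongrightarrow> dir_deriv v H z"
        by (rule filterlim_compose) (use h h_lim in \<open>auto simp: filterlim_at less_imp_neq[symmetric] intro!: always_eventually\<close>)
      then show "(\<lambda>n. indicator half_space z * ?q n z) \<longlonglongrightarrow> indicator half_space z * dir_deriv v H z"
        by (intro tendsto_mult tendsto_const)
    qed
    show "AE z in lborel. norm (indicator half_space z * ?q n z) \<le> C * indicator (cball 0 (r + norm v)) z" for n
    proof (rule AE_I2)
      fix z :: "'a \<times> real"
      have "\<bar>?q n z\<bar> \<le> C * indicator (cball 0 (r + norm v)) z"
      proof (cases "norm z \<le> r + norm v")
        case True
        obtain s where "H (z + h n *\<^sub>R v) - H (z + 0 *\<^sub>R v) = (h n - 0) * dir_deriv v H (z + s *\<^sub>R v)"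
          using MVT2[OF h(1)[of n], of "\<lambda>s. H (z + s *\<^sub>R v)" "\<lambda>s. dir_deriv v H (z + s *\<^sub>R v)"] DERIV_line[OF H(1)]
          by blast
        then have "?q n z = dir_deriv v H (z + s *\<^sub>R v)" using h(1)[of n] by (simp add: field_simps)
        then show ?thesis using C True by simp
      next
        case False
        have "norm (h n *\<^sub>R v) \<le> norm v" using h[of n] by (simp add: mult_left_le_one_le)
        then have "r < norm (z + h n *\<^sub>R v)" using False norm_triangle_ineq4[of "z + h n *\<^sub>R v" "h n *\<^sub>R v"] by simp
        moreover have "r < norm z" using False norm_ge_zero[of v] by linarith
        ultimately show ?thesis using r C by simp
      qed
      then show "norm (indicator half_space z * ?q n z) \<le> C * indicator (cball 0 (r + norm v)) z"
        using C(1) by (auto simp: indicator_def)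
    qed
    show "integrable lborel (\<lambda>z. C * indicator (cball 0 (r + norm v)) z :: real)"
      by (intro integrable_mult_right integrable_real_indicator) (use emeasure_bounded_finite[OF bounded_cball] in auto)
  qed measurable
  have zero: "(\<integral>z. indicator half_space z * ?q n z \<partial>lborel) = 0" for n
  proof -
    define c where "c = h n *\<^sub>R v"
    have inv: "z + c \<in> half_space \<longleftrightarrow> z \<in> half_space" for z
      by (cases z) (simp add: c_def v_def mem_half_space)
    have "vanishes_far (\<lambda>z. H (z + c))"
    proof -
      have "H (z + c) = 0" if "r + norm c < norm z" for z
        using r that norm_triangle_ineq4[of "z + c" c] by simp
      then show ?thesis unfolding vanishes_far_def by blast
    qed
    then have i1: "integrable lborel (\<lambda>z. indicator half_space z * H (z + c))"
      by (intro integrable_half_space contS)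
    have i2: "integrable lborel (\<lambda>z. indicator half_space z * H z)"
      by (intro integrable_half_space contH H)
    have "(\<integral>z. indicator half_space z * H (z + c) \<partial>lborel) = (\<integral>z. indicator half_space (c + z) * H (c + z) \<partial>lborel)"
      by (simp add: indicator_def inv add.commute[of c])
    also have "\<dots> = (\<integral>z. indicator half_space z * H z \<partial>distr lborel borel ((+) c))"
      by (rule integral_distr[symmetric]) auto
    also have "\<dots> = (\<integral>z. indicator half_space z * H z \<partial>lborel)"
      by (simp add: lborel_distr_plus)
    finally have "(\<integral>z. indicator half_space z * H (z + c) - indicator half_space z * H z \<partial>lborel) = 0"
      using i1 i2 by simp
    then have "(\<integral>z. (indicator half_space z * H (z + c) - indicator half_space z * H z) / h n \<partial>lborel) = 0"
      by simp
    then show ?thesis by (simp add: c_def algebra_simps)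
  qed
  show ?thesis using LIMSEQ_unique[OF lim[unfolded zero] tendsto_const] by (simp add: v_def)
qed

text \<open>On each line with \<open>x\<close> fixed, the fundamental theorem of calculus is applied
  up to a time beyond the support, so only the contribution at t = 0 remains; Fubini then integrates
  it over \<open>x\<close>.\<close>

lemma integral_half_space_time_deriv:
  fixes H :: "'a::euclidean_space \<times> real \<Rightarrow> real"
  assumes H: "smooth_on UNIV H" "vanishes_far H"
  shows "(\<integral>z. indicator half_space z * dir_deriv (0, 1) H z \<partial>lborel) = - (\<integral>x. H (x, 0) \<partial>lborel)"
proof -
  let ?D = "dir_deriv (0, 1) H"
  have contD: "continuous_on UNIV ?D" by (rule smooth_continuous[OF smooth_dir_deriv[OF H(1)]])
  obtain r1 r2 where r12: "\<And>z. r1 < norm z \<Longrightarrow> H z = 0" "\<And>z. r2 < norm z \<Longrightarrow> ?D z = 0"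
    using H(2) vanishes_far_dir_deriv[OF H(2)] unfolding vanishes_far_def by metis
  define r where "r = max 1 (max r1 r2 + 1)"
  have r: "\<And>x t. r \<le> t \<Longrightarrow> H (x, t) = 0" "\<And>x t. r \<le> t \<Longrightarrow> ?D (x, t) = 0" "r \<ge> 0"
  proof -
    fix x :: 'a and t :: real assume "r \<le> t"
    then have "r1 < \<bar>t\<bar>" "r2 < \<bar>t\<bar>" by (auto simp: r_def)
    then have "r1 < norm (x, t)" "r2 < norm (x, t)"
      using norm_snd_le[of "(x, t)"] by (simp_all add: norm_Pair) (metis less_le_trans real_norm_def real_sqrt_ge_abs2)+
    then show "H (x, t) = 0" "?D (x, t) = 0" using r12 by auto
  qed (simp add: r_def)
  have "integrable lborel (\<lambda>z. indicator half_space z * ?D z)"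
    by (intro integrable_half_space contD vanishes_far_dir_deriv H)
  then have int: "integrable (lborel \<Otimes>\<^sub>M lborel) (\<lambda>(x, t). indicator half_space (x, t) * ?D (x, t))"
    by (simp add: lborel_prod case_prod_unfold)
  have inner: "(\<integral>t. indicator half_space (x, t) * ?D (x, t) \<partial>lborel) = - H (x, 0)" for x
  proof -
    have deriv: "((\<lambda>t. H (x, t)) has_real_derivative ?D (x, t)) (at t)" for t
      using DERIV_line[OF H(1), of "(x, 0)" "(0, 1)" t] by simp
    have cont: "continuous_on UNIV (\<lambda>t. ?D (x, t))"
      by (rule continuous_on_compose2[OF contD]) (auto intro!: continuous_intros)
    have [measurable]: "(\<lambda>t. ?D (x, t)) \<in> borel_measurable borel"
      using cont by (rule borel_measurable_continuous_onI)
    have "(\<integral>t. indicator half_space (x, t) * ?D (x, t) \<partial>lborel) = (\<integral>t. ?D (x, t) * indicator {0..r} t \<partial>lborel)"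
    proof (rule integral_cong_AE)
      have "AE t in lborel. t \<noteq> (0::real)" by (rule AE_lborel_singleton)
      then show "AE t in lborel. indicator half_space (x, t) * ?D (x, t) = ?D (x, t) * indicator {0..r} t"
        by eventually_elim (use r in \<open>auto simp: indicator_def mem_half_space\<close>)
      have "indicator half_space (x, t) = (indicator {0<..} t :: real)" for t
        by (simp add: indicator_def mem_half_space)
      then show "(\<lambda>t. indicator half_space (x, t) * ?D (x, t)) \<in> borel_measurable lborel" by simp
    qed simp
    also have "\<dots> = H (x, r) - H (x, 0)"
      by (rule integral_FTC_Icc_real) (use r(3) deriv cont in \<open>auto simp: continuous_on_eq_continuous_at\<close>)
    finally show ?thesis using r(1) by simp
  qed
  have "(\<integral>z. indicator half_space z * ?D z \<partial>lborel) = (\<integral>x. (\<integral>t. indicator half_space (x, t) * ?D (x, t) \<partial>lborel) \<partial>lborel)"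
    by (subst lborel_pair.integral_fst[OF int]) (simp add: lborel_prod case_prod_unfold)
  also have "\<dots> = (\<integral>x. - H (x, 0) \<partial>lborel)" by (simp add: inner)
  finally show ?thesis by simp
qed

text \<open>Both formulas integrate a derivative of the product of \<open>f\<close> and
  \<open>\<psi>\<close>, which vanishes far out because \<open>\<psi>\<close> does. Only the time
  direction leaves a boundary term.\<close>

lemma integral_half_space_by_parts:
  fixes f \<psi> :: "'a::euclidean_space \<times> real \<Rightarrow> real"
  assumes f: "smooth_on UNIV f" and \<psi>: "smooth_on UNIV \<psi>" "vanishes_far \<psi>"
  shows "(\<integral>z. indicator half_space z * (f z * dir_deriv (b, 0) \<psi> z) \<partial>lborel)
      = - (\<integral>z. indicator half_space z * (dir_deriv (b, 0) f z * \<psi> z) \<partial>lborel)"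
    and "(\<integral>z. indicator half_space z * (f z * dir_deriv (0, 1) \<psi> z) \<partial>lborel)
      = - (\<integral>x. f (x, 0) * \<psi> (x, 0) \<partial>lborel) - (\<integral>z. indicator half_space z * (dir_deriv (0, 1) f z * \<psi> z) \<partial>lborel)"
proof -
  have int: "integrable lborel (\<lambda>z. indicator half_space z * (f z * dir_deriv v \<psi> z))"
    "integrable lborel (\<lambda>z. indicator half_space z * (dir_deriv v f z * \<psi> z))" for v
    by (intro integrable_half_space vanishes_far_mult vanishes_far_dir_deriv smooth_continuous smooth_mult
        smooth_dir_deriv f \<psi>)+
  have *: "(\<integral>z. indicator half_space z * dir_deriv v (\<lambda>z. f z * \<psi> z) z \<partial>lborel)
     = (\<integral>z. indicator half_space z * (f z * dir_deriv v \<psi> z) \<partial>lborel)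
       + (\<integral>z. indicator half_space z * (dir_deriv v f z * \<psi> z) \<partial>lborel)" for v
    unfolding dir_deriv_mult[OF f \<psi>(1)] using int[of v] by (simp add: distrib_left)
  show "(\<integral>z. indicator half_space z * (f z * dir_deriv (b, 0) \<psi> z) \<partial>lborel)
      = - (\<integral>z. indicator half_space z * (dir_deriv (b, 0) f z * \<psi> z) \<partial>lborel)"
    using *[of "(b, 0)"] integral_half_space_space_deriv[OF smooth_mult[OF f \<psi>(1)] vanishes_far_mult[OF \<psi>(2)]]
    by simp
  show "(\<integral>z. indicator half_space z * (f z * dir_deriv (0, 1) \<psi> z) \<partial>lborel)
      = - (\<integral>x. f (x, 0) * \<psi> (x, 0) \<partial>lborel) - (\<integral>z. indicator half_space z * (dir_deriv (0, 1) f z * \<psi> z) \<partial>lborel)"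
    using *[of "(0, 1)"] integral_half_space_time_deriv[OF smooth_mult[OF f \<psi>(1)] vanishes_far_mult[OF \<psi>(2)]]
    by simp
qed

section \<open>Moving the polyharmonic operator and the time derivatives onto the solution\<close>

lemma smooth_space_laplacian: "smooth_on UNIV f \<Longrightarrow> smooth_on UNIV (space_laplacian f)"
  unfolding space_laplacian_def[abs_def] by (intro smooth_sum smooth_dir_deriv)

lemma vanishes_far_space_laplacian: "vanishes_far f \<Longrightarrow> vanishes_far (space_laplacian f)"
  unfolding space_laplacian_def[abs_def] by (intro vanishes_far_sum vanishes_far_dir_deriv finite_Basis)

lemma vanishes_far_time_deriv:
  fixes \<phi> :: "'a::euclidean_space \<times> real \<Rightarrow> real"
  shows "vanishes_far \<phi> \<Longrightarrow> vanishes_far (time_deriv j \<phi>)"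
  by (rule time_deriv_graded[of "\<lambda>_. vanishes_far"]) (auto intro: vanishes_far_dir_deriv)

lemma vanishes_far_space_polyharmonic: "vanishes_far \<phi> \<Longrightarrow> vanishes_far (space_polyharmonic m \<phi>)"
  by (induction m) (simp_all add: space_polyharmonic_0 space_polyharmonic_Suc vanishes_far_uminus vanishes_far_space_laplacian)

text \<open>The induction for symmetry takes the outermost Laplacian off \<open>\<psi>\<close> and
  puts it on \<open>f\<close> as the innermost one, so the recursion is also needed at the other
  end.\<close>

lemma space_polyharmonic_Suc_right:
  "space_polyharmonic (Suc m) u = space_polyharmonic m (\<lambda>z. - space_laplacian u z)"
  by (induction m) (simp_all add: space_polyharmonic_0 space_polyharmonic_Suc)

lemma integral_half_space_laplacian:
  fixes f \<psi> :: "'a::euclidean_space \<times> real \<Rightarrow> real"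
  assumes f: "smooth_on UNIV f" and \<psi>: "smooth_on UNIV \<psi>" "vanishes_far \<psi>"
  shows "(\<integral>z. indicator half_space z * (f z * space_laplacian \<psi> z) \<partial>lborel)
      = (\<integral>z. indicator half_space z * (space_laplacian f z * \<psi> z) \<partial>lborel)"
proof -
  have eq: "(\<integral>z. indicator half_space z * (f z * dir_deriv (b, 0) (dir_deriv (b, 0) \<psi>) z) \<partial>lborel)
      = (\<integral>z. indicator half_space z * (dir_deriv (b, 0) (dir_deriv (b, 0) f) z * \<psi> z) \<partial>lborel)" for b
    using integral_half_space_by_parts(1)[OF f smooth_dir_deriv[OF \<psi>(1)] vanishes_far_dir_deriv[OF \<psi>(2)]]
      integral_half_space_by_parts(1)[OF smooth_dir_deriv[OF f] \<psi>]
    by simp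
  have int: "integrable lborel (\<lambda>z. indicator half_space z * (f z * dir_deriv v (dir_deriv v \<psi>) z))"
    "integrable lborel (\<lambda>z. indicator half_space z * (dir_deriv v (dir_deriv v f) z * \<psi> z))" for v
    by (intro integrable_half_space vanishes_far_mult vanishes_far_dir_deriv smooth_continuous smooth_mult
        smooth_dir_deriv f \<psi>)+
  show ?thesis
    unfolding space_laplacian_def sum_distrib_left sum_distrib_right
    by (subst (1 2) Bochner_Integration.integral_sum) (auto simp: int eq)
qed

lemma integral_half_space_polyharmonic:
  fixes f \<psi> :: "'a::euclidean_space \<times> real \<Rightarrow> real"
  assumes f: "smooth_on UNIV f" and \<psi>: "smooth_on UNIV \<psi>" "vanishes_far \<psi>"
  shows "(\<integral>z. indicator half_space z * (f z * space_polyharmonic m \<psi> z) \<partial>lborel)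
      = (\<integral>z. indicator half_space z * (space_polyharmonic m f z * \<psi> z) \<partial>lborel)"
  using f
proof (induction m arbitrary: f)
  case (Suc m)
  have "(\<integral>z. indicator half_space z * (f z * space_polyharmonic (Suc m) \<psi> z) \<partial>lborel)
      = - (\<integral>z. indicator half_space z * (f z * space_laplacian (space_polyharmonic m \<psi>) z) \<partial>lborel)"
    by (simp add: space_polyharmonic_Suc)
  also have "\<dots> = (\<integral>z. indicator half_space z * (- space_laplacian f z * space_polyharmonic m \<psi> z) \<partial>lborel)"
    using integral_half_space_laplacian[OF Suc.prems smooth_space_polyharmonic[OF \<psi>(1)]
        vanishes_far_space_polyharmonic[OF \<psi>(2)]] by simp
  also have "\<dots> = (\<integral>z. indicator half_space z * (space_polyharmonic m (\<lambda>z. - space_laplacian f z) z * \<psi> z) \<partial>lborel)"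
    by (rule Suc.IH) (intro smooth_minus smooth_space_laplacian Suc.prems)
  finally show ?case by (simp add: space_polyharmonic_Suc_right)
qed (simp add: space_polyharmonic_0)

text \<open>The time derivative of the profile is -M times the profile, and this sign cancels the
  one from integration by parts. Each step thus yields a factor \<open>M\<close> and one boundary
  term.\<close>

lemma integral_half_space_profile_time_deriv:
  fixes \<psi> :: "'a::euclidean_space \<times> real \<Rightarrow> real"
  assumes \<psi>: "smooth_on UNIV \<psi>" "vanishes_far \<psi>"
  shows "(\<integral>z. indicator half_space z * (profile n M z * time_deriv j \<psi> z) \<partial>lborel)
    = M ^ j * (\<integral>z. indicator half_space z * (profile n M z * \<psi> z) \<partial>lborel)
      - (\<Sum>i<j. M ^ (j - Suc i) * (\<integral>x. profile n M (x, 0) * time_deriv i \<psi> (x, 0) \<partial>lborel))"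
proof (induction j)
  case (Suc j)
  have "dir_deriv (0, 1) (profile n M) = (\<lambda>z :: 'a \<times> real. - M * profile n M z)"
    using profile_time_deriv[of 1 n M] by (simp add: time_deriv_Suc time_deriv_0)
  then have "(\<integral>z. indicator half_space z * (profile n M z * time_deriv (Suc j) \<psi> z) \<partial>lborel)
      = M * (\<integral>z. indicator half_space z * (profile n M z * time_deriv j \<psi> z) \<partial>lborel)
        - (\<integral>x. profile n M (x, 0) * time_deriv j \<psi> (x, 0) \<partial>lborel)"
    using integral_half_space_by_parts(2)[OF smooth_profile[of n M] smooth_time_deriv[OF \<psi>(1)]
        vanishes_far_time_deriv[OF \<psi>(2)]]
    by (simp add: time_deriv_Suc mult.left_commute[of "indicator _ _"] mult.assoc)
  also have "\<dots> = M ^ Suc j * (\<integral>z. indicator half_space z * (profile n M z * \<psi> z) \<partial>lborel)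
      - (\<Sum>i<Suc j. M ^ (Suc j - Suc i) * (\<integral>x. profile n M (x, 0) * time_deriv i \<psi> (x, 0) \<partial>lborel))"
    unfolding Suc.IH
    by (simp add: right_diff_distrib sum_distrib_left Suc_diff_le mult.assoc[symmetric]
        flip: power_Suc cong: sum.cong_simp) (auto intro!: sum.cong simp: Suc_diff_Suc mult.assoc)
  finally show ?case .
qed (simp add: time_deriv_0)

lemma L1_loc_continuous:
  fixes f :: "'b::euclidean_space \<Rightarrow> real"
  assumes "continuous_on UNIV f" shows "L1_loc S f"
  unfolding L1_loc_def
proof (intro allI impI)
  fix C assume "compact C \<and> C \<subseteq> S"
  then have "integrable lborel (\<lambda>x. indicator C x *\<^sub>R f x)"
    using assms by (intro borel_integrable_compact) (auto intro: continuous_on_subset)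
  then show "set_integrable lebesgue C f"
    unfolding set_integrable_def by (subst integrable_completion) auto
qed

section \<open>A positive solution with negative last initial datum\<close>

lemma positive_solution_exists:
  fixes K :: "real \<Rightarrow> real" and p q :: real and m k :: nat
  assumes k: "even k" "k \<ge> 1" and p: "p > 0" and q: "q \<ge> 1"
    and contK: "continuous_on {0<..} K" and Kpos: "\<And>r. r > 0 \<Longrightarrow> K r > 0"
    and Kloc: "L1_loc UNIV (\<lambda>x::'a::euclidean_space. K (norm x))"
    and Kinf: "\<exists>R0. \<forall>R>R0. (INF r\<in>{0<..<R}. K r) = K R"
  shows "\<exists>(u :: 'a \<times> real \<Rightarrow> real) U.
           smooth_solution k m K p q U u \<and> weak_solution k m K p q U u \<and>
           (\<forall>z\<in>half_space. u z > 0) \<and> (\<forall>x. U (k - 1) x < 0)"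
proof -
  obtain n :: nat where "1 / p \<le> real n" using real_arch_simple by blast
  then have n: "real n * p \<ge> 1" using p by (simp add: divide_le_eq)
  define W where "W = (\<lambda>y::'a. profile n 0 (y, 0) powr p)"
  have W01: "0 \<le> W y" "W y \<le> 1" for y
    using profile_le_1[of n y] profile_pos[of n 0 "(y, 0)"] p by (auto simp: W_def powr_le1)
  have W_int: "integrable lborel W" unfolding W_def by (rule profile_powr_integrable[OF n])
  then have W_meas: "W \<in> borel_measurable borel" using borel_measurable_integrable by force
  define c where "c = (\<lambda>x::'a. LINT y|lebesgue. K (norm (x - y)) * W y)"
  obtain B where B: "B \<ge> 0" "\<And>x::'a. integrable lebesgue (\<lambda>y. K (norm (x - y)) * W y)" "\<And>x. c x \<le> B"
    "c \<in> borel_measurable borel"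
    using kernel_convolution_bound[OF contK Kpos Kloc Kinf W_meas W01 W_int] unfolding c_def by blast
  have c0: "c x \<ge> 0" for x
  proof -
    have "AE y in lborel. y \<noteq> x" by (rule AE_lborel_singleton)
    then have "AE y in lborel. 0 \<le> K (norm (x - y)) * W y"
      by eventually_elim (auto intro!: mult_nonneg_nonneg less_imp_le[OF Kpos] W01)
    then show ?thesis unfolding c_def by (intro integral_nonneg_AE AE_completion)
  qed
  obtain g :: "'a \<Rightarrow> real" where g: "g \<in> symbols"
    "\<And>M. space_polyharmonic m (profile n M) = (\<lambda>z. profile n M z * g (fst z))"
    using profile_polyharmonic by blast
  obtain G where G: "\<And>x. \<bar>g x\<bar> \<le> G" using symbols_bounded[OF g(1)] by blast
  \<comment> \<open>\<open>B\<close> bounds the convolution and \<open>G\<close> the symbol of the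
    polyharmonic part. Neither depends on \<open>M\<close>: \<open>W\<close> is formed from the
    profile with parameter 0, and the symbol serves all \<open>M\<close>. The lower bound 1 turns B
    + G <= M into B + G <= M^k.\<close>
  define M where "M = max 1 (B + G)"
  have M: "M \<ge> 1" "B + G \<le> M ^ k"
  proof -
    show "M \<ge> 1" by (simp add: M_def)
    then show "B + G \<le> M ^ k" using self_le_power[of M k] k by (simp add: M_def)
  qed
  define u where "u = (profile n M :: 'a \<times> real \<Rightarrow> real)"
  define U where "U = (\<lambda>i x. (- M) ^ i * u (x, 0))"
  have u_pos: "u z > 0" for z by (simp add: u_def profile_pos)
  have u_smooth: "smooth_on UNIV u" by (simp add: u_def smooth_profile)
  have u_cont: "continuous_on UNIV u" by (rule smooth_continuous[OF u_smooth])
  have u_time: "time_deriv i u = (\<lambda>z. (- M) ^ i * u z)" for i by (simp add: u_def profile_time_deriv)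
  \<comment> \<open>The decay in time factors out of the convolution and leaves the fixed bounded
    function \<open>c\<close> of \<open>x\<close>.\<close>
  have conv_eq: "conv_integrand K p u (x, t) = (\<lambda>y. exp (- M * t) powr p * (K (norm (x - y)) * W y))" for x t
    by (simp add: conv_integrand_def u_def W_def profile_split[of n M] abs_mult powr_mult fun_eq_iff
        abs_of_pos[OF profile_pos])
  have conv_int: "integrable lebesgue (conv_integrand K p u z)" for z
    using B(2) by (cases z) (simp add: conv_eq)
  have conv_c: "conv K p u (x, t) = exp (- M * t) powr p * c x" for x t
    by (simp add: conv_def conv_eq c_def)
  have rhs0: "0 \<le> rhs_term K p q u z" for z
    using c0 by (cases z) (simp add: rhs_term_def conv_c)
  have rhs_le: "rhs_term K p q u z \<le> B * u z" if "snd z \<ge> 0" for z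
  proof -
    from that obtain x t where z: "z = (x, t)" "t \<ge> 0" by (cases z) auto
    have e1: "exp (- M * t) \<le> 1" using M z by simp
    have "u z \<le> 1"
      using mult_mono[OF profile_le_1[of n x] e1] profile_pos[of n 0 "(x, 0)"] by (simp add: u_def z profile_split[of n M])
    \<comment> \<open>This is where q >= 1 enters: since u <= 1 for t >= 0, the right-hand side is
      at most linear in u.\<close>
    then have "u z powr q \<le> u z"
      using powr_mono'[of 1 q "u z"] q u_pos[of z] by simp
    moreover have "conv K p u z \<le> B"
      using mult_mono[of "exp (- M * t) powr p" 1 "c x" B] B c0 e1 p by (simp add: z conv_c powr_le1)
    moreover have "conv K p u z \<ge> 0" using c0 by (simp add: z conv_c)
    ultimately show ?thesis
      unfolding rhs_term_def using u_pos[of z] B(1) by (intro mult_mono) auto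
  qed
  have rhs_meas: "rhs_term K p q u \<in> borel_measurable borel"
  proof -
    have "rhs_term K p q u = (\<lambda>z. exp (- M * snd z) powr p * c (fst z) * \<bar>u z\<bar> powr q)"
      by (auto simp: rhs_term_def conv_c)
    moreover have "(\<lambda>z::'a \<times> real. exp (- M * snd z) powr p) \<in> borel_measurable borel"
      by (intro borel_measurable_continuous_onI continuous_intros) auto
    moreover have "(\<lambda>z::'a \<times> real. c (fst z)) \<in> borel_measurable borel"
      by (rule measurable_compose[OF _ B(4)])
         (auto intro!: borel_measurable_continuous_onI continuous_on_fst continuous_on_id)
    moreover have "u \<in> borel_measurable borel" using u_cont by (rule borel_measurable_continuous_onI)
    ultimately show ?thesis by simp
  qed
  have poly_u: "space_polyharmonic m u = (\<lambda>z. u z * g (fst z))" by (simp add: u_def g(2))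
  have time_k: "time_deriv k u = (\<lambda>z. M ^ k * u z)" using k(1) by (simp add: u_time)
  have ineq: "rhs_term K p q u z \<le> M ^ k * u z + space_polyharmonic m u z" if "snd z \<ge> 0" for z
  proof -
    have "B * u z \<le> (M ^ k + g (fst z)) * u z"
      using M(2) G[of "fst z"] u_pos[of z] by (intro mult_right_mono) auto
    then show ?thesis using rhs_le[OF that] by (simp add: poly_u algebra_simps)
  qed
  have "smooth_solution k m K p q U u"
    unfolding smooth_solution_def
  proof (intro conjI ballI allI impI)
    show "smooth_on half_space u" using smooth_on_subset[OF u_smooth] by simp
    show "integrable lebesgue (conv_integrand K p u z)" for z by (rule conv_int)
    show "rhs_term K p q u z \<le> time_deriv k u z + space_polyharmonic m u z" if "z \<in> half_space" for z
      using that ineq[of z] by (auto simp: time_k half_space_def)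
    show "(time_deriv i u \<longlongrightarrow> U i x) (at (x, 0) within half_space)" for i x
    proof -
      have "continuous_on UNIV (time_deriv i u)" by (intro smooth_continuous smooth_time_deriv u_smooth)
      then have "(time_deriv i u \<longlongrightarrow> time_deriv i u (x, 0)) (at (x, 0))"
        by (simp add: continuous_on_eq_continuous_at isCont_def)
      then show ?thesis
        by (simp add: u_time U_def tendsto_within_subset[where T = half_space and S = UNIV])
    qed
  qed
  moreover have "weak_solution k m K p q U u"
    unfolding weak_solution_def
  proof (intro conjI allI impI)
    fix i
    show "L1_loc UNIV (U i)"
      unfolding U_def
      by (intro L1_loc_continuous continuous_on_mult continuous_on_const continuous_on_compose2[OF u_cont])
         (auto intro!: continuous_intros)
  next
    have "continuous_on UNIV (\<lambda>z. \<bar>u z\<bar> powr p)"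
      using u_pos by (intro continuous_intros u_cont) (auto simp: less_imp_neq[symmetric])
    then have "L1_loc closed_half_space (\<lambda>z. \<bar>u z\<bar> powr p)" by (rule L1_loc_continuous)
    moreover have "set_borel_measurable lebesgue C u" if "compact C" for C
      using compact_imp_closed[OF that] borel_measurable_continuous_onI[OF u_cont]
      unfolding set_borel_measurable_def
      by (intro borel_measurable_scaleR borel_measurable_indicator) (auto intro: measurable_completion)
    ultimately show "Lp_loc p closed_half_space u" by (simp add: Lp_loc_def L1_loc_def)
  next
    show "AE z in lebesgue. z \<in> half_space \<longrightarrow> integrable lebesgue (conv_integrand K p u z)"
      using conv_int by simp
  next
    show "L1_loc closed_half_space (rhs_term K p q u)"
      unfolding L1_loc_def set_integrable_def
    proof (intro allI impI)
      fix C :: "('a \<times> real) set" assume C: "compact C \<and> C \<subseteq> closed_half_space"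
      have bound_int: "integrable lborel (\<lambda>z. indicator C z *\<^sub>R (B * u z))"
        using C u_cont by (intro borel_integrable_compact continuous_on_mult continuous_on_const)
           (auto intro: continuous_on_subset)
      have meas: "(\<lambda>z. indicator C z *\<^sub>R rhs_term K p q u z) \<in> borel_measurable borel"
        using rhs_meas compact_imp_closed[OF conjunct1[OF C]] by (intro borel_measurable_scaleR borel_measurable_indicator) auto
      have le: "norm (indicator C z *\<^sub>R rhs_term K p q u z) \<le> norm (indicator C z *\<^sub>R (B * u z))" for z
        using C rhs0[of z] rhs_le[of z] by (cases "z \<in> C") (auto simp: closed_half_space_def)
      have "integrable lborel (\<lambda>z. indicator C z *\<^sub>R rhs_term K p q u z)"
        by (rule Bochner_Integration.integrable_bound[OF bound_int _ AE_I2[OF le]]) (simp add: meas del: real_scaleR_def)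
      then show "integrable lebesgue (\<lambda>z. indicator C z *\<^sub>R rhs_term K p q u z)"
        by (subst integrable_completion) (simp_all add: meas del: real_scaleR_def)
    qed
  next
    fix \<phi> :: "'a \<times> real \<Rightarrow> real" assume \<phi>: "test_function \<phi>"
    have \<phi>s: "smooth_on UNIV \<phi>" and \<phi>0: "\<And>z. \<phi> z \<ge> 0" and \<phi>v: "vanishes_far \<phi>"
      using \<phi> test_function_vanishes_far[OF \<phi>] unfolding test_function_def by blast+
    let ?T = "\<lambda>z. (-1)^k * time_deriv k \<phi> z + space_polyharmonic m \<phi> z"
    have int: "integrable lborel (\<lambda>z. indicator half_space z * (f z * \<psi> z))"
      if "smooth_on UNIV f" "smooth_on UNIV \<psi>" "vanishes_far \<psi>" for f \<psi> :: "'a \<times> real \<Rightarrow> real"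
      by (intro integrable_half_space vanishes_far_mult smooth_continuous smooth_mult that)
    note int_t = int[OF u_smooth smooth_time_deriv[OF \<phi>s] vanishes_far_time_deriv[OF \<phi>v], of k]
    note int_s = int[OF u_smooth smooth_space_polyharmonic[OF \<phi>s] vanishes_far_space_polyharmonic[OF \<phi>v], of m]
    note int_u = int[OF u_smooth \<phi>s \<phi>v]
    note int_p = int[OF smooth_space_polyharmonic[OF u_smooth] \<phi>s \<phi>v, of m]
    have uT: "indicator half_space z *\<^sub>R (u z * ?T z) =
       indicator half_space z * (u z * time_deriv k \<phi> z) + indicator half_space z * (u z * space_polyharmonic m \<phi> z)" for z
      using k(1) by (simp add: algebra_simps)
    have int_uT: "integrable lborel (\<lambda>z. indicator half_space z *\<^sub>R (u z * ?T z))"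
      unfolding uT using int_t int_s by (rule Bochner_Integration.integrable_add)
    have int_rhs: "integrable lborel (\<lambda>z. indicator half_space z *\<^sub>R (rhs_term K p q u z * \<phi> z))"
      and rhs_int_le: "(\<integral>z. indicator half_space z *\<^sub>R (rhs_term K p q u z * \<phi> z) \<partial>lborel)
        \<le> (\<integral>z. M ^ k * (indicator half_space z * (u z * \<phi> z)) + indicator half_space z * (space_polyharmonic m u z * \<phi> z) \<partial>lborel)"
      and meas_rhs: "(\<lambda>z. indicator half_space z *\<^sub>R (rhs_term K p q u z * \<phi> z)) \<in> borel_measurable borel"
    proof -
      let ?b = "\<lambda>z. M ^ k * (indicator half_space z * (u z * \<phi> z)) + indicator half_space z * (space_polyharmonic m u z * \<phi> z)"
      have b: "integrable lborel ?b" using int_u int_p by simp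
      show m: "(\<lambda>z. indicator half_space z *\<^sub>R (rhs_term K p q u z * \<phi> z)) \<in> borel_measurable borel"
        using rhs_meas half_space_measurable borel_measurable_continuous_onI[OF smooth_continuous[OF \<phi>s]]
        by (intro borel_measurable_scaleR borel_measurable_indicator borel_measurable_times) auto
      have le: "0 \<le> indicator half_space z *\<^sub>R (rhs_term K p q u z * \<phi> z)"
        "indicator half_space z *\<^sub>R (rhs_term K p q u z * \<phi> z) \<le> ?b z" for z
      proof -
        show "0 \<le> indicator half_space z *\<^sub>R (rhs_term K p q u z * \<phi> z)"
          using rhs0 \<phi>0 by simp
        show "indicator half_space z *\<^sub>R (rhs_term K p q u z * \<phi> z) \<le> ?b z"
        proof (cases "z \<in> half_space")
          case True
          then have "rhs_term K p q u z * \<phi> z \<le> (M ^ k * u z + space_polyharmonic m u z) * \<phi> z"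
            using ineq[of z] \<phi>0[of z] by (intro mult_right_mono) (auto simp: half_space_def)
          then show ?thesis using True by (simp add: algebra_simps)
        qed simp
      qed
      show i: "integrable lborel (\<lambda>z. indicator half_space z *\<^sub>R (rhs_term K p q u z * \<phi> z))"
      proof (rule Bochner_Integration.integrable_bound[OF b])
        show "AE z in lborel. norm (indicator half_space z *\<^sub>R (rhs_term K p q u z * \<phi> z)) \<le> norm (?b z)"
          using le by (intro AE_I2) (metis abs_of_nonneg order_trans real_norm_def)
      qed (use m in simp)
      show "(\<integral>z. indicator half_space z *\<^sub>R (rhs_term K p q u z * \<phi> z) \<partial>lborel) \<le> integral\<^sup>L lborel ?b"
        using i b le(2) by (rule integral_mono)
    qed
    have bdry: "(LINT x|lebesgue. U i x * time_deriv j \<phi> (x, 0))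
       = (- M) ^ i * (\<integral>x. u (x, 0) * time_deriv j \<phi> (x, 0) \<partial>lborel)" for i j
    proof -
      have "continuous_on UNIV (\<lambda>x. U i x * time_deriv j \<phi> (x, 0))"
        unfolding U_def
        by (intro continuous_intros continuous_on_compose2[OF u_cont]
              continuous_on_compose2[OF smooth_continuous[OF smooth_time_deriv[OF \<phi>s]]]) auto
      then have "(LINT x|lebesgue. U i x * time_deriv j \<phi> (x, 0)) = (LINT x|lborel. U i x * time_deriv j \<phi> (x, 0))"
        by (intro integral_completion) (simp add: borel_measurable_continuous_onI)
      then show ?thesis by (simp add: U_def mult.assoc)
    qed
    let ?E = "\<lambda>j. \<integral>x. u (x, 0) * time_deriv j \<phi> (x, 0) \<partial>lborel"
    have "(\<Sum>i=1..k. (-1)^i * (LINT x|lebesgue. U (k - i) x * time_deriv (i - 1) \<phi> (x, 0)))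
       = (\<Sum>j<k. (-1) ^ Suc j * ((- M) ^ (k - Suc j) * ?E j))"
      unfolding bdry by (simp add: sum.atLeast1_atMost_eq)
    \<comment> \<open>With j = i - 1, the sign of the weak formulation and the sign of the initial
      datum combine to (-1)^k, which is 1.\<close>
    also have "\<dots> = (\<Sum>j<k. M ^ (k - Suc j) * ?E j)"
    proof (rule sum.cong[OF refl])
      fix j assume "j \<in> {..<k}"
      then have "(-1) ^ Suc j * (- M) ^ (k - Suc j) = (-1) ^ (Suc j + (k - Suc j)) * M ^ (k - Suc j)"
        unfolding power_add power_minus[of M] by simp
      also have "Suc j + (k - Suc j) = k" using \<open>j \<in> {..<k}\<close> by simp
      finally show "(-1) ^ Suc j * ((- M) ^ (k - Suc j) * ?E j) = M ^ (k - Suc j) * ?E j"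
        using k(1) by (simp add: mult.assoc[symmetric])
    qed
    finally have sum_eq: "(\<Sum>i=1..k. (-1)^i * (LINT x|lebesgue. U (k - i) x * time_deriv (i - 1) \<phi> (x, 0)))
       = (\<Sum>j<k. M ^ (k - Suc j) * ?E j)" .
    have lebesgue_uT: "(LINT z:half_space|lebesgue. u z * ?T z) = (\<integral>z. indicator half_space z *\<^sub>R (u z * ?T z) \<partial>lborel)"
      unfolding set_lebesgue_integral_def using borel_measurable_integrable[OF int_uT] by (intro integral_completion) simp
    also have "\<dots> = (\<integral>z. indicator half_space z * (u z * time_deriv k \<phi> z) \<partial>lborel)
        + (\<integral>z. indicator half_space z * (u z * space_polyharmonic m \<phi> z) \<partial>lborel)"
      unfolding uT using int_t int_s by (rule Bochner_Integration.integral_add)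
    \<comment> \<open>The boundary terms of Green's formula are the negatives of the sum over the
      initial data. They cancel in the weak inequality, which thereby reduces to the integrated
      pointwise inequality.\<close>
    also have "\<dots> = (\<integral>z. M ^ k * (indicator half_space z * (u z * \<phi> z))
        + indicator half_space z * (space_polyharmonic m u z * \<phi> z) \<partial>lborel) - (\<Sum>j<k. M ^ (k - Suc j) * ?E j)"
      using integral_half_space_profile_time_deriv[OF \<phi>s \<phi>v, of n M k] int_u int_p
        integral_half_space_polyharmonic[OF u_smooth \<phi>s \<phi>v, of m]
      by (simp add: u_def)
    finally have "(LINT z:half_space|lebesgue. rhs_term K p q u z * \<phi> z)
        \<le> (\<Sum>i=1..k. (-1)^i * (LINT x|lebesgue. U (k - i) x * time_deriv (i - 1) \<phi> (x, 0)))
          + (LINT z:half_space|lebesgue. u z * ?T z)"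
      unfolding sum_eq using rhs_int_le meas_rhs
      by (simp add: set_lebesgue_integral_def integral_completion)
    moreover have "set_integrable lebesgue half_space (\<lambda>z. u z * ?T z)"
      unfolding set_integrable_def using int_uT borel_measurable_integrable[OF int_uT]
      by (subst integrable_completion) auto
    ultimately show "let L\<phi> = ?T in set_integrable lebesgue half_space (\<lambda>z. u z * L\<phi> z) \<and>
        (LINT z:half_space|lebesgue. rhs_term K p q u z * \<phi> z)
        \<le> (\<Sum>i=1..k. (-1)^i * (LINT x|lebesgue. U (k - i) x * time_deriv (i - 1) \<phi> (x, 0)))
          + (LINT z:half_space|lebesgue. u z * L\<phi> z)"
      by (simp add: Let_def)
  qed
  moreover have "U (k - 1) x < 0" for x
  proof -
    have "odd (k - 1)" using k by simp
    then show ?thesis using M(1) u_pos[of "(x, 0)"] by (simp add: U_def power_minus_odd)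
  qed
  ultimately show ?thesis using u_pos by blast
qed

theorem theorem1p1:
  fixes K :: "real \<Rightarrow> real" and p q :: real and m k :: nat
  assumes "m \<ge> 1" and "k \<ge> 1" and "p > 0" and "q > 0"
    and "continuous_on {0<..} K" and "\<forall>r>0. K r > 0"
    and "L1_loc UNIV (\<lambda>x::real^'n. K (norm x))"
    and "\<exists>R0>1. \<forall>R>R0. (INF r\<in>{0<..<R}. K r) = K R"
  shows
    "(even k \<and> q \<ge> 1 \<longrightarrow>
        (\<exists>(u :: (real^'n) \<times> real \<Rightarrow> real) U.
           smooth_solution k m K p q U u \<and> weak_solution k m K p q U u \<and>
           (\<forall>z\<in>half_space. u z > 0) \<and> (\<forall>x. U (k - 1) x < 0)))
     \<and>
     (p + q > 2 \<and>
      Limsup at_top (\<lambda>R::real. ereal (K R * R powr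
         ((2 * real CARD('n) + 2 * real m / real k) / (p + q) - real CARD('n)
           + 2 * real m * (1 - 1 / real k)))) > 0 \<longrightarrow>
        (\<forall>(u :: (real^'n) \<times> real \<Rightarrow> real) U.
           weak_solution k m K p q U u \<and>
           ((AE x in lebesgue. U (k - 1) x \<ge> 0) \<or>
            (integrable lebesgue (U (k - 1)) \<and> (LINT x|lebesgue. U (k - 1) x) > 0)) \<longrightarrow>
           (AE z in lebesgue. z \<in> half_space \<longrightarrow> u z = 0)))"
proof (intro conjI impI allI)
  have Kinf: "\<exists>R0. \<forall>R>R0. (INF r\<in>{0<..<R}. K r) = K R" using assms(8) by blast
  have Kpos: "\<And>r. r > 0 \<Longrightarrow> K r > 0" using assms(6) by blast
  show "\<exists>(u :: (real^'n) \<times> real \<Rightarrow> real) U.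
           smooth_solution k m K p q U u \<and> weak_solution k m K p q U u \<and>
           (\<forall>z\<in>half_space. u z > 0) \<and> (\<forall>x. U (k - 1) x < 0)" if "even k \<and> q \<ge> 1"
    using that by (intro positive_solution_exists assms Kpos Kinf) auto
  fix u :: "(real^'n) \<times> real \<Rightarrow> real" and U
  assume growth: "p + q > 2 \<and>
      Limsup at_top (\<lambda>R::real. ereal (K R * R powr
         ((2 * real CARD('n) + 2 * real m / real k) / (p + q) - real CARD('n)
           + 2 * real m * (1 - 1 / real k)))) > 0"
    and u: "weak_solution k m K p q U u \<and>
           ((AE x in lebesgue. U (k - 1) x \<ge> 0) \<or>
            (integrable lebesgue (U (k - 1)) \<and> (LINT x|lebesgue. U (k - 1) x) > 0))"
  show "AE z in lebesgue. z \<in> half_space \<longrightarrow> u z = 0"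
    by (rule weak_solution_eq_0[OF assms(1-4) conjunct1[OF growth] Kpos Kinf _ conjunct1[OF u] conjunct2[OF u]])
       (use growth in simp_all)
qed

end
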